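(* Let $\mathbf{M}$ be a compact smooth $m$-dimensional submanifold without boundary of $\mathbf{R}^s$, with cutlocus $\mathbf{C}$ and nearest-point mapping $\pi:\mathbf{R}^s\setminus\mathbf{C}\to\mathbf{M}$. Let $(t_n)$ be a sequence in $\mathbf{R}^s$, $(\tilde t_n)$ random vectors in $\mathbf{R}^s$, and $B_n$ nonsingular $s\times s$ matrices with $B_n\to 0$ such that $Z_n=B_n^{-1}(\tilde t_n-t_n)\xrightarrow{\mathcal D} Z$ for some random vector $Z$ in $\mathbf{R}^s$. Put $\mu_n=\pi(t_n)$, $\tilde\mu_n=\pi(\tilde t_n)$ and $G_n=\mathrm{I}_s-A_{t_n-\mu_n}\tan_{\mu_n}$. Suppose $t_n\notin\mathbf{C}$, $d(t_n,\mathbf{M})\le D$ for all $n$ (some constant $D>0$), and $\|B_n\|/d(t_n,\mathbf{C})\to0$. Let $\Gamma_n$ be $s\times s$ matrices such that $$\|\Gamma_n\|\,\|B_n\|^2/d(t_n,\mathbf{C})^2\to 0.$$ Then: 1. $\Gamma_nG_n(\tilde\mu_n-\mu_n)-(\Gamma_n\tan_{\mu_n}B_n)Z_n\to 0$ in probability. Suppose moreover that $Z$ is spherical and that the $\Gamma_n$ satisfy $\Gamma_n\tan_{\mu_n}B_nB_n^T\tan_{\mu_n}\Gamma_n^T=\tan_{\mu_n}$ for all $n$. Then: 2. If $\mu_n\to\mu$ for some $\mu\in\mathbf{M}$, then $\Gamma_nG_n(\tilde\mu_n-\mu_n)=(\Gamma_n\tan_{\mu_n}B_n)Z_n+o_P(1)\xrightarrow{\mathcal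 D}\tan_\mu Z$. 3. Without any restriction on $\mu_n$, $(\tilde\mu_n-\mu_n)^TG_n\Gamma_n^T\Gamma_nG_n(\tilde\mu_n-\mu_n)\xrightarrow{\mathcal D}\zeta_m^2$.
   Context: $\|\cdot\|$ is the Euclidean norm and the operator norm on matrices; $d(t,A)=\inf_{a\in A}\|t-a\|$. For $x\in\mathbf{R}^s$, $L_x(\mu)=\|\mu-x\|^2$ on $\mathbf{M}$; the cutlocus $\mathbf{C}$ is the set of $x$ for which the minimizer of $L_x$ on $\mathbf{M}$ is not unique or $L_x$ has degenerate Hessian at its minimizer; $\pi(x)=\arg\min_{\mu\in\mathbf{M}}\|\mu-x\|$ for $x\notin\mathbf{C}$. For $\mu\in\mathbf{M}$, $T_\mu\mathbf{M}$ and $N_\mu\mathbf{M}=(T_\mu\mathbf{M})^\perp$ are the tangent and normal spaces as linear subspaces of $\mathbf{R}^s$; $\tan_\mu$ and $\mathrm{nor}_\mu=\mathrm{I}_s-\tan_\mu$ are the orthogonal projections onto them (as $s\times s$ matrices). For $v\in N_\mu\mathbf{M}$, the Weingarten mapping $A_v:T_\mu\mathbf{M}\to T_\mu\mathbf{M}$ is $A_v(w)=-\tan_\mu(D_w\nu)$, where $\nu:\mathbf{M}\to\mathbf{R}^s$ is any smooth map with $\nu(\alpha)\in N_\alpha\mathbf{M}$ for all $\alpha$ and $\nu(\mu)=v$, and $D_w$ is the coordinatewise directional derivative; $A_v\tan_\mu$ is a symmetric $s\times s$ matrix. A random vector $Z$ in $\mathbf{R}^s$ is spherical if $HZ\overset{\mathcal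 D}{=}Z$ for every orthogonal $s\times s$ matrix $H$. For spherical $Z=(Z_1,\dots,Z_s)$, $\zeta_m^2$ denotes the distribution of $\sum_{i=1}^m Z_i^2$ (equal to the distribution of $Z^T\tan_\mu Z$ for any $\mu\in\mathbf{M}$). $o_P(1)$ denotes a term tending to $0$ in probability. *)

theory Defs
  imports "HOL-Analysis.Analysis" "HOL-Probability.Probability"
begin

fun Ck :: "nat \<Rightarrow> (real^'n) set \<Rightarrow> (real^'n \<Rightarrow> real) \<Rightarrow> bool" where
  "Ck 0 U g = continuous_on U g"
| "Ck (Suc k) U g =
     (\<exists>Dg :: 'n \<Rightarrow> real^'n \<Rightarrow> real.
        (\<forall>x\<in>U. (g has_derivative (\<lambda>h. \<Sum>i\<in>UNIV. Dg i x * h $ i)) (at x)) \<and>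
        (\<forall>i. Ck k U (Dg i)))"

definition smooth_on :: "(real^'n) set \<Rightarrow> (real^'n \<Rightarrow> real^'k) \<Rightarrow> bool" where
  "smooth_on U f \<longleftrightarrow> (\<forall>k j. Ck k U (\<lambda>x. f x $ j))"

definition chart ::
  "(real^'n) set \<Rightarrow> real^'n \<Rightarrow> (real^'n) set \<Rightarrow> (real^'n) set \<Rightarrow>
   (real^'n \<Rightarrow> real^'n) \<Rightarrow> (real^'n \<Rightarrow> real^'n) \<Rightarrow> (real^'n) set \<Rightarrow> bool" where
  "chart M p U V \<phi> \<psi> L \<longleftrightarrow>
     open U \<and> p \<in> U \<and> open V \<and> subspace L \<and>
     smooth_on U \<phi> \<and> smooth_on V \<psi> \<and> \<phi> ` U = V \<and>
     (\<forall>x\<in>U. \<psi> (\<phi> x) = x) \<and> (\<forall>y\<in>V. \<phi> (\<psi> y) = y) \<and>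
     \<phi> ` (M \<inter> U) = V \<inter> L"

definition submanifold :: "nat \<Rightarrow> (real^'n) set \<Rightarrow> bool" where
  "submanifold m M \<longleftrightarrow>
     (\<forall>p\<in>M. \<exists>U V \<phi> \<psi> L. chart M p U V \<phi> \<psi> L \<and> dim L = m)"

definition tangent_space :: "(real^'n) set \<Rightarrow> real^'n \<Rightarrow> (real^'n) set" where
  "tangent_space M \<mu> =
     {v. \<exists>\<gamma> e. 0 < e \<and> (\<forall>t\<in>{-e<..<e}. \<gamma> t \<in> M) \<and> \<gamma> 0 = \<mu> \<and>
              (\<gamma> has_vector_derivative v) (at 0)}"

definition normal_space :: "(real^'n) set \<Rightarrow> real^'n \<Rightarrow> (real^'n) set" where
  "normal_space M \<mu> = {v. \<forall>w\<in>tangent_space M \<mu>. v \<bullet> w = 0}"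

definition tanproj :: "(real^'n) set \<Rightarrow> real^'n \<Rightarrow> real^'n^'n" where
  "tanproj M \<mu> = (THE P. \<forall>x. P *v x \<in> tangent_space M \<mu> \<and> x - P *v x \<in> normal_space M \<mu>)"

text \<open>The matrix A_v tan_mu of the Weingarten mapping, x |-> -tan_mu (D_{tan_mu x} nu),
  for any smooth normal field nu (defined on an open neighbourhood of mu) with nu(mu) = v.\<close>
definition weingarten_tan :: "(real^'n) set \<Rightarrow> real^'n \<Rightarrow> real^'n \<Rightarrow> real^'n^'n" where
  "weingarten_tan M \<mu> v =
     (THE W. \<forall>U \<nu> \<nu>'. open U \<and> \<mu> \<in> U \<and> smooth_on U \<nu> \<and>
        (\<forall>\<alpha>\<in>M \<inter> U. \<nu> \<alpha> \<in> normal_space M \<alpha>) \<and> \<nu> \<mu> = v \<and>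
        (\<nu> has_derivative \<nu>') (at \<mu>) \<longrightarrow>
        W = - (tanproj M \<mu> ** matrix \<nu>' ** tanproj M \<mu>))"

definition hess_at :: "(real^'n \<Rightarrow> real) \<Rightarrow> real^'n \<Rightarrow> real^'n^'n \<Rightarrow> bool" where
  "hess_at h y H \<longleftrightarrow>
     (\<exists>g. eventually (\<lambda>z. (h has_derivative (\<lambda>u. g z \<bullet> u)) (at z)) (nhds y) \<and>
          (g has_derivative (\<lambda>u. H *v u)) (at y))"

text \<open>The Hessian of L_x restricted to M (computed in local coordinates) at mu is nondegenerate.\<close>
definition nondeg_hess :: "(real^'n) set \<Rightarrow> real^'n \<Rightarrow> real^'n \<Rightarrow> bool" where
  "nondeg_hess M x \<mu> \<longleftrightarrow>
     (\<forall>U V \<phi> \<psi> L H. chart M \<mu> U V \<phi> \<psi> L \<and>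
        hess_at (\<lambda>y. (norm (\<psi> y - x))\<^sup>2) (\<phi> \<mu>) H \<longrightarrow>
        (\<forall>w\<in>L. (\<forall>u\<in>L. u \<bullet> (H *v w) = 0) \<longrightarrow> w = 0))"

definition unique_nondeg_min :: "(real^'n) set \<Rightarrow> real^'n \<Rightarrow> real^'n \<Rightarrow> bool" where
  "unique_nondeg_min M x \<mu> \<longleftrightarrow>
     \<mu> \<in> M \<and> (\<forall>\<alpha>\<in>M. \<alpha> \<noteq> \<mu> \<longrightarrow> (norm (\<mu> - x))\<^sup>2 < (norm (\<alpha> - x))\<^sup>2) \<and>
     nondeg_hess M x \<mu>"

definition cutlocus :: "(real^'n) set \<Rightarrow> (real^'n) set" where
  "cutlocus M = {x. \<not> (\<exists>\<mu>. unique_nondeg_min M x \<mu>)}"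

definition nearest :: "(real^'n) set \<Rightarrow> real^'n \<Rightarrow> real^'n" where
  "nearest M x = (if x \<in> cutlocus M then 0
                  else THE \<mu>. \<mu> \<in> M \<and> (\<forall>\<alpha>\<in>M. norm (\<mu> - x) \<le> norm (\<alpha> - x)))"

definition conv_distr ::
  "'a measure \<Rightarrow> (nat \<Rightarrow> 'a \<Rightarrow> 'c::metric_space) \<Rightarrow> 'b measure \<Rightarrow> ('b \<Rightarrow> 'c) \<Rightarrow> bool" where
  "conv_distr P X Q Y \<longleftrightarrow>
     (\<forall>f :: 'c \<Rightarrow> real. continuous_on UNIV f \<and> bounded (range f) \<longrightarrow>
        (\<lambda>n. \<integral>\<omega>. f (X n \<omega>) \<partial>P) \<longlonglongrightarrow> (\<integral>\<omega>. f (Y \<omega>) \<partial>Q))"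

text \<open>Convergence to 0 in (outer) probability.\<close>
definition conv_prob_zero :: "'a measure \<Rightarrow> (nat \<Rightarrow> 'a \<Rightarrow> 'c::real_normed_vector) \<Rightarrow> bool" where
  "conv_prob_zero P X \<longleftrightarrow>
     (\<forall>e>0. \<forall>d>0. eventually (\<lambda>n. \<exists>A\<in>sets P.
        {\<omega>\<in>space P. e < norm (X n \<omega>)} \<subseteq> A \<and> measure P A < d) sequentially)"

definition spherical :: "'b measure \<Rightarrow> ('b \<Rightarrow> real^'n) \<Rightarrow> bool" where
  "spherical Q Z \<longleftrightarrow>
     (\<forall>H :: real^'n^'n. orthogonal_matrix H \<longrightarrow>
        distr Q borel (\<lambda>\<omega>. H *v Z \<omega>) = distr Q borel Z)"

end

theory Submission
  imports Defs
begin

text \<open>A point x lies off the cut locus C, with nearest point b, exactly when the squared distance to x grows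
  quadratically at b, that is, when 2 (a - b, x - b) \<le> (1 - c) |a - b|^2 for some c > 0 and all a in M.
  Pushing x outwards along its normal ray until c drops to 0 must hit C, which turns the distance \<delta> from
  x to C into an explicit admissible c. Comparing these one-sided bounds at x and at y gives
  |\<pi>(y) - \<pi>(x)| = O(|y - x| / \<delta>) without differentiating \<pi>. Since x - \<pi>(x) and y - \<pi>(y) are both normal,
  a first-order expansion of a normal field along M then yields
  G (\<pi>(y) - \<pi>(x)) = tan (y - x) + O(|y - x|^2 / \<delta>^2), uniformly in x. The first claim follows by tightness
  of the Z_n; the other two follow from Slutsky's lemma along subsequences of the bounded matrices
  \<Gamma>_n tan B_n, each limit W of which satisfies W W^T = tan, so that W Z and tan Z have the same law.\<close>

section \<open>Calculus of C^k functions\<close>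

text \<open>The points \<open>t n\<close> may approach the cut locus, so every estimate needs
  constants independent of the base point; only the distance \<delta> to the cut locus may enter, in
  the powers that the hypotheses control. Hence the local bounds hold for pairs of moving points and
  are made uniform by compactness of M. The Weingarten matrix is specified through all normal fields
  at once. A concrete field is the gradient of u \<bullet> \<phi>, for a chart \<phi> and a covector
  u vanishing on the model subspace: it is normal because u \<bullet> \<phi> vanishes on M, and its
  derivative is a Hessian, hence symmetric. Two default values shape the case distinctions.
  \<open>infdist\<close> to the empty set is 0, and so is a quotient by 0; for an empty cut locus
  the rate conditions thus hold trivially, and that case is settled by showing that M is one point.
  And \<open>nearest\<close> is 0 on the cut locus, so the relation \<open>is_nearest\<close> is
  used wherever a point may lie there; the random points may do so, but only on events that
  tightness makes improbable.\<close>

lemma Ck_Suc_imp: "Ck (Suc k) U g \<Longrightarrow> Ck k U g"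
proof (induction k arbitrary: g)
  case 0
  then obtain Dg where Dg: "\<forall>x\<in>U. (g has_derivative (\<lambda>h. \<Sum>i\<in>UNIV. Dg i x * h $ i)) (at x)" by auto
  have "isCont g x" if "x \<in> U" for x
    using has_derivative_continuous Dg that by blast
  then show ?case by (simp add: continuous_at_imp_continuous_on)
next
  case (Suc k)
  then obtain Dg where 1: "\<forall>x\<in>U. (g has_derivative (\<lambda>h. \<Sum>i\<in>UNIV. Dg i x * h $ i)) (at x)"
    and 2: "\<And>i. Ck (Suc k) U (Dg i)"
    using Ck.simps(2) by blast
  have "\<And>i. Ck k U (Dg i)" using Suc.IH 2 by blast
  with 1 show ?case unfolding Ck.simps(2) by blast
qed

lemma Ck_cong:
  assumes "open U" "\<And>x. x \<in> U \<Longrightarrow> f x = g x" "Ck k U f"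
  shows "Ck k U g"
proof (cases k)
  case 0
  then show ?thesis using assms by (simp cong: continuous_on_cong)
next
  case (Suc k')
  then obtain Df where 1: "\<forall>x\<in>U. (f has_derivative (\<lambda>h. \<Sum>i\<in>UNIV. Df i x * h $ i)) (at x)"
    and 2: "\<And>i. Ck k' U (Df i)"
    using assms(3) by auto
  have "\<forall>x\<in>U. (g has_derivative (\<lambda>h. \<Sum>i\<in>UNIV. Df i x * h $ i)) (at x)"
    using 1 assms(2) by (auto intro!: has_derivative_transform_within_open[OF _ assms(1), of f _ _ _ g])
  with 2 show ?thesis unfolding Suc Ck.simps(2) by blast
qed

lemma Ck_const: "Ck k U (\<lambda>x. c)"
proof (induction k arbitrary: c)
  case (Suc k)
  show ?case unfolding Ck.simps(2)
    by (rule exI[of _ "\<lambda>i x. 0"]) (auto simp: Suc)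
qed auto

lemma Ck_add: "Ck k U f \<Longrightarrow> Ck k U g \<Longrightarrow> Ck k U (\<lambda>x. f x + g x)"
proof (induction k arbitrary: f g)
  case 0 then show ?case by (auto intro: continuous_intros)
next
  case (Suc k)
  obtain Df where f: "\<forall>x\<in>U. (f has_derivative (\<lambda>h. \<Sum>i\<in>UNIV. Df i x * h $ i)) (at x)"
    "\<And>i. Ck k U (Df i)" using Suc.prems(1) by auto
  obtain Dg where g: "\<forall>x\<in>U. (g has_derivative (\<lambda>h. \<Sum>i\<in>UNIV. Dg i x * h $ i)) (at x)"
    "\<And>i. Ck k U (Dg i)" using Suc.prems(2) by auto
  show ?case unfolding Ck.simps(2)
  proof (intro exI[of _ "\<lambda>i x. Df i x + Dg i x"] conjI ballI allI)
    fix x assume "x \<in> U"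
    then show "((\<lambda>x. f x + g x) has_derivative (\<lambda>h. \<Sum>i\<in>UNIV. (Df i x + Dg i x) * h $ i)) (at x)"
      using has_derivative_add[of f _ _ g] f(1) g(1)
      by (simp add: distrib_right sum.distrib)
  qed (use Suc.IH f g in auto)
qed

lemma Ck_mult: "Ck k U f \<Longrightarrow> Ck k U g \<Longrightarrow> Ck k U (\<lambda>x. f x * g x)"
proof (induction k arbitrary: f g)
  case 0 then show ?case by (auto intro: continuous_intros)
next
  case (Suc k)
  obtain Df where f: "\<forall>x\<in>U. (f has_derivative (\<lambda>h. \<Sum>i\<in>UNIV. Df i x * h $ i)) (at x)"
    "\<And>i. Ck k U (Df i)" using Suc.prems(1) by auto
  obtain Dg where g: "\<forall>x\<in>U. (g has_derivative (\<lambda>h. \<Sum>i\<in>UNIV. Dg i x * h $ i)) (at x)"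
    "\<And>i. Ck k U (Dg i)" using Suc.prems(2) by auto
  show ?case unfolding Ck.simps(2)
  proof (intro exI[of _ "\<lambda>i x. f x * Dg i x + Df i x * g x"] conjI ballI allI)
    fix x assume "x \<in> U"
    then show "((\<lambda>x. f x * g x) has_derivative (\<lambda>h. \<Sum>i\<in>UNIV. (f x * Dg i x + Df i x * g x) * h $ i)) (at x)"
      by (intro has_derivative_eq_rhs[OF has_derivative_mult[OF bspec[OF f(1)] bspec[OF g(1)]]])
         (auto simp: fun_eq_iff sum.distrib[symmetric] sum_distrib_left sum_distrib_right algebra_simps)
  next
    fix i show "Ck k U (\<lambda>x. f x * Dg i x + Df i x * g x)"
      by (intro Ck_add Suc.IH f(2) g(2) Ck_Suc_imp[OF Suc.prems(1)] Ck_Suc_imp[OF Suc.prems(2)])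
  qed
qed

lemma Ck_sum: "finite I \<Longrightarrow> (\<And>i. i \<in> I \<Longrightarrow> Ck k U (f i)) \<Longrightarrow> Ck k U (\<lambda>x. \<Sum>i\<in>I. f i x)"
  by (induction I rule: finite_induct) (auto simp: Ck_const intro!: Ck_add)

text \<open>\<open>Ck\<close> only claims that some family of partial derivatives is regular.
  Uniqueness of the derivative, tested on the axes, passes this on to any family already at hand, as
  needed when Jacobians are differentiated again.\<close>

lemma Ck_partial:
  assumes "open U" "\<And>x. x \<in> U \<Longrightarrow> (g has_derivative (\<lambda>h. \<Sum>i\<in>UNIV. Dg i x * h $ i)) (at x)"
    "Ck (Suc k) U g"
  shows "Ck k U (Dg i)"
proof -
  obtain Df where f: "\<forall>x\<in>U. (g has_derivative (\<lambda>h. \<Sum>i\<in>UNIV. Df i x * h $ i)) (at x)"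
    "\<And>i. Ck k U (Df i)" using assms(3) by auto
  have "Df i x = Dg i x" if "x \<in> U" for x
  proof -
    have "(\<lambda>h. \<Sum>i\<in>UNIV. Df i x * h $ i) = (\<lambda>h. \<Sum>i\<in>UNIV. Dg i x * h $ i)"
      using has_derivative_unique f(1) assms(2) that by blast
    from fun_cong[OF this, of "axis i 1"] show ?thesis
      by (simp add: axis_def if_distrib cong: if_cong)
  qed
  then show ?thesis using Ck_cong[OF assms(1) _ f(2)] by blast
qed

section \<open>Jacobians, and Taylor bounds uniform in both points\<close>

definition smooth_mat :: "(real^'n) set \<Rightarrow> (real^'n \<Rightarrow> real^'m^'k) \<Rightarrow> bool" where
  "smooth_mat U J \<longleftrightarrow> (\<forall>k i j. Ck k U (\<lambda>x. J x $ i $ j))"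

lemma smooth_jacobian:
  fixes f :: "real^'n \<Rightarrow> real^'m"
  assumes "open U" "smooth_on U f"
  obtains J where "\<And>x. x \<in> U \<Longrightarrow> (f has_derivative ((*v) (J x))) (at x)" "smooth_mat U J"
proof -
  have "\<exists>Dg. \<forall>x\<in>U. ((\<lambda>x. f x $ j) has_derivative (\<lambda>h. \<Sum>i\<in>UNIV. Dg i x * h $ i)) (at x)" for j
  proof -
    have "Ck (Suc 0) U (\<lambda>x. f x $ j)" using assms(2) unfolding smooth_on_def by blast
    then show ?thesis unfolding Ck.simps(2) by blast
  qed
  then have "\<exists>Dg. \<forall>j. \<forall>x\<in>U. ((\<lambda>x. f x $ j) has_derivative (\<lambda>h. \<Sum>i\<in>UNIV. Dg j i x * h $ i)) (at x)"
    by (intro choice allI)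
  then obtain Dg where Dg: "\<And>j x. x\<in>U \<Longrightarrow> ((\<lambda>x. f x $ j) has_derivative (\<lambda>h. \<Sum>i\<in>UNIV. Dg j i x * h $ i)) (at x)"
    by blast
  define J :: "real^'n \<Rightarrow> real^'n^'m" where "J x = (\<chi> j i. Dg j i x)" for x
  show ?thesis
  proof
    fix x assume "x \<in> U"
    then show "(f has_derivative ((*v) (J x))) (at x)"
      by (subst has_derivative_componentwise_within)
         (use Dg in \<open>auto simp: Basis_vec_def inner_axis J_def matrix_vector_mult_def\<close>)
  next
    show "smooth_mat U J"
      unfolding smooth_mat_def J_def
      using Ck_partial[OF assms(1) Dg] assms(2) unfolding smooth_on_def by simp
  qed
qed

text \<open>Bounds are wanted for two moving points near \<open>p\<close>, because the base point of
  an expansion is itself a nearest point that moves. The predicate lets radii and constants be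
  combined over finitely many components.\<close>

definition near_pairs :: "'a::metric_space \<Rightarrow> ('a \<Rightarrow> 'a \<Rightarrow> bool) \<Rightarrow> bool" where
  "near_pairs p R \<longleftrightarrow> (\<exists>\<rho>>0. \<forall>x\<in>ball p \<rho>. \<forall>y\<in>ball p \<rho>. R x y)"

lemma near_pairs_all:
  fixes R :: "'i::finite \<Rightarrow> 'a::metric_space \<Rightarrow> 'a \<Rightarrow> bool"
  assumes "\<And>i. near_pairs p (R i)"
  shows "near_pairs p (\<lambda>x y. \<forall>i. R i x y)"
proof -
  obtain \<rho> where \<rho>: "\<And>i. \<rho> i > 0" "\<And>i x y. x \<in> ball p (\<rho> i) \<Longrightarrow> y \<in> ball p (\<rho> i) \<Longrightarrow> R i x y"
    using assms unfolding near_pairs_def by metis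
  define r where "r = Min (range \<rho>)"
  have "r > 0" "\<And>i. r \<le> \<rho> i" unfolding r_def using \<rho>(1) by (auto simp: Min_gr_iff)
  then have "R i x y" if "x \<in> ball p r" "y \<in> ball p r" for i x y
    using \<rho>(2)[of x i y] that by (simp add: less_le_trans)
  with \<open>r > 0\<close> show ?thesis unfolding near_pairs_def by blast
qed

lemma near_pairs_uniform:
  fixes R :: "'i::finite \<Rightarrow> 'a::metric_space \<Rightarrow> 'a \<Rightarrow> real"
  assumes "\<And>i. \<exists>K. near_pairs p (\<lambda>x y. R i x y \<le> K * S x y)" and S: "\<And>x y. S x y \<ge> 0"
  shows "\<exists>K. near_pairs p (\<lambda>x y. \<forall>i. R i x y \<le> K * S x y)"
proof -
  have "\<exists>K. \<forall>i. near_pairs p (\<lambda>x y. R i x y \<le> K i * S x y)"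
    by (intro choice allI assms)
  then obtain K where K: "\<forall>i. near_pairs p (\<lambda>x y. R i x y \<le> K i * S x y)" ..
  define KK where "KK = Max (range K)"
  have le: "K i \<le> KK" for i unfolding KK_def by simp
  have "near_pairs p (\<lambda>x y. R i x y \<le> KK * S x y)" for i
  proof -
    obtain \<rho> where "\<rho> > 0" and \<rho>: "\<And>x y. x \<in> ball p \<rho> \<Longrightarrow> y \<in> ball p \<rho> \<Longrightarrow> R i x y \<le> K i * S x y"
      using K unfolding near_pairs_def by blast
    show ?thesis unfolding near_pairs_def
      by (intro exI[of _ \<rho>] conjI ballI \<open>\<rho> > 0\<close> order_trans[OF \<rho> mult_right_mono[OF le S]])
  qed
  then show ?thesis using near_pairs_all[of p "\<lambda>i x y. R i x y \<le> KK * S x y"] by blast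
qed

lemma norm_matrix_vector_mult_le:
  fixes A :: "real^'n^'m"
  shows "norm (A *v x) \<le> norm A * norm x"
proof -
  have "norm (A *v x) = L2_set (\<lambda>i. norm ((A *v x) $ i)) UNIV" by (simp add: norm_vec_def)
  also have "\<dots> \<le> L2_set (\<lambda>i. norm (A $ i) * norm x) UNIV"
  proof (rule L2_set_mono)
    fix i
    have "(A *v x) $ i = A $ i \<bullet> x" by (simp add: matrix_vector_mult_def inner_vec_def)
    then show "norm ((A *v x) $ i) \<le> norm (A $ i) * norm x"
      using Cauchy_Schwarz_ineq2[of "A$i" x] by simp
  qed auto
  also have "\<dots> = norm A * norm x"
    by (simp add: norm_vec_def L2_set_left_distrib)
  finally show ?thesis .
qed

lemma norm_matrix_le_l1: "norm (A :: real^'n^'m) \<le> (\<Sum>i\<in>UNIV. \<Sum>j\<in>UNIV. \<bar>A $ i $ j\<bar>)"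
proof -
  have "norm A \<le> (\<Sum>i\<in>UNIV. norm (A $ i))" unfolding norm_vec_def
    by (rule L2_set_le_sum) auto
  also have "\<dots> \<le> (\<Sum>i\<in>UNIV. \<Sum>j\<in>UNIV. \<bar>A $ i $ j\<bar>)"
    by (intro sum_mono norm_le_l1_cart)
  finally show ?thesis .
qed

lemma C2_remainder:
  fixes g :: "real^'n \<Rightarrow> real"
  assumes "open U" "p \<in> U"
    and g: "\<And>x. x \<in> U \<Longrightarrow> (g has_derivative (\<lambda>h. \<Sum>i\<in>UNIV. Dg i x * h $ i)) (at x)"
    and lip: "\<And>i. \<exists>K. near_pairs p (\<lambda>x y. \<bar>Dg i x - Dg i y\<bar> \<le> K * norm (x - y))"
  shows "\<exists>K. near_pairs p (\<lambda>x y. \<bar>g x - g y - (\<Sum>i\<in>UNIV. Dg i y * (x - y) $ i)\<bar> \<le> K * norm (x - y)^2)"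
proof -
  obtain K where "near_pairs p (\<lambda>x y. \<forall>i. \<bar>Dg i x - Dg i y\<bar> \<le> K * norm (x - y))"
    using near_pairs_uniform[of p "\<lambda>i x y. \<bar>Dg i x - Dg i y\<bar>", OF lip] by auto
  then obtain \<rho>0 where \<rho>0: "\<rho>0 > 0" and b0: "\<And>x y i. x \<in> ball p \<rho>0 \<Longrightarrow> y \<in> ball p \<rho>0 \<Longrightarrow>
      \<bar>Dg i x - Dg i y\<bar> \<le> K * norm (x - y)" unfolding near_pairs_def by blast
  obtain \<rho>1 where \<rho>1: "\<rho>1 > 0" "ball p \<rho>1 \<subseteq> U" using assms(1,2) openE by blast
  define \<rho> where "\<rho> = min \<rho>0 \<rho>1"
  have \<rho>: "\<rho> > 0" and b: "\<And>x y i. x \<in> ball p \<rho> \<Longrightarrow> y \<in> ball p \<rho> \<Longrightarrow>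
      \<bar>Dg i x - Dg i y\<bar> \<le> K * norm (x - y)" and U: "ball p \<rho> \<subseteq> U"
    using \<rho>0 b0 \<rho>1 unfolding \<rho>_def by auto
  define KK where "KK = (\<Sum>i\<in>(UNIV::'n set). \<bar>K\<bar>)"
  have "\<bar>g x - g y - (\<Sum>i\<in>UNIV. Dg i y * (x - y) $ i)\<bar> \<le> KK * norm (x - y)^2"
    if xy: "x \<in> ball p \<rho>" "y \<in> ball p \<rho>" for x y
  proof -
    \<comment> \<open>Besides the ball at \<open>p\<close>, the points stay within |x - y| of
      \<open>y\<close>, so that the gradients there differ from the one at \<open>y\<close> by a
      multiple of |x - y|; this is the second factor of the quadratic bound.\<close>
    define S where "S = ball p \<rho> \<inter> cball y (norm (x - y))"
    have "norm (g x - g y - (\<Sum>i\<in>UNIV. Dg i y * (x - y) $ i)) \<le> norm (x - y) * (KK * norm (x-y))"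
    proof (rule differentiable_bound_linearization[where S=S and f'="\<lambda>z h. \<Sum>i\<in>UNIV. Dg i z * h $ i"])
      fix t :: real assume t: "t \<in> {0..1}"
      have e: "y + t *\<^sub>R (x - y) = (1 - t) *\<^sub>R y + t *\<^sub>R x" by (simp add: algebra_simps)
      have "y + t *\<^sub>R (x - y) \<in> ball p \<rho>"
        unfolding e using convexD[OF convex_ball xy(2,1)] t by auto
      moreover have "dist y (y + t *\<^sub>R (x - y)) \<le> norm (x - y)"
        using t by (simp add: dist_norm mult_left_le_one_le)
      ultimately show "y + t *\<^sub>R (x - y) \<in> S" unfolding S_def by auto
    next
      fix z assume "z \<in> S"
      then have "z \<in> U" using U unfolding S_def by blast
      then show "(g has_derivative (\<lambda>h. \<Sum>i\<in>UNIV. Dg i z * h $ i)) (at z within S)"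
        by (rule has_derivative_at_withinI[OF g])
    next
      fix z assume z: "z \<in> S"
        show "onorm ((\<lambda>h. \<Sum>i\<in>UNIV. Dg i z * h $ i) - (\<lambda>h. \<Sum>i\<in>UNIV. Dg i y * h $ i)) \<le> KK * norm (x - y)"
        proof (rule onorm_le)
          fix h :: "real^'n"
          have "norm (((\<lambda>h. \<Sum>i\<in>UNIV. Dg i z * h $ i) - (\<lambda>h. \<Sum>i\<in>UNIV. Dg i y * h $ i)) h)
            = \<bar>\<Sum>i\<in>UNIV. (Dg i z - Dg i y) * h $ i\<bar>"
            by (simp add: algebra_simps sum_subtractf)
          also have "\<dots> \<le> (\<Sum>i\<in>UNIV. \<bar>Dg i z - Dg i y\<bar> * \<bar>h $ i\<bar>)"
            by (rule order_trans[OF sum_abs]) (simp add: abs_mult)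
          also have "\<dots> \<le> (\<Sum>i\<in>(UNIV::'n set). (\<bar>K\<bar> * norm (x - y)) * norm h)"
          proof (intro sum_mono mult_mono component_le_norm_cart)
            fix i
            have "\<bar>Dg i z - Dg i y\<bar> \<le> K * norm (z - y)" using b z xy unfolding S_def by auto
            also have "\<dots> \<le> \<bar>K\<bar> * norm (x - y)"
              using z unfolding S_def by (intro mult_mono) (auto simp: dist_norm norm_minus_commute)
            finally show "\<bar>Dg i z - Dg i y\<bar> \<le> \<bar>K\<bar> * norm (x - y)" .
          qed auto
          also have "\<dots> = KK * norm (x - y) * norm h"
            unfolding KK_def by (simp add: sum_distrib_right)
          finally show "norm (((\<lambda>h. \<Sum>i\<in>UNIV. Dg i z * h $ i) - (\<lambda>h. \<Sum>i\<in>UNIV. Dg i y * h $ i)) h)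
            \<le> KK * norm (x - y) * norm h" .
        qed
    next
      show "y \<in> S" using xy unfolding S_def by auto
    qed
    then show ?thesis by (simp add: power2_eq_square mult_ac)
  qed
  with \<rho> show ?thesis unfolding near_pairs_def by blast
qed

lemma C1_lipschitz:
  fixes g :: "real^'n \<Rightarrow> real"
  assumes "open U" "p \<in> U" "Ck (Suc 0) U g"
  shows "\<exists>K. near_pairs p (\<lambda>x y. \<bar>g x - g y\<bar> \<le> K * norm (x - y))"
proof -
  obtain Dg where g: "\<And>x. x\<in>U \<Longrightarrow> (g has_derivative (\<lambda>h. \<Sum>i\<in>UNIV. Dg i x * h $ i)) (at x)"
    and c: "\<And>i. continuous_on U (Dg i)" using assms(3) by auto
  obtain \<rho> where \<rho>: "\<rho> > 0" "cball p \<rho> \<subseteq> U" using assms(1,2) open_contains_cball by blast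
  have "\<exists>K. \<forall>x\<in>cball p \<rho>. \<bar>Dg i x\<bar> \<le> K" for i
    using compact_imp_bounded[OF compact_continuous_image[OF continuous_on_subset[OF c \<rho>(2), of i] compact_cball]]
    unfolding bounded_iff by auto
  then obtain K where K: "\<And>i x. x \<in> cball p \<rho> \<Longrightarrow> \<bar>Dg i x\<bar> \<le> K i" by metis
  define KK where "KK = (\<Sum>i\<in>UNIV. K i)"
  have "norm (g x - g y) \<le> KK * norm (x - y)" if "x \<in> ball p \<rho>" "y \<in> ball p \<rho>" for x y
  proof (rule differentiable_bound[OF convex_ball[of p \<rho>] _ _ that])
    fix z assume z: "z \<in> ball p \<rho>"
    then show "(g has_derivative (\<lambda>h. \<Sum>i\<in>UNIV. Dg i z * h $ i)) (at z within ball p \<rho>)"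
      using \<rho>(2) by (intro has_derivative_at_withinI[OF g]) auto
    show "onorm (\<lambda>h. \<Sum>i\<in>UNIV. Dg i z * h $ i) \<le> KK"
    proof (rule onorm_le)
      fix h :: "real^'n"
      have "norm (\<Sum>i\<in>UNIV. Dg i z * h $ i) \<le> (\<Sum>i\<in>UNIV. \<bar>Dg i z\<bar> * \<bar>h $ i\<bar>)"
        by (simp add: order_trans[OF sum_abs] abs_mult[symmetric])
      also have "\<dots> \<le> (\<Sum>i\<in>UNIV. K i * norm h)"
        using K z by (intro sum_mono mult_mono component_le_norm_cart order_trans[OF abs_ge_zero K[of z]]) auto
      finally show "norm (\<Sum>i\<in>UNIV. Dg i z * h $ i) \<le> KK * norm h"
        unfolding KK_def by (simp add: sum_distrib_right)
    qed
  qed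
  with \<rho> show ?thesis unfolding near_pairs_def real_norm_def by blast
qed

lemma smooth_mat_lipschitz:
  fixes J :: "real^'n \<Rightarrow> real^'m^'k"
  assumes "open U" "p \<in> U" "smooth_mat U J"
  obtains \<rho> K where "\<rho> > 0" "K \<ge> 0" "ball p \<rho> \<subseteq> U"
    "\<And>x y. x \<in> ball p \<rho> \<Longrightarrow> y \<in> ball p \<rho> \<Longrightarrow> norm (J x - J y) \<le> K * norm (x - y)"
    "\<And>x. x \<in> ball p \<rho> \<Longrightarrow> norm (J x) \<le> K"
proof -
  have "\<exists>K. near_pairs p (\<lambda>x y. \<bar>J x $ i $ j - J y $ i $ j\<bar> \<le> K * norm (x - y))" for i j
    using assms(3) unfolding smooth_mat_def by (intro C1_lipschitz[OF assms(1,2)]) blast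
  then have "\<exists>K. near_pairs p (\<lambda>x y. \<forall>ij. \<bar>J x $ (fst ij) $ (snd ij) - J y $ (fst ij) $ (snd ij)\<bar> \<le> K * norm (x - y))"
    by (intro near_pairs_uniform) auto
  then obtain K \<rho>0 where \<rho>0: "\<rho>0 > 0" and "\<And>x y. x \<in> ball p \<rho>0 \<Longrightarrow> y \<in> ball p \<rho>0 \<Longrightarrow>
      \<forall>ij. \<bar>J x $ (fst ij) $ (snd ij) - J y $ (fst ij) $ (snd ij)\<bar> \<le> K * norm (x - y)"
    unfolding near_pairs_def by blast
  then have b0: "\<And>x y i j. x \<in> ball p \<rho>0 \<Longrightarrow> y \<in> ball p \<rho>0 \<Longrightarrow>
      \<bar>J x $ i $ j - J y $ i $ j\<bar> \<le> K * norm (x - y)" by simp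
  obtain \<rho>1 where \<rho>1: "\<rho>1 > 0" "ball p \<rho>1 \<subseteq> U" using assms openE by blast
  \<comment> \<open>The radius is at most 1, so that the Lipschitz bound from \<open>p\<close> also
    bounds \<open>J\<close> itself, by \<open>K1 + norm (J p)\<close>.\<close>
  define \<rho> where "\<rho> = min 1 (min \<rho>0 \<rho>1)"
  define K1 where  "K1 = (\<Sum>i\<in>(UNIV::'k set). \<Sum>j\<in>(UNIV::'m set). \<bar>K\<bar>)"
  have K1: "K1 \<ge> 0" unfolding K1_def by (intro sum_nonneg) auto
  have l: "norm (J x - J y) \<le> K1 * norm (x - y)" if "x \<in> ball p \<rho>" "y \<in> ball p \<rho>" for x y
  proof -
    have "norm (J x - J y) \<le> (\<Sum>i\<in>UNIV. \<Sum>j\<in>UNIV. \<bar>(J x - J y) $ i $ j\<bar>)" by (rule norm_matrix_le_l1)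
    also have "\<dots> \<le> (\<Sum>i\<in>(UNIV::'k set). \<Sum>j\<in>(UNIV::'m set). \<bar>K\<bar> * norm (x - y))"
    proof (intro sum_mono)
      fix i j
      have "\<bar>(J x - J y) $ i $ j\<bar> \<le> K * norm (x - y)" using b0 that unfolding \<rho>_def by auto
      also have "\<dots> \<le> \<bar>K\<bar> * norm (x - y)" by (intro mult_right_mono) auto
      finally show "\<bar>(J x - J y) $ i $ j\<bar> \<le> \<bar>K\<bar> * norm (x - y)" .
    qed
    finally show ?thesis unfolding K1_def by (simp add: sum_distrib_right)
  qed
  have pp: "\<rho> > 0" using \<rho>0 \<rho>1 unfolding \<rho>_def by auto
  show thesis
  proof (rule that[of \<rho> "K1 + norm (J p)"])
    fix x y assume xy: "x \<in> ball p \<rho>" "y \<in> ball p \<rho>"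
    have "norm (J x - J y) \<le> K1 * norm (x - y)" by (rule l[OF xy])
    also have "\<dots> \<le> (K1 + norm (J p)) * norm (x - y)" by (intro mult_right_mono) auto
    finally show "norm (J x - J y) \<le> (K1 + norm (J p)) * norm (x - y)" .
  next
    fix x assume x: "x \<in> ball p \<rho>"
    have "norm (x - p) \<le> 1" using x unfolding \<rho>_def by (auto simp: dist_norm norm_minus_commute)
    then have "K1 * norm (x - p) \<le> K1" using K1 by (rule mult_left_le)
    with l[OF x, of p] pp have "norm (J x - J p) \<le> K1" by auto
    then show "norm (J x) \<le> K1 + norm (J p)"
      using norm_triangle_ineq2[of "J x" "J p"] by linarith
  qed (use pp K1 \<rho>1 in \<open>auto simp: \<rho>_def\<close>)
qed

lemma smooth_remainder:
  fixes f :: "real^'n \<Rightarrow> real^'m"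
  assumes "open U" "p \<in> U" "smooth_mat U J"
    and f: "\<And>x. x \<in> U \<Longrightarrow> (f has_derivative ((*v) (J x))) (at x)"
  obtains \<rho> K where "\<rho> > 0" "K \<ge> 0" "ball p \<rho> \<subseteq> U"
    "\<And>x y. x \<in> ball p \<rho> \<Longrightarrow> y \<in> ball p \<rho> \<Longrightarrow> norm (f x - f y - J y *v (x - y)) \<le> K * norm (x - y)^2"
proof -
  have "\<exists>K. near_pairs p (\<lambda>x y. \<bar>f x $ j - f y $ j - (\<Sum>i\<in>UNIV. J y $ j $ i * (x - y) $ i)\<bar> \<le> K * norm (x - y)^2)" for j
  proof (rule C2_remainder[OF assms(1,2)])
    fix x assume x: "x \<in> U"
    show "((\<lambda>x. f x $ j) has_derivative (\<lambda>h. \<Sum>i\<in>UNIV. J x $ j $ i * h $ i)) (at x)"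
      using has_derivative_compose[OF f[OF x] bounded_linear_imp_has_derivative[OF bounded_linear_vec_nth]]
      by (simp add: matrix_vector_mult_def)
  next
    fix i show "\<exists>K. near_pairs p (\<lambda>x y. \<bar>J x $ j $ i - J y $ j $ i\<bar> \<le> K * norm (x - y))"
      using assms(3) unfolding smooth_mat_def by (intro C1_lipschitz[OF assms(1,2)]) blast
  qed
  then have "\<exists>K. near_pairs p (\<lambda>x y. \<forall>j. \<bar>f x $ j - f y $ j - (\<Sum>i\<in>UNIV. J y $ j $ i * (x - y) $ i)\<bar> \<le> K * norm (x - y)^2)"
    by (intro near_pairs_uniform) auto
  then obtain K \<rho>0 where \<rho>0: "\<rho>0 > 0" and b0: "\<And>x y j. x \<in> ball p \<rho>0 \<Longrightarrow> y \<in> ball p \<rho>0 \<Longrightarrow>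
      \<bar>f x $ j - f y $ j - (\<Sum>i\<in>UNIV. J y $ j $ i * (x - y) $ i)\<bar> \<le> K * norm (x - y)^2"
    unfolding near_pairs_def by blast
  obtain \<rho>1 where \<rho>1: "\<rho>1 > 0" "ball p \<rho>1 \<subseteq> U" using assms openE by blast
  show thesis
  proof (rule that[of "min \<rho>0 \<rho>1" "\<bar>\<Sum>j\<in>(UNIV::'m set). K\<bar>"])
    fix x y assume xy: "x \<in> ball p (min \<rho>0 \<rho>1)" "y \<in> ball p (min \<rho>0 \<rho>1)"
    have "norm (f x - f y - J y *v (x - y)) \<le> (\<Sum>j\<in>UNIV. \<bar>(f x - f y - J y *v (x - y)) $ j\<bar>)"
      by (rule norm_le_l1_cart)
    also have "\<dots> \<le> (\<Sum>j\<in>(UNIV::'m set). K * norm (x - y)^2)"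
      using b0 xy by (intro sum_mono) (auto simp: matrix_vector_mult_def)
    also have "\<dots> = (\<Sum>j\<in>(UNIV::'m set). K) * norm (x - y)^2" by (simp add: sum_distrib_right)
    also have "\<dots> \<le> \<bar>\<Sum>j\<in>(UNIV::'m set). K\<bar> * norm (x - y)^2" by (intro mult_right_mono) auto
    finally show "norm (f x - f y - J y *v (x - y)) \<le> \<bar>\<Sum>j\<in>(UNIV::'m set). K\<bar> * norm (x - y)^2" .
  qed (use \<rho>0 \<rho>1 in auto)
qed

text \<open>The bound \<open>C\<close> is integrated twice along the segment by monotonicity:
  \<open>p\<close> is the slope minus its guaranteed growth, and \<open>q\<close> is the value minus
  the claimed quadratic minorant, with derivative \<open>p s - p 0\<close>.\<close>

lemma second_order_lower_bound:
  fixes F :: "real^'n \<Rightarrow> real"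
  assumes "convex S" "k \<in> S" "k + d \<in> S"
    and F: "\<And>z. z \<in> S \<Longrightarrow> (F has_derivative (\<lambda>h. g z \<bullet> h)) (at z)"
    and g: "\<And>z. z \<in> S \<Longrightarrow> (g has_derivative ((*v) (H z))) (at z)"
    and C: "\<And>z. z \<in> S \<Longrightarrow> C \<le> d \<bullet> (H z *v d)"
  shows "F (k + d) \<ge> F k + g k \<bullet> d + C / 2"
proof -
  have S: "k + s *\<^sub>R d \<in> S" if "0 \<le> s" "s \<le> 1" for s
  proof -
    have "k + s *\<^sub>R d = (1 - s) *\<^sub>R k + s *\<^sub>R (k + d)" by (simp add: algebra_simps)
    then show ?thesis using convexD[OF assms(1-3), of "1 - s" s] that by simp
  qed
  have line: "((\<lambda>s. k + s *\<^sub>R d) has_derivative (\<lambda>s. s *\<^sub>R d)) (at s)" for s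
    by (auto intro!: derivative_eq_intros)
  define p where "p s = g (k + s *\<^sub>R d) \<bullet> d - C * s" for s
  define q where "q s = F (k + s *\<^sub>R d) - s * (g k \<bullet> d) - C / 2 * s^2" for s
  have dp: "(p has_real_derivative (d \<bullet> (H (k + s *\<^sub>R d) *v d) - C)) (at s)" if "0 \<le> s" "s \<le> 1" for s
  proof -
    have "((\<lambda>s. g (k + s *\<^sub>R d)) has_derivative (\<lambda>x. H (k + s *\<^sub>R d) *v (x *\<^sub>R d))) (at s)"
      using has_derivative_compose[OF line g[OF S[OF that]]] .
    from has_derivative_inner_left[OF this, of d]
    have "((\<lambda>s. g (k + s *\<^sub>R d) \<bullet> d) has_real_derivative (d \<bullet> (H (k + s *\<^sub>R d) *v d))) (at s)"
      unfolding has_field_derivative_def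
      by (rule has_derivative_eq_rhs) (simp add: fun_eq_iff matrix_vector_mult_scaleR inner_commute)
    then show ?thesis unfolding p_def by (auto intro!: derivative_eq_intros)
  qed
  have p_mono: "p 0 \<le> p s" if "0 \<le> s" "s \<le> 1" for s
  proof (rule DERIV_nonneg_imp_nondecreasing[of 0 s p])
    fix x assume x: "0 \<le> x" "x \<le> s"
    then show "\<exists>y. (p has_real_derivative y) (at x) \<and> 0 \<le> y"
      using dp[of x] C[OF S[of x]] that by (intro exI[of _ "d \<bullet> (H (k + x *\<^sub>R d) *v d) - C"]) simp
  qed (use that in auto)
  have dq: "(q has_real_derivative (p s - p 0)) (at s)" if "0 \<le> s" "s \<le> 1" for s
  proof -
    have "((\<lambda>s. F (k + s *\<^sub>R d)) has_derivative (\<lambda>x. g (k + s *\<^sub>R d) \<bullet> (x *\<^sub>R d))) (at s)"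
      using has_derivative_compose[OF line F[OF S[OF that]]] .
    then have "((\<lambda>s. F (k + s *\<^sub>R d)) has_real_derivative (g (k + s *\<^sub>R d) \<bullet> d)) (at s)"
      unfolding has_field_derivative_def
      by (rule has_derivative_eq_rhs) (simp add: fun_eq_iff)
    then show ?thesis unfolding q_def p_def by (auto intro!: derivative_eq_intros)
  qed
  have "q 0 \<le> q 1"
  proof (rule DERIV_nonneg_imp_nondecreasing[of 0 1 q])
    fix x :: real assume x: "0 \<le> x" "x \<le> 1"
    then show "\<exists>y. (q has_real_derivative y) (at x) \<and> 0 \<le> y"
      using dq[of x] p_mono[of x] by (intro exI[of _ "p x - p 0"]) simp
  qed auto
  then show ?thesis unfolding q_def by simp
qed

text \<open>The second difference of F over the parallelogram spanned by u and w is symmetric in u and w.\<close>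
lemma hessian_symmetric:
  fixes F :: "real^'n \<Rightarrow> real"
  assumes "open S" "y \<in> S"
    and F: "\<And>z. z \<in> S \<Longrightarrow> (F has_derivative (\<lambda>h. g z \<bullet> h)) (at z)"
    and g: "(g has_derivative ((*v) H)) (at y)"
  shows "u \<bullet> (H *v w) = w \<bullet> (H *v u)"
proof -
  have main: "\<exists>r>0. \<forall>t. 0 < t \<and> t < r \<longrightarrow>
      \<bar>F (y + t *\<^sub>R u + t *\<^sub>R w) - F (y + t *\<^sub>R u) - F (y + t *\<^sub>R w) + F y - t^2 * (w \<bullet> (H *v u))\<bar>
        \<le> 2 * e * t^2 * (norm u + norm w)^2" if e: "e > 0" for e u w
  proof -
    obtain \<rho> where \<rho>: "\<rho> > 0" "ball y \<rho> \<subseteq> S" using assms openE by blast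
    obtain \<rho>' where \<rho>': "\<rho>' > 0" "\<And>z. norm (z - y) < \<rho>' \<Longrightarrow> norm (g z - g y - H *v (z - y)) \<le> e * norm (z - y)"
      using g e unfolding has_derivative_at_alt by blast
    define N where "N = norm u + norm w"
    \<comment> \<open>Steps below \<open>r\<close> keep the whole parallelogram within both radii;
      the 1 covers u = w = 0.\<close>
    define r where "r = min \<rho> \<rho>' / (N + 1)"
    have N: "N \<ge> 0" unfolding N_def by simp
    have r: "r > 0" unfolding r_def using \<rho> \<rho>' N by simp
    have est: "\<bar>F (y + t *\<^sub>R u + t *\<^sub>R w) - F (y + t *\<^sub>R u) - F (y + t *\<^sub>R w) + F y - t^2 * (w \<bullet> (H *v u))\<bar>
        \<le> 2 * e * t^2 * N^2" if t: "0 < t" "t < r" for t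
    proof -
      have "t * N < min \<rho> \<rho>'"
      proof -
        have "t * N \<le> t * (N + 1)" using t by simp
        also have "\<dots> < r * (N + 1)" using t N by simp
        also have "\<dots> = min \<rho> \<rho>'" unfolding r_def using N by simp
        finally show ?thesis .
      qed
      then have tN: "t * N < \<rho>" "t * N < \<rho>'" by auto
      have nrm: "norm (a *\<^sub>R u + s *\<^sub>R w) \<le> t * N" if "0 \<le> s" "s \<le> t" "0 \<le> a" "a \<le> t" for s a
      proof -
        have "norm (a *\<^sub>R u + s *\<^sub>R w) \<le> a * norm u + s * norm w"
          using norm_triangle_ineq[of "a *\<^sub>R u" "s *\<^sub>R w"] that by simp
        also have "\<dots> \<le> t * norm u + t * norm w" using that by (intro add_mono mult_right_mono) auto
        finally show ?thesis unfolding N_def by (simp add: algebra_simps)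
      qed
      have inS: "y + a *\<^sub>R u + s *\<^sub>R w \<in> S" if "0 \<le> s" "s \<le> t" "0 \<le> a" "a \<le> t" for s a
      proof -
        have "dist y (y + a *\<^sub>R u + s *\<^sub>R w) = norm (a *\<^sub>R u + s *\<^sub>R w)"
          using norm_minus_cancel[of "a *\<^sub>R u + s *\<^sub>R w"] by (simp add: dist_norm)
        then show ?thesis using nrm[OF that] tN \<rho>(2) by auto
      qed
      \<comment> \<open>The second difference is \<open>q t - q 0\<close>. One mean value step in
        the direction \<open>w\<close> leaves a difference of gradients at two points near
        \<open>y\<close>, which the derivative \<open>H\<close> of \<open>g\<close> at
        \<open>y\<close> turns into t H u up to a small error.\<close>
      define q where "q s = F (y + t *\<^sub>R u + s *\<^sub>R w) - F (y + s *\<^sub>R w)" for s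
      have dF: "((\<lambda>s. F (y + a *\<^sub>R u + s *\<^sub>R w)) has_real_derivative (g (y + a *\<^sub>R u + s *\<^sub>R w) \<bullet> w)) (at s)"
        if "0 \<le> s" "s \<le> t" "0 \<le> a" "a \<le> t" for s a
      proof -
        have "((\<lambda>s. y + a *\<^sub>R u + s *\<^sub>R w) has_derivative (\<lambda>s. s *\<^sub>R w)) (at s)"
          by (auto intro!: derivative_eq_intros)
        from has_derivative_compose[OF this F[OF inS[OF that]]]
        show ?thesis unfolding has_field_derivative_def
          by (rule has_derivative_eq_rhs) (simp add: fun_eq_iff)
      qed
      have "(q has_real_derivative (g (y + t *\<^sub>R u + s *\<^sub>R w) \<bullet> w - g (y + s *\<^sub>R w) \<bullet> w)) (at s)"
        if "0 \<le> s" "s \<le> t" for s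
        unfolding q_def using DERIV_diff[OF dF[of s t] dF[of s 0]] that t by simp
      note dq = this
      obtain \<xi> where \<xi>: "0 < \<xi>" "\<xi> < t"
        and q: "q t - q 0 = (t - 0) * (g (y + t *\<^sub>R u + \<xi> *\<^sub>R w) \<bullet> w - g (y + \<xi> *\<^sub>R w) \<bullet> w)"
        using MVT2[OF t(1), of q "\<lambda>s. g (y + t *\<^sub>R u + s *\<^sub>R w) \<bullet> w - g (y + s *\<^sub>R w) \<bullet> w", OF dq] by auto
      define z1 z2 where "z1 = t *\<^sub>R u + \<xi> *\<^sub>R w" and "z2 = \<xi> *\<^sub>R w"
      have n1: "norm z1 \<le> t * N" using nrm[of \<xi> t] \<xi> t unfolding z1_def by auto
      have n2: "norm z2 \<le> t * N" using nrm[of \<xi> 0] \<xi> t unfolding z2_def by auto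
      have g1: "norm (g (y + z1) - g y - H *v z1) \<le> e * (t * N)"
        using \<rho>'(2)[of "y + z1"] n1 tN e mult_left_mono[OF n1, of e] by (simp add: order_trans)
      have g2: "norm (g (y + z2) - g y - H *v z2) \<le> e * (t * N)"
        using \<rho>'(2)[of "y + z2"] n2 tN e mult_left_mono[OF n2, of e] by (simp add: order_trans)
      define E where "E = (g (y + z1) - g y - H *v z1) - (g (y + z2) - g y - H *v z2)"
      have E: "norm E \<le> 2 * e * t * N" unfolding E_def
        using norm_triangle_le_diff[OF add_mono[OF g1 g2]] by (simp add: mult_ac)
      have "H *v z1 - H *v z2 = t *\<^sub>R (H *v u)"
        unfolding z1_def z2_def by (simp add: matrix_vector_right_distrib matrix_vector_mult_scaleR)
      then have "g (y + z1) - g (y + z2) = t *\<^sub>R (H *v u) + E" unfolding E_def by (simp add: algebra_simps)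
      then have "(g (y + z1) - g (y + z2)) \<bullet> w = (t *\<^sub>R (H *v u) + E) \<bullet> w" by simp
      then have "q t - q 0 = t^2 * (w \<bullet> (H *v u)) + t * (E \<bullet> w)"
        using q unfolding z1_def z2_def
        by (simp add: inner_diff_left inner_add_left inner_commute power2_eq_square algebra_simps)
      then have "\<bar>q t - q 0 - t^2 * (w \<bullet> (H *v u))\<bar> = t * \<bar>E \<bullet> w\<bar>" using t by (simp add: abs_mult)
      also have "\<dots> \<le> t * (2 * e * t * N * N)"
      proof -
        have "\<bar>E \<bullet> w\<bar> \<le> norm E * norm w" by (rule Cauchy_Schwarz_ineq2)
        also have "\<dots> \<le> (2 * e * t * N) * N" using E t e N by (intro mult_mono) (auto simp: N_def)
        finally show ?thesis using t by simp
      qed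
      finally show ?thesis unfolding q_def
        by (simp add: power2_eq_square algebra_simps)
    qed
    show ?thesis using r est unfolding N_def by blast
  qed
  have "\<bar>u \<bullet> (H *v w) - w \<bullet> (H *v u)\<bar> \<le> e * (4 * (norm u + norm w)^2)" if e: "e > 0" for e
  proof -
    obtain r1 where r1: "r1 > 0" "\<And>t. 0 < t \<Longrightarrow> t < r1 \<Longrightarrow>
      \<bar>F (y + t *\<^sub>R u + t *\<^sub>R w) - F (y + t *\<^sub>R u) - F (y + t *\<^sub>R w) + F y - t^2 * (w \<bullet> (H *v u))\<bar>
        \<le> 2 * e * t^2 * (norm u + norm w)^2" using main[OF e, of u w] by blast
    obtain r2 where r2: "r2 > 0" "\<And>t. 0 < t \<Longrightarrow> t < r2 \<Longrightarrow>
      \<bar>F (y + t *\<^sub>R w + t *\<^sub>R u) - F (y + t *\<^sub>R w) - F (y + t *\<^sub>R u) + F y - t^2 * (u \<bullet> (H *v w))\<bar>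
        \<le> 2 * e * t^2 * (norm w + norm u)^2" using main[OF e, of w u] by blast
    define t where "t = min r1 r2 / 2"
    have t: "0 < t" "t < r1" "t < r2" unfolding t_def using r1(1) r2(1) by auto
    have sw: "y + t *\<^sub>R w + t *\<^sub>R u = y + t *\<^sub>R u + t *\<^sub>R w" "norm w + norm u = norm u + norm w" by simp_all
    have "\<bar>t^2 * (u \<bullet> (H *v w)) - t^2 * (w \<bullet> (H *v u))\<bar> \<le> 4 * e * t^2 * (norm u + norm w)^2"
      using r1(2)[OF t(1,2)] r2(2)[OF t(1,3)] unfolding sw by linarith
    then have "t^2 * \<bar>u \<bullet> (H *v w) - w \<bullet> (H *v u)\<bar> \<le> t^2 * (e * (4 * (norm u + norm w)^2))"
      unfolding right_diff_distrib[symmetric] abs_mult by (simp add: mult_ac)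
    then show ?thesis using t by simp
  qed
  note b = this
  have "\<bar>u \<bullet> (H *v w) - w \<bullet> (H *v u)\<bar> \<le> 0"
  proof (rule field_le_epsilon)
    fix e :: real assume "e > 0"
    have "4 * (norm u + norm w)^2 + 1 > 0" by (simp add: add_nonneg_pos)
    then have "e / (4 * (norm u + norm w)^2 + 1) * (4 * (norm u + norm w)^2) \<le> e"
      using \<open>e > 0\<close> by (simp add: field_simps)
    then show "\<bar>u \<bullet> (H *v w) - w \<bullet> (H *v u)\<bar> \<le> 0 + e"
      using b[of "e / (4 * (norm u + norm w)^2 + 1)"] \<open>e > 0\<close> \<open>4 * (norm u + norm w)^2 + 1 > 0\<close> by auto
  qed
  then show ?thesis by simp
qed

section \<open>Orthogonal projection onto the tangent space\<close>

lemma orthogonal_projection_unique: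
  fixes T :: "(real^'n) set"
  assumes "subspace T"
    "p \<in> T" "\<And>w. w \<in> T \<Longrightarrow> (x - p) \<bullet> w = 0" "q \<in> T" "\<And>w. w \<in> T \<Longrightarrow> (x - q) \<bullet> w = 0"
  shows "p = q"
proof -
  have "p - q \<in> T" using assms by (simp add: subspace_diff)
  then have "(x - q) \<bullet> (p - q) - (x - p) \<bullet> (p - q) = 0" using assms(3,5) by simp
  then have "(p - q) \<bullet> (p - q) = 0" by (simp add: inner_diff_left)
  then show ?thesis by simp
qed

text \<open>Orthogonal decompositions exist point by point; their uniqueness makes the chosen points
  depend linearly on \<open>x\<close>, hence come from a matrix.\<close>

lemma orthogonal_projection_exists:
  fixes T :: "(real^'n) set"
  assumes T: "subspace T"
  obtains P :: "real^'n^'n" where "\<And>x. P *v x \<in> T" "\<And>x w. w \<in> T \<Longrightarrow> (x - P *v x) \<bullet> w = 0"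
proof -
  have "\<exists>p. p \<in> T \<and> (\<forall>w\<in>T. (x - p) \<bullet> w = 0)" for x
  proof -
    obtain y z where "y \<in> span T" "\<And>w. w \<in> span T \<Longrightarrow> orthogonal z w" "x = y + z"
      using orthogonal_subspace_decomp_exists[of T x] by blast
    then show ?thesis using span_eq_iff[THEN iffD2, OF T] by (auto simp: orthogonal_def intro!: exI[of _ y])
  qed
  then have "\<exists>p. \<forall>x. p x \<in> T \<and> (\<forall>w\<in>T. (x - p x) \<bullet> w = 0)" by (intro choice allI)
  then obtain p where p: "\<And>x. p x \<in> T" "\<And>x w. w \<in> T \<Longrightarrow> (x - p x) \<bullet> w = 0" by blast
  have "linear p"
  proof (rule linearI)
    fix x y show "p (x + y) = p x + p y"
    proof (rule orthogonal_projection_unique[OF T p(1)])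
      fix w assume "w \<in> T"
      then show "(x + y - (p x + p y)) \<bullet> w = 0"
        using p(2)[of w x] p(2)[of w y] by (simp add: inner_diff_left inner_add_left)
    qed (use p T in \<open>auto simp: subspace_add\<close>)
  next
    fix c x show "p (c *\<^sub>R x) = c *\<^sub>R p x"
    proof (rule orthogonal_projection_unique[OF T p(1)])
      fix w assume "w \<in> T"
      then show "(c *\<^sub>R x - c *\<^sub>R p x) \<bullet> w = 0"
        using p(2)[of w x] by (simp add: inner_diff_left)
    qed (use p T in \<open>auto simp: subspace_scale\<close>)
  qed
  then have "matrix p *v x = p x" for x by (simp add: matrix_works)
  then show thesis using p by (intro that[of "matrix p"]) auto
qed

lemma tanproj_properties:
  fixes M :: "(real^'n) set"
  assumes T: "subspace (tangent_space M \<mu>)"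
  shows tanproj_in: "tanproj M \<mu> *v x \<in> tangent_space M \<mu>"
    and tanproj_normal: "x - tanproj M \<mu> *v x \<in> normal_space M \<mu>"
proof -
  obtain P :: "real^'n^'n" where P: "\<And>x. P *v x \<in> tangent_space M \<mu>" "\<And>x w. w \<in> tangent_space M \<mu> \<Longrightarrow> (x - P *v x) \<bullet> w = 0"
    using orthogonal_projection_exists[OF T] by blast
  have "\<exists>!P::real^'n^'n. \<forall>x. P *v x \<in> tangent_space M \<mu> \<and> x - P *v x \<in> normal_space M \<mu>"
  proof (rule ex1I[of _ P])
    show "\<forall>x. P *v x \<in> tangent_space M \<mu> \<and> x - P *v x \<in> normal_space M \<mu>"
      using P unfolding normal_space_def by auto
  next
    fix R :: "real^'n^'n" assume R: "\<forall>x. R *v x \<in> tangent_space M \<mu> \<and> x - R *v x \<in> normal_space M \<mu>"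
    have "R *v x = P *v x" for x
      by (rule orthogonal_projection_unique[OF T]) (use R P in \<open>auto simp: normal_space_def\<close>)
    then show "R = P" by (simp add: matrix_eq)
  qed
  from theI'[OF this] show "tanproj M \<mu> *v x \<in> tangent_space M \<mu>" "x - tanproj M \<mu> *v x \<in> normal_space M \<mu>"
    unfolding tanproj_def by blast+
qed

context
  fixes M :: "(real^'n) set" and \<mu> :: "real^'n"
  assumes T: "subspace (tangent_space M \<mu>)"
begin

lemma tanproj_eqI:
  assumes "p \<in> tangent_space M \<mu>" "x - p \<in> normal_space M \<mu>"
  shows "tanproj M \<mu> *v x = p"
  by (rule orthogonal_projection_unique[OF T])
     (use tanproj_properties[OF T] assms in \<open>auto simp: normal_space_def\<close>)

lemma tanproj_tangent: "w \<in> tangent_space M \<mu> \<Longrightarrow> tanproj M \<mu> *v w = w"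
  by (rule tanproj_eqI) (auto simp: normal_space_def)

lemma tanproj_normal_zero: "v \<in> normal_space M \<mu> \<Longrightarrow> tanproj M \<mu> *v v = 0"
  by (rule tanproj_eqI) (use T in \<open>auto simp: subspace_0\<close>)

lemma tanproj_inner: "(tanproj M \<mu> *v x) \<bullet> y = x \<bullet> (tanproj M \<mu> *v y)"
proof -
  have "(x - tanproj M \<mu> *v x) \<bullet> (tanproj M \<mu> *v y) = 0" "(y - tanproj M \<mu> *v y) \<bullet> (tanproj M \<mu> *v x) = 0"
    using tanproj_properties[OF T] by (auto simp: normal_space_def)
  then show ?thesis by (simp add: inner_diff_left inner_diff_right inner_commute)
qed

lemma tanproj_transpose: "transpose (tanproj M \<mu>) = tanproj M \<mu>"
proof -
  have "transpose (tanproj M \<mu>) *v x = tanproj M \<mu> *v x" for x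
  proof (rule vector_eq_rdot[THEN iffD1], rule allI)
    fix y show "(transpose (tanproj M \<mu>) *v x) \<bullet> y = (tanproj M \<mu> *v x) \<bullet> y"
      using tanproj_inner[of x y] by (simp add: dot_lmul_matrix)
  qed
  then show ?thesis by (simp add: matrix_eq)
qed

lemma tanproj_idem: "tanproj M \<mu> *v (tanproj M \<mu> *v x) = tanproj M \<mu> *v x"
  by (rule tanproj_tangent) (rule tanproj_properties[OF T])

lemma norm_tanproj_Pythagoras: "(norm x)^2 = (norm (tanproj M \<mu> *v x))^2 + (norm (x - tanproj M \<mu> *v x))^2"
proof -
  have "(x - tanproj M \<mu> *v x) \<bullet> (tanproj M \<mu> *v x) = 0"
    using tanproj_properties[OF T] by (auto simp: normal_space_def)
  then show ?thesis
    by (simp add: power2_norm_eq_inner inner_diff_left inner_diff_right inner_commute)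
qed

lemma norm_tanproj_le: "norm (tanproj M \<mu> *v x) \<le> norm x"
  by (rule power2_le_imp_le) (use norm_tanproj_Pythagoras[of x] in auto)

text \<open>Lets any convenient tangent vector \<open>w\<close> bound the normal part of
  \<open>x\<close>: Pythagoras is applied to \<open>x - w\<close>, which has the same normal
  part.\<close>

lemma norm_diff_tanproj_le:
  assumes "w \<in> tangent_space M \<mu>"
  shows "norm (x - tanproj M \<mu> *v x) \<le> norm (x - w)"
proof -
  have "(x - w) - tanproj M \<mu> *v (x - w) = x - tanproj M \<mu> *v x"
    using tanproj_tangent[OF assms] by (simp add: matrix_vector_mult_diff_distrib)
  with norm_tanproj_Pythagoras[of "x - w"] have "(norm (x - tanproj M \<mu> *v x))^2 \<le> (norm (x - w))^2" by simp
  then show ?thesis by (rule power2_le_imp_le) simp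
qed

end

section \<open>Straightening charts and the Weingarten map\<close>

text \<open>Subtracting the projection onto \<open>L\<close> gives a curve that vanishes near
  \<open>t\<close>, so the derivative of that curve, \<open>w - P w\<close>, vanishes too.\<close>

lemma subspace_has_vector_derivative:
  fixes f :: "real \<Rightarrow> real^'n"
  assumes L: "subspace L" and f: "(f has_vector_derivative w) (at t)"
    and ev: "\<forall>\<^sub>F s in nhds t. f s \<in> L"
  shows "w \<in> L"
proof -
  obtain P :: "real^'n^'n" where P: "\<And>x. P *v x \<in> L" "\<And>x w. w \<in> L \<Longrightarrow> (x - P *v x) \<bullet> w = 0"
    using orthogonal_projection_exists[OF L] by blast
  have fixL: "P *v x = x" if "x \<in> L" for x
    by (rule orthogonal_projection_unique[OF L P(1) P(2)]) (use that in auto)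
  have bl: "bounded_linear (\<lambda>x. x - P *v x)"
    by (intro bounded_linear_sub bounded_linear_ident matrix_vector_mul_bounded_linear)
  have "((\<lambda>s. f s - P *v f s) has_vector_derivative (w - P *v w)) (at t)"
    using bounded_linear.has_vector_derivative[OF bl f] .
  moreover have "((\<lambda>s. f s - P *v f s) has_vector_derivative 0) (at t)"
  proof -
    obtain S where S: "open S" "t \<in> S" "\<And>s. s \<in> S \<Longrightarrow> f s \<in> L"
      using ev unfolding eventually_nhds by blast
    have "((\<lambda>s. 0) has_vector_derivative 0) (at t)" by simp
    then show ?thesis
      by (rule has_vector_derivative_transform_within_open[OF _ S(1,2)]) (use S(3) fixL in auto)
  qed
  ultimately have "w - P *v w = 0" by (rule vector_derivative_unique_at)
  then show ?thesis using P(1)[of w] by simp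
qed

lemma has_vector_derivative_compose_matrix:
  fixes f :: "real^'n \<Rightarrow> real^'m"
  assumes "(\<gamma> has_vector_derivative w) (at t)" "(f has_derivative ((*v) J)) (at (\<gamma> t))"
  shows "((\<lambda>t. f (\<gamma> t)) has_vector_derivative (J *v w)) (at t)"
  using has_derivative_compose[OF assms(1)[unfolded has_vector_derivative_def] assms(2)]
  unfolding has_vector_derivative_def by (simp add: matrix_vector_mult_scaleR)

text \<open>A chart together with its derivative data: \<open>A\<close> and \<open>B\<close> are the
  Jacobians of \<phi> and \<psi>, and \<open>C k\<close> is that of row \<open>k\<close> of
  \<open>A\<close>, so \<open>C\<close> holds the second derivatives of \<phi>, from which curvature
  is read off. Fixing one choice keeps the later estimates free of existential quantifiers.\<close>

locale straightening =
  fixes M :: "(real^'n) set" and p U V \<phi> \<psi> L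
    and A B :: "real^'n \<Rightarrow> real^'n^'n" and C :: "'n \<Rightarrow> real^'n \<Rightarrow> real^'n^'n"
  assumes chart: "chart M p U V \<phi> \<psi> L"
    and d\<phi>: "\<And>x. x \<in> U \<Longrightarrow> (\<phi> has_derivative ((*v) (A x))) (at x)"
    and d\<psi>: "\<And>y. y \<in> V \<Longrightarrow> (\<psi> has_derivative ((*v) (B y))) (at y)"
    and dA: "\<And>x k. x \<in> U \<Longrightarrow> ((\<lambda>x. A x $ k) has_derivative ((*v) (C k x))) (at x)"
    and smooth_A: "smooth_mat U A" and smooth_B: "smooth_mat V B" and smooth_C: "\<And>k. smooth_mat U (C k)"
begin

lemma open_U: "open U" and open_V: "open V" and p_U: "p \<in> U" and L: "subspace L"
  and \<psi>\<phi>: "x \<in> U \<Longrightarrow> \<psi> (\<phi> x) = x" and \<phi>\<psi>: "y \<in> V \<Longrightarrow> \<phi> (\<psi> y) = y"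
  and \<phi>_V: "x \<in> U \<Longrightarrow> \<phi> x \<in> V" and smooth_\<psi>: "smooth_on V \<psi>"
  using chart unfolding chart_def by auto

lemma \<psi>_U: "y \<in> V \<Longrightarrow> \<psi> y \<in> U"
proof -
  assume "y \<in> V"
  then obtain x where "x \<in> U" "y = \<phi> x" using chart unfolding chart_def by auto
  then show ?thesis using \<psi>\<phi> by simp
qed

lemma \<phi>_L: "x \<in> M \<Longrightarrow> x \<in> U \<Longrightarrow> \<phi> x \<in> L"
  using chart unfolding chart_def by blast

lemma \<psi>_M: "y \<in> V \<Longrightarrow> y \<in> L \<Longrightarrow> \<psi> y \<in> M"
proof -
  assume "y \<in> V" "y \<in> L"
  then have "y \<in> \<phi> ` (M \<inter> U)" using chart unfolding chart_def by auto
  then show ?thesis using \<psi>\<phi> by auto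
qed

lemma A_B: "y \<in> V \<Longrightarrow> A (\<psi> y) *v (B y *v h) = h"
proof -
  assume y: "y \<in> V"
  have "((\<lambda>y. \<phi> (\<psi> y)) has_derivative (\<lambda>h. A (\<psi> y) *v (B y *v h))) (at y)"
    by (rule has_derivative_compose[OF d\<psi>[OF y] d\<phi>[OF \<psi>_U[OF y]]])
  moreover have "((\<lambda>y. \<phi> (\<psi> y)) has_derivative (\<lambda>h. h)) (at y)"
    by (rule has_derivative_transform_within_open[OF has_derivative_ident open_V y]) (simp add: \<phi>\<psi>)
  ultimately have "(\<lambda>h. A (\<psi> y) *v (B y *v h)) = (\<lambda>h. h)" by (rule has_derivative_unique)
  then show ?thesis by (rule fun_cong)
qed

lemma B_A: "x \<in> U \<Longrightarrow> B (\<phi> x) *v (A x *v h) = h"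
proof -
  assume x: "x \<in> U"
  have "((\<lambda>x. \<psi> (\<phi> x)) has_derivative (\<lambda>h. B (\<phi> x) *v (A x *v h))) (at x)"
    by (rule has_derivative_compose[OF d\<phi>[OF x] d\<psi>[OF \<phi>_V[OF x]]])
  moreover have "((\<lambda>x. \<psi> (\<phi> x)) has_derivative (\<lambda>h. h)) (at x)"
    by (rule has_derivative_transform_within_open[OF has_derivative_ident open_U x]) (simp add: \<psi>\<phi>)
  ultimately have "(\<lambda>h. B (\<phi> x) *v (A x *v h)) = (\<lambda>h. h)" by (rule has_derivative_unique)
  then show ?thesis by (rule fun_cong)
qed

text \<open>Provides curves in \<open>M\<close> with prescribed velocity, both to realize tangent
  vectors and to differentiate normal fields along.\<close>

lemma curve:
  assumes "y \<in> V" "y \<in> L" "l \<in> L"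
  obtains e where "e > 0" "\<And>t. t \<in> {-e<..<e} \<Longrightarrow> y + t *\<^sub>R l \<in> V \<and> \<psi> (y + t *\<^sub>R l) \<in> M"
    "((\<lambda>t. \<psi> (y + t *\<^sub>R l)) has_vector_derivative (B y *v l)) (at 0)"
proof -
  obtain \<rho> where \<rho>: "\<rho> > 0" "ball y \<rho> \<subseteq> V" using open_V assms openE by blast
  define e where "e = \<rho> / (norm l + 1)"
  have n: "norm l + 1 > 0" by (simp add: add_nonneg_pos)
  have e: "e > 0" unfolding e_def using \<rho> n by simp
  have V: "y + t *\<^sub>R l \<in> V" if "t \<in> {-e<..<e}" for t
  proof -
    have "\<bar>t\<bar> * norm l \<le> \<bar>t\<bar> * (norm l + 1)" by (intro mult_left_mono) auto
    also have "\<dots> < e * (norm l + 1)" using that n by (intro mult_strict_right_mono) auto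
    also have "\<dots> = \<rho>" unfolding e_def using n by simp
    finally have "dist y (y + t *\<^sub>R l) < \<rho>" by (simp add: dist_norm)
    then show ?thesis using \<rho> by auto
  qed
  have "y + t *\<^sub>R l \<in> L" for t using assms L by (simp add: subspace_add subspace_scale)
  moreover have "((\<lambda>t. \<psi> (y + t *\<^sub>R l)) has_vector_derivative (B y *v l)) (at 0)"
  proof (rule has_vector_derivative_compose_matrix[where f=\<psi>])
    show "((\<lambda>t. y + t *\<^sub>R l) has_vector_derivative l) (at 0)"
      by (auto intro!: derivative_eq_intros)
  qed (use assms d\<psi> in simp)
  ultimately show thesis using that[OF e] V \<psi>_M by blast
qed

text \<open>The definition of tangent vectors by curves shows neither linearity nor dimension. The
  chart turns curves in \<open>M\<close> into curves in \<open>L\<close>, whose velocities stay in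
  \<open>L\<close>, and lines in \<open>L\<close> into curves in \<open>M\<close>.\<close>

lemma tangent_space_eq:
  assumes \<mu>: "\<mu> \<in> M" "\<mu> \<in> U"
  shows "tangent_space M \<mu> = (\<lambda>l. B (\<phi> \<mu>) *v l) ` L"
proof safe
  fix v assume "v \<in> tangent_space M \<mu>"
  then obtain \<gamma> e where g: "0 < e" "\<And>t. t\<in>{-e<..<e} \<Longrightarrow> \<gamma> t \<in> M" "\<gamma> 0 = \<mu>" "(\<gamma> has_vector_derivative v) (at 0)"
    unfolding tangent_space_def by blast
  have d: "((\<lambda>t. \<phi> (\<gamma> t)) has_vector_derivative (A \<mu> *v v)) (at 0)"
    by (rule has_vector_derivative_compose_matrix[OF g(4)]) (use d\<phi> \<mu> g(3) in simp)
  have "isCont \<gamma> 0" using has_vector_derivative_continuous[OF g(4)] .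
  then have "\<forall>\<^sub>F t in nhds 0. \<gamma> t \<in> U"
    using \<mu>(2) open_U g(3) by (auto simp: isCont_def tendsto_at_iff_tendsto_nhds dest: topological_tendstoD)
  moreover have "\<forall>\<^sub>F t in nhds 0. t \<in> {-e<..<e}" using g(1) by (intro eventually_nhds_in_open) auto
  ultimately have "\<forall>\<^sub>F t in nhds 0. \<phi> (\<gamma> t) \<in> L"
    by eventually_elim (use g(2) \<phi>_L in auto)
  from subspace_has_vector_derivative[OF L d this] have "A \<mu> *v v \<in> L" .
  moreover have "v = B (\<phi> \<mu>) *v (A \<mu> *v v)" using B_A[OF \<mu>(2)] by simp
  ultimately show "v \<in> (\<lambda>l. B (\<phi> \<mu>) *v l) ` L" by blast
next
  fix l assume l: "l \<in> L"
  obtain e where e: "e > 0" "\<And>t. t \<in> {-e<..<e} \<Longrightarrow> \<phi> \<mu> + t *\<^sub>R l \<in> V \<and> \<psi> (\<phi> \<mu> + t *\<^sub>R l) \<in> M"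
    "((\<lambda>t. \<psi> (\<phi> \<mu> + t *\<^sub>R l)) has_vector_derivative (B (\<phi> \<mu>) *v l)) (at 0)"
    using curve[OF \<phi>_V[OF \<mu>(2)] \<phi>_L[OF \<mu>] l] by blast
  then show "B (\<phi> \<mu>) *v l \<in> tangent_space M \<mu>"
    unfolding tangent_space_def
    by (intro CollectI exI[of _ "\<lambda>t. \<psi> (\<phi> \<mu> + t *\<^sub>R l)"] exI[of _ e]) (auto simp: \<psi>\<phi> \<mu>)
qed

lemma B_tangent: "\<mu> \<in> M \<Longrightarrow> \<mu> \<in> U \<Longrightarrow> l \<in> L \<Longrightarrow> B (\<phi> \<mu>) *v l \<in> tangent_space M \<mu>"
  by (simp add: tangent_space_eq)

lemma A_tangent: "\<mu> \<in> M \<Longrightarrow> \<mu> \<in> U \<Longrightarrow> w \<in> tangent_space M \<mu> \<Longrightarrow> A \<mu> *v w \<in> L"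
  using A_B[OF \<phi>_V] by (auto simp: tangent_space_eq \<psi>\<phi>)

lemma subspace_tangent: "\<mu> \<in> M \<Longrightarrow> \<mu> \<in> U \<Longrightarrow> subspace (tangent_space M \<mu>)"
  unfolding tangent_space_eq
  by (intro linear_subspace_image[OF _ L] matrix_vector_mul_linear)

lemma dim_tangent: "\<mu> \<in> M \<Longrightarrow> \<mu> \<in> U \<Longrightarrow> dim (tangent_space M \<mu>) = dim L"
proof -
  assume \<mu>: "\<mu> \<in> M" "\<mu> \<in> U"
  have "inj ((*v) (B (\<phi> \<mu>)))"
    by (rule injI) (metis A_B[OF \<phi>_V[OF \<mu>(2)]])
  then show ?thesis unfolding tangent_space_eq[OF \<mu>]
    by (intro dim_image_eq matrix_vector_mul_linear) (auto intro: inj_on_subset)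
qed

lemma normal_space_iff:
  "\<mu> \<in> M \<Longrightarrow> \<mu> \<in> U \<Longrightarrow> z \<in> normal_space M \<mu> \<longleftrightarrow> (\<forall>l\<in>L. z \<bullet> (B (\<phi> \<mu>) *v l) = 0)"
  unfolding normal_space_def by (auto simp: tangent_space_eq)

end

lemma straightening_exists:
  assumes ch: "chart M p U V \<phi> \<psi> L"
  obtains A B C where "straightening M p U V \<phi> \<psi> L A B C"
proof -
  have U: "open U" "open V" "smooth_on U \<phi>" "smooth_on V \<psi>" using ch unfolding chart_def by auto
  obtain A where A: "\<And>x. x \<in> U \<Longrightarrow> (\<phi> has_derivative ((*v) (A x))) (at x)" "smooth_mat U A"
    using smooth_jacobian[OF U(1,3)] by blast
  obtain B where B: "\<And>x. x \<in> V \<Longrightarrow> (\<psi> has_derivative ((*v) (B x))) (at x)" "smooth_mat V B"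
    using smooth_jacobian[OF U(2,4)] by blast
  have "\<exists>J. (\<forall>x\<in>U. ((\<lambda>x. A x $ k) has_derivative ((*v) (J x))) (at x)) \<and> smooth_mat U J" for k
  proof -
    have "smooth_on U (\<lambda>x. A x $ k)" using A(2) unfolding smooth_on_def smooth_mat_def by blast
    from smooth_jacobian[OF U(1) this] obtain J
      where "\<And>x. x \<in> U \<Longrightarrow> ((\<lambda>x. A x $ k) has_derivative ((*v) (J x))) (at x)" "smooth_mat U J" by metis
    then show ?thesis by (intro exI[of _ J]) simp
  qed
  then have "\<exists>C. \<forall>k. (\<forall>x\<in>U. ((\<lambda>x. A x $ k) has_derivative ((*v) (C k x))) (at x)) \<and> smooth_mat U (C k)"
    by (intro choice allI)
  then obtain C where C: "\<And>x k. x \<in> U \<Longrightarrow> ((\<lambda>x. A x $ k) has_derivative ((*v) (C k x))) (at x)"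
     "\<And>k. smooth_mat U (C k)" by blast
  show thesis using that[of A B C] ch A B C unfolding straightening_def by blast
qed

lemma submanifold_straightening:
  assumes "submanifold m M" "p \<in> M"
  obtains U V \<phi> \<psi> L A B C where "straightening M p U V \<phi> \<psi> L A B C" "dim L = m"
  using assms straightening_exists unfolding submanifold_def by metis

lemma submanifold_tangent:
  assumes "submanifold m M" "\<mu> \<in> M"
  shows subspace_tangent_space: "subspace (tangent_space M \<mu>)" and dim_tangent_space: "dim (tangent_space M \<mu>) = m"
proof -
  obtain U V \<phi> \<psi> L A B C where s: "straightening M \<mu> U V \<phi> \<psi> L A B C" and m: "dim L = m"
    using submanifold_straightening[OF assms] by blast
  show "subspace (tangent_space M \<mu>)" "dim (tangent_space M \<mu>) = m"
    using straightening.subspace_tangent[OF s assms(2)] straightening.dim_tangent[OF s assms(2)]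
      straightening.p_U[OF s] m by auto
qed

section \<open>Normal fields and the Weingarten matrix\<close>

definition normal_field :: "(real^'n) set \<Rightarrow> real^'n \<Rightarrow> real^'n \<Rightarrow> (real^'n) set \<Rightarrow> (real^'n \<Rightarrow> real^'n) \<Rightarrow> (real^'n \<Rightarrow> real^'n) \<Rightarrow> bool" where
  "normal_field M \<mu> v U \<nu> \<nu>' \<longleftrightarrow> open U \<and> \<mu> \<in> U \<and> smooth_on U \<nu> \<and>
        (\<forall>\<alpha>\<in>M \<inter> U. \<nu> \<alpha> \<in> normal_space M \<alpha>) \<and> \<nu> \<mu> = v \<and> (\<nu> has_derivative \<nu>') (at \<mu>)"

context straightening begin

text \<open>The inner product of \<nu> with the moving tangent vector \<open>B y l\<close> vanishes
  along the curve, so its derivative does. In the result \<nu> survives only through its value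
  \<open>v\<close>; hence two normal fields with the same value have the same tangential
  derivative.\<close>

lemma normal_field_derivative:
  assumes \<mu>: "\<mu> \<in> M" "\<mu> \<in> U" and \<nu>: "normal_field M \<mu> v U' \<nu> \<nu>'"
    and a: "a \<in> L" and l: "l \<in> L"
    and X: "((\<lambda>t. B (\<phi> \<mu> + t *\<^sub>R a) *v l) has_vector_derivative X) (at 0)"
  shows "\<nu>' (B (\<phi> \<mu>) *v a) \<bullet> (B (\<phi> \<mu>) *v l) = - (v \<bullet> X)"
proof -
  define \<gamma> where "\<gamma> t = \<psi> (\<phi> \<mu> + t *\<^sub>R a)" for t
  have y: "\<phi> \<mu> \<in> V" "\<phi> \<mu> \<in> L" using \<phi>_V \<phi>_L \<mu> by auto
  obtain e where e: "e > 0" "\<And>t. t \<in> {-e<..<e} \<Longrightarrow> \<phi> \<mu> + t *\<^sub>R a \<in> V \<and> \<gamma> t \<in> M"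
    "(\<gamma> has_vector_derivative (B (\<phi> \<mu>) *v a)) (at 0)"
    using curve[OF y a] unfolding \<gamma>_def by blast
  have g0: "\<gamma> 0 = \<mu>" unfolding \<gamma>_def using \<psi>\<phi> \<mu> by simp
  have n: "open U'" "\<mu> \<in> U'" "\<And>\<alpha>. \<alpha> \<in> M \<Longrightarrow> \<alpha> \<in> U' \<Longrightarrow> \<nu> \<alpha> \<in> normal_space M \<alpha>" "\<nu> \<mu> = v"
    "(\<nu> has_derivative \<nu>') (at \<mu>)" using \<nu> unfolding normal_field_def by auto
  have d1: "((\<lambda>t. \<nu> (\<gamma> t)) has_vector_derivative \<nu>' (B (\<phi> \<mu>) *v a)) (at 0)"
    using has_derivative_compose[OF e(3)[unfolded has_vector_derivative_def], of \<nu> \<nu>'] n(5) g0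
      linear_scale[OF has_derivative_linear[OF n(5)]]
    unfolding has_vector_derivative_def by simp
  have d2: "((\<lambda>t. \<nu> (\<gamma> t) \<bullet> (B (\<phi> \<mu> + t *\<^sub>R a) *v l)) has_vector_derivative
      (\<nu>' (B (\<phi> \<mu>) *v a) \<bullet> (B (\<phi> \<mu>) *v l) + v \<bullet> X)) (at 0)"
    using bounded_bilinear.has_vector_derivative[OF bounded_bilinear_inner d1 X] n(4) g0
    by (simp add: add.commute)
  have "isCont \<gamma> 0" using has_vector_derivative_continuous[OF e(3)] .
  then have "\<forall>\<^sub>F t in nhds 0. \<gamma> t \<in> U'"
    using n(1,2) g0 by (auto simp: isCont_def tendsto_at_iff_tendsto_nhds dest: topological_tendstoD)
  moreover have "\<forall>\<^sub>F t in nhds 0. t \<in> {-e<..<e}" using e(1) by (intro eventually_nhds_in_open) auto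
  ultimately have "\<forall>\<^sub>F t in nhds 0. \<nu> (\<gamma> t) \<bullet> (B (\<phi> \<mu> + t *\<^sub>R a) *v l) = 0"
  proof eventually_elim
    fix t assume t: "\<gamma> t \<in> U'" "t \<in> {-e<..<e}"
    then have V: "\<phi> \<mu> + t *\<^sub>R a \<in> V" "\<gamma> t \<in> M" using e(2) by auto
    then have "\<gamma> t \<in> U" "\<phi> (\<gamma> t) = \<phi> \<mu> + t *\<^sub>R a" unfolding \<gamma>_def using \<psi>_U \<phi>\<psi> by auto
    then show "\<nu> (\<gamma> t) \<bullet> (B (\<phi> \<mu> + t *\<^sub>R a) *v l) = 0"
      using n(3)[OF V(2) t(1)] normal_space_iff[OF V(2), of "\<nu> (\<gamma> t)"] l by auto
  qed
  then obtain S where S: "open S" "0 \<in> S" "\<And>t. t \<in> S \<Longrightarrow> \<nu> (\<gamma> t) \<bullet> (B (\<phi> \<mu> + t *\<^sub>R a) *v l) = 0"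
    unfolding eventually_nhds by blast
  have "((\<lambda>s. 0::real) has_vector_derivative 0) (at 0)" by simp
  then have "((\<lambda>t. \<nu> (\<gamma> t) \<bullet> (B (\<phi> \<mu> + t *\<^sub>R a) *v l)) has_vector_derivative 0) (at 0)"
    by (rule has_vector_derivative_transform_within_open[OF _ S(1,2)]) (use S(3) in auto)
  from vector_derivative_unique_at[OF this d2] show ?thesis by simp
qed

text \<open>The covector of \<open>v\<close> in chart coordinates. For \<open>v\<close> normal at
  \<mu> it annihilates \<open>L\<close>.\<close>

definition coframe :: "real^'n \<Rightarrow> real^'n \<Rightarrow> real^'n" where
  "coframe \<mu> v = transpose (B (\<phi> \<mu>)) *v v"

text \<open>The gradient of u \<bullet> \<phi>, that is, the transpose of \<open>A \<alpha>\<close>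
  applied to \<open>u\<close>. If \<open>u\<close> annihilates \<open>L\<close>, then u \<bullet>
  \<phi> vanishes on \<open>M\<close> within the chart, so this gradient is normal to
  \<open>M\<close>. The sum over the rows can be differentiated row by row through
  \<open>C\<close>.\<close>

definition nfield :: "real^'n \<Rightarrow> real^'n \<Rightarrow> real^'n" where
  "nfield u \<alpha> = (\<Sum>k\<in>UNIV. u $ k *\<^sub>R (A \<alpha> $ k))"

text \<open>The Hessian of u \<bullet> \<phi>, from which its symmetry follows.\<close>

definition nfield_deriv :: "real^'n \<Rightarrow> real^'n \<Rightarrow> real^'n^'n" where
  "nfield_deriv u \<alpha> = (\<Sum>k\<in>UNIV. u $ k *\<^sub>R C k \<alpha>)"

lemma nfield_inner: "nfield u \<alpha> \<bullet> h = u \<bullet> (A \<alpha> *v h)"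
proof -
  have "A \<alpha> $ k \<bullet> h = (A \<alpha> *v h) $ k" for k by (simp add: matrix_vector_mult_def inner_vec_def)
  then show ?thesis unfolding nfield_def by (simp add: inner_sum_left inner_vec_def[of u])
qed

lemma coframe_inner: "coframe \<mu> v \<bullet> l = v \<bullet> (B (\<phi> \<mu>) *v l)"
  unfolding coframe_def by (simp add: dot_lmul_matrix)

lemma nfield_deriv_apply: "nfield_deriv u \<alpha> *v h = (\<Sum>k\<in>UNIV. u $ k *\<^sub>R (C k \<alpha> *v h))"
proof -
  have "linear (\<lambda>X :: real^'n^'n. X *v h)"
    by (intro linearI) (auto simp: matrix_vector_mult_add_rdistrib scaleR_matrix_vector_assoc)
  from linear_sum[OF this, of "\<lambda>k. u $ k *\<^sub>R C k \<alpha>" UNIV] show ?thesis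
    unfolding nfield_deriv_def by (simp add: scaleR_matrix_vector_assoc)
qed

lemma has_derivative_nfield:
  assumes "\<alpha> \<in> U"
  shows "(nfield u has_derivative ((*v) (nfield_deriv u \<alpha>))) (at \<alpha>)"
proof -
  have "((\<lambda>x. \<Sum>k\<in>UNIV. u $ k *\<^sub>R (A x $ k)) has_derivative (\<lambda>h. \<Sum>k\<in>UNIV. u $ k *\<^sub>R (C k \<alpha> *v h))) (at \<alpha>)"
    by (intro has_derivative_sum has_derivative_scaleR_right dA assms)
  moreover have "(*v) (nfield_deriv u \<alpha>) = (\<lambda>h. \<Sum>k\<in>UNIV. u $ k *\<^sub>R (C k \<alpha> *v h))"
    by (simp add: fun_eq_iff nfield_deriv_apply)
  ultimately show ?thesis by (simp add: nfield_def[abs_def])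
qed

lemma nfield_normal:
  assumes \<mu>: "\<mu> \<in> M" "\<mu> \<in> U" and v: "v \<in> normal_space M \<mu>" and \<alpha>: "\<alpha> \<in> M" "\<alpha> \<in> U"
  shows "nfield (coframe \<mu> v) \<alpha> \<in> normal_space M \<alpha>"
  unfolding normal_space_iff[OF \<alpha>]
proof
  fix l assume l: "l \<in> L"
  have "nfield (coframe \<mu> v) \<alpha> \<bullet> (B (\<phi> \<alpha>) *v l) = coframe \<mu> v \<bullet> l"
    using A_B[OF \<phi>_V[OF \<alpha>(2)], of l] \<psi>\<phi>[OF \<alpha>(2)] by (simp add: nfield_inner)
  also have "\<dots> = 0" using v l unfolding normal_space_iff[OF \<mu>] by (simp add: coframe_inner)
  finally show "nfield (coframe \<mu> v) \<alpha> \<bullet> (B (\<phi> \<alpha>) *v l) = 0" .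
qed

lemma nfield_base:
  assumes "\<mu> \<in> U"
  shows "nfield (coframe \<mu> v) \<mu> = v"
proof (rule vector_eq_rdot[THEN iffD1], rule allI)
  fix h show "nfield (coframe \<mu> v) \<mu> \<bullet> h = v \<bullet> h"
    using B_A[OF assms] by (simp add: nfield_inner coframe_inner)
qed

lemma normal_field_nfield:
  assumes \<mu>: "\<mu> \<in> M" "\<mu> \<in> U" and v: "v \<in> normal_space M \<mu>"
  shows "normal_field M \<mu> v U (nfield (coframe \<mu> v)) ((*v) (nfield_deriv (coframe \<mu> v) \<mu>))"
proof -
  have "smooth_on U (nfield u)" for u
    unfolding smooth_on_def
  proof safe
    fix k j
    have "nfield u x $ j = (\<Sum>i\<in>UNIV. u $ i * A x $ i $ j)" for x unfolding nfield_def by simp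
    moreover have "Ck k U (\<lambda>x. \<Sum>i\<in>UNIV. u $ i * A x $ i $ j)"
      using smooth_A unfolding smooth_mat_def by (intro Ck_sum Ck_mult Ck_const) auto
    ultimately show "Ck k U (\<lambda>x. nfield u x $ j)" by presburger
  qed
  then show ?thesis unfolding normal_field_def
    using assms open_U nfield_normal nfield_base has_derivative_nfield by auto
qed

lemma nfield_deriv_symmetric:
  assumes "\<alpha> \<in> U"
  shows "x \<bullet> (nfield_deriv u \<alpha> *v y) = y \<bullet> (nfield_deriv u \<alpha> *v x)"
proof (rule hessian_symmetric[OF open_U assms _ has_derivative_nfield[OF assms]])
  fix z assume z: "z \<in> U"
  show "((\<lambda>x. u \<bullet> \<phi> x) has_derivative (\<lambda>h. nfield u z \<bullet> h)) (at z)"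
    unfolding nfield_inner by (rule has_derivative_inner_right[OF d\<phi>[OF z]])
qed

text \<open>A definite description over all normal fields needs one such field and independence of
  the choice. \<open>nfield\<close> supplies the first; for the second, the derivatives of two
  fields, paired with tangent vectors, are compared by
  \<open>normal_field_derivative\<close>.\<close>

lemma weingarten_tan_eq:
  assumes \<mu>: "\<mu> \<in> M" "\<mu> \<in> U" and v: "v \<in> normal_space M \<mu>"
  shows "weingarten_tan M \<mu> v = - (tanproj M \<mu> ** nfield_deriv (coframe \<mu> v) \<mu> ** tanproj M \<mu>)"
proof -
  define P where "P = tanproj M \<mu>"
  define N where "N = nfield_deriv (coframe \<mu> v) \<mu>"
  note T = subspace_tangent[OF \<mu>]
  have eq: "P ** matrix \<nu>' ** P = P ** N ** P" if \<nu>: "normal_field M \<mu> v U' \<nu> \<nu>'" for U' \<nu> \<nu>'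
  proof -
    have lin: "linear \<nu>'" using \<nu> unfolding normal_field_def by (auto dest: has_derivative_linear)
    have mw: "matrix \<nu>' *v x = \<nu>' x" for x using lin by (simp add: matrix_works)
    have main: "\<nu>' w \<bullet> z = (N *v w) \<bullet> z" if wz: "w \<in> tangent_space M \<mu>" "z \<in> tangent_space M \<mu>" for w z
    proof -
      obtain a l where al: "a \<in> L" "l \<in> L" "w = B (\<phi> \<mu>) *v a" "z = B (\<phi> \<mu>) *v l"
        using wz tangent_space_eq[OF \<mu>] by auto
      have sm: "smooth_on V (\<lambda>y. B y *v l)"
        unfolding smooth_on_def matrix_vector_mult_def
        using smooth_B unfolding smooth_mat_def by (auto intro!: Ck_sum Ck_mult Ck_const)
      obtain J where "\<And>x. x \<in> V \<Longrightarrow> ((\<lambda>y. B y *v l) has_derivative ((*v) (J x))) (at x)"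
        using smooth_jacobian[OF open_V sm] by blast
      then have J: "((\<lambda>y. B y *v l) has_derivative ((*v) (J (\<phi> \<mu>)))) (at (\<phi> \<mu> + 0 *\<^sub>R a))" using \<phi>_V[OF \<mu>(2)] by simp
      have "((\<lambda>t. \<phi> \<mu> + t *\<^sub>R a) has_vector_derivative a) (at 0)" by (auto intro!: derivative_eq_intros)
      note X = has_vector_derivative_compose_matrix[OF this J]
      show ?thesis unfolding al N_def
        using normal_field_derivative[OF \<mu> \<nu> al(1,2) X]
          normal_field_derivative[OF \<mu> normal_field_nfield[OF \<mu> v] al(1,2) X] by simp
    qed
    have "(P ** matrix \<nu>' ** P) *v x = (P ** N ** P) *v x" for x
    proof (rule vector_eq_rdot[THEN iffD1], rule allI)
      fix y
      have "((P ** matrix \<nu>' ** P) *v x) \<bullet> y = \<nu>' (P *v x) \<bullet> (P *v y)"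
        unfolding P_def by (simp add: matrix_vector_mul_assoc[symmetric] tanproj_inner[OF T] mw)
      also have "\<dots> = (N *v (P *v x)) \<bullet> (P *v y)"
        unfolding P_def by (intro main tanproj_in[OF T])
      also have "\<dots> = ((P ** N ** P) *v x) \<bullet> y"
        unfolding P_def by (simp add: matrix_vector_mul_assoc[symmetric] tanproj_inner[OF T])
      finally show "((P ** matrix \<nu>' ** P) *v x) \<bullet> y = ((P ** N ** P) *v x) \<bullet> y" .
    qed
    then show ?thesis by (simp add: matrix_eq)
  qed
  have "weingarten_tan M \<mu> v = (THE W. \<forall>U \<nu> \<nu>'. normal_field M \<mu> v U \<nu> \<nu>' \<longrightarrow> W = - (P ** matrix \<nu>' ** P))"
    unfolding weingarten_tan_def normal_field_def P_def by simp
  also have "\<dots> = - (P ** N ** P)"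
  proof (rule the_equality)
    show "\<forall>U \<nu> \<nu>'. normal_field M \<mu> v U \<nu> \<nu>' \<longrightarrow> - (P ** N ** P) = - (P ** matrix \<nu>' ** P)"
      using eq by simp
  next
    fix W assume "\<forall>U \<nu> \<nu>'. normal_field M \<mu> v U \<nu> \<nu>' \<longrightarrow> W = - (P ** matrix \<nu>' ** P)"
    then show "W = - (P ** N ** P)" using normal_field_nfield[OF \<mu> v] eq[OF normal_field_nfield[OF \<mu> v]] by metis
  qed
  finally show ?thesis unfolding P_def N_def .
qed

text \<open>The Hessian \<open>nfield_deriv\<close> is symmetric and stays so between two orthogonal
  projections. This makes G symmetric, which turns the quadratic form of the third claim into a
  squared norm.\<close>

lemma weingarten_tan_symmetric:
  assumes \<mu>: "\<mu> \<in> M" "\<mu> \<in> U" and v: "v \<in> normal_space M \<mu>"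
  shows "x \<bullet> (weingarten_tan M \<mu> v *v y) = y \<bullet> (weingarten_tan M \<mu> v *v x)"
proof -
  define P where "P = tanproj M \<mu>"
  define N where "N = nfield_deriv (coframe \<mu> v) \<mu>"
  note T = subspace_tangent[OF \<mu>]
  have i: "a \<bullet> (P *v b) = (P *v a) \<bullet> b" for a b unfolding P_def using tanproj_inner[OF T] by simp
  have "x \<bullet> ((P ** N ** P) *v y) = (P *v x) \<bullet> (N *v (P *v y))" for x y
    by (simp add: matrix_vector_mul_assoc[symmetric] i)
  then have "x \<bullet> ((P ** N ** P) *v y) = y \<bullet> ((P ** N ** P) *v x)"
    unfolding N_def using nfield_deriv_symmetric[OF \<mu>(2)] by simp
  moreover have "(- X) *v z = - (X *v z)" for X :: "real^'n^'n" and z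
    by (simp add: vec_eq_iff matrix_vector_mult_def sum_negf)
  ultimately show ?thesis unfolding weingarten_tan_eq[OF assms] P_def N_def by simp
qed

end

section \<open>Second-order estimates along M\<close>

lemma matrix_vector_mult_uminus: "(- X) *v z = - (X *v z)" for X :: "real^'n^'m"
  by (simp add: vec_eq_iff matrix_vector_mult_def sum_negf)

context straightening begin

text \<open>Testing the difference \<open>d\<close> against itself moves the transposed matrix to
  the other side, where \<open>norm_matrix_vector_mult_le\<close> applies. The same device recurs
  below.\<close>

lemma norm_nfield_diff_le: "norm (nfield u \<alpha> - nfield u \<beta>) \<le> norm u * norm (A \<alpha> - A \<beta>)"
proof -
  define d where "d = nfield u \<alpha> - nfield u \<beta>"
  have "d \<bullet> d = u \<bullet> ((A \<alpha> - A \<beta>) *v d)"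
    using nfield_inner[of u \<alpha> d] nfield_inner[of u \<beta> d] d_def
    by (simp add: inner_diff_left matrix_vector_mult_diff_rdistrib inner_diff_right)
  also have "\<dots> \<le> norm u * (norm (A \<alpha> - A \<beta>) * norm d)"
    by (intro order_trans[OF norm_cauchy_schwarz] mult_left_mono norm_matrix_vector_mult_le) auto
  finally have "norm d * norm d \<le> norm u * norm (A \<alpha> - A \<beta>) * norm d"
    by (simp add: power2_norm_eq_inner[symmetric] power2_eq_square mult_ac)
  then show ?thesis unfolding d_def[symmetric] by (cases "norm d = 0") auto
qed

text \<open>All bounds share one ball and one constant and hold for pairs of points; those on
  \<open>nfield\<close> are linear in the norm of \<open>u\<close>, so that they scale with the
  normal vector.\<close>

lemma local_bounds:
  obtains \<rho> K where "\<rho> > 0" "K \<ge> 0" "ball p \<rho> \<subseteq> U"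
    "\<And>\<alpha>. \<alpha> \<in> ball p \<rho> \<Longrightarrow> norm (A \<alpha>) \<le> K"
    "\<And>\<alpha>. \<alpha> \<in> ball p \<rho> \<Longrightarrow> norm (B (\<phi> \<alpha>)) \<le> K"
    "\<And>\<alpha> \<beta>. \<alpha> \<in> ball p \<rho> \<Longrightarrow> \<beta> \<in> ball p \<rho> \<Longrightarrow> norm (\<phi> \<alpha> - \<phi> \<beta>) \<le> K * norm (\<alpha> - \<beta>)"
    "\<And>\<alpha> \<beta>. \<alpha> \<in> ball p \<rho> \<Longrightarrow> \<beta> \<in> ball p \<rho> \<Longrightarrow> norm (B (\<phi> \<alpha>) - B (\<phi> \<beta>)) \<le> K * norm (\<alpha> - \<beta>)"
    "\<And>\<alpha> \<beta>. \<alpha> \<in> ball p \<rho> \<Longrightarrow> \<beta> \<in> ball p \<rho> \<Longrightarrow>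
       norm (\<alpha> - \<beta> - B (\<phi> \<beta>) *v (\<phi> \<alpha> - \<phi> \<beta>)) \<le> K * norm (\<phi> \<alpha> - \<phi> \<beta>)^2"
    "\<And>\<alpha> u. \<alpha> \<in> ball p \<rho> \<Longrightarrow> norm (nfield_deriv u \<alpha>) \<le> K * norm u"
    "\<And>\<alpha> \<beta> u. \<alpha> \<in> ball p \<rho> \<Longrightarrow> \<beta> \<in> ball p \<rho> \<Longrightarrow> norm (nfield u \<alpha> - nfield u \<beta>) \<le> K * norm u * norm (\<alpha> - \<beta>)"
    "\<And>\<alpha> \<beta> u. \<alpha> \<in> ball p \<rho> \<Longrightarrow> \<beta> \<in> ball p \<rho> \<Longrightarrow>
       norm (nfield u \<alpha> - nfield u \<beta> - nfield_deriv u \<beta> *v (\<alpha> - \<beta>)) \<le> K * norm u * norm (\<alpha> - \<beta>)^2"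
proof -
  have pV: "\<phi> p \<in> V" using \<phi>_V p_U by blast
  obtain \<rho>1 K1 where 1: "\<rho>1 > 0" "K1 \<ge> 0" "ball p \<rho>1 \<subseteq> U"
    "\<And>x y. x \<in> ball p \<rho>1 \<Longrightarrow> y \<in> ball p \<rho>1 \<Longrightarrow> norm (A x - A y) \<le> K1 * norm (x - y)"
    "\<And>x. x \<in> ball p \<rho>1 \<Longrightarrow> norm (A x) \<le> K1"
    using smooth_mat_lipschitz[OF open_U p_U smooth_A] by metis
  obtain \<rho>2 K2 where 2: "\<rho>2 > 0" "K2 \<ge> 0"
    "\<And>x y. x \<in> ball (\<phi> p) \<rho>2 \<Longrightarrow> y \<in> ball (\<phi> p) \<rho>2 \<Longrightarrow> norm (B x - B y) \<le> K2 * norm (x - y)"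
    "\<And>x. x \<in> ball (\<phi> p) \<rho>2 \<Longrightarrow> norm (B x) \<le> K2"
    using smooth_mat_lipschitz[OF open_V pV smooth_B] by metis
  obtain \<rho>3 K3 where 3: "\<rho>3 > 0" "K3 \<ge> 0"
    "\<And>x y. x \<in> ball p \<rho>3 \<Longrightarrow> y \<in> ball p \<rho>3 \<Longrightarrow> norm (\<phi> x - \<phi> y - A y *v (x - y)) \<le> K3 * norm (x - y)^2"
    using smooth_remainder[OF open_U p_U smooth_A d\<phi>] by metis
  obtain \<rho>4 K4 where 4: "\<rho>4 > 0" "K4 \<ge> 0"
    "\<And>x y. x \<in> ball (\<phi> p) \<rho>4 \<Longrightarrow> y \<in> ball (\<phi> p) \<rho>4 \<Longrightarrow> norm (\<psi> x - \<psi> y - B y *v (x - y)) \<le> K4 * norm (x - y)^2"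
    using smooth_remainder[OF open_V pV smooth_B d\<psi>] by metis
  have "\<exists>r. fst r > 0 \<and> snd r \<ge> 0 \<and> (\<forall>x\<in>ball p (fst r). norm (C k x) \<le> snd r) \<and>
     (\<forall>x\<in>ball p (fst r). \<forall>y\<in>ball p (fst r). norm (A x $ k - A y $ k - C k y *v (x - y)) \<le> snd r * norm (x - y)^2)" for k
  proof -
    obtain \<rho> K where c: "\<rho> > 0" "K \<ge> 0"
      "\<And>x. x \<in> ball p \<rho> \<Longrightarrow> norm (C k x) \<le> K"
      using smooth_mat_lipschitz[OF open_U p_U smooth_C[of k]] by metis
    obtain \<rho>' K' where d: "\<rho>' > 0" "K' \<ge> 0"
      "\<And>x y. x \<in> ball p \<rho>' \<Longrightarrow> y \<in> ball p \<rho>' \<Longrightarrow> norm (A x $ k - A y $ k - C k y *v (x - y)) \<le> K' * norm (x - y)^2"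
      using smooth_remainder[OF open_U p_U smooth_C[of k] dA] by metis
    have "norm (C k x) \<le> max K K'" if "x \<in> ball p (min \<rho> \<rho>')" for x
      using c(3)[of x] that by auto
    moreover have "norm (A x $ k - A y $ k - C k y *v (x - y)) \<le> max K K' * norm (x - y)^2"
      if "x \<in> ball p (min \<rho> \<rho>')" "y \<in> ball p (min \<rho> \<rho>')" for x y
    proof -
      have "norm (A x $ k - A y $ k - C k y *v (x - y)) \<le> K' * norm (x - y)^2" using d(3) that by auto
      also have "\<dots> \<le> max K K' * norm (x - y)^2" by (intro mult_right_mono) auto
      finally show ?thesis .
    qed
    ultimately show ?thesis using c d
      by (intro exI[of _ "(min \<rho> \<rho>', max K K')"]) auto
  qed
  then have "\<exists>r. \<forall>k. fst (r k) > 0 \<and> snd (r k) \<ge> 0 \<and> (\<forall>x\<in>ball p (fst (r k)). norm (C k x) \<le> snd (r k)) \<and>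
     (\<forall>x\<in>ball p (fst (r k)). \<forall>y\<in>ball p (fst (r k)). norm (A x $ k - A y $ k - C k y *v (x - y)) \<le> snd (r k) * norm (x - y)^2)"
    by (intro choice allI)
  then obtain r where r: "\<And>k. fst (r k) > 0" "\<And>k. snd (r k) \<ge> 0"
    "\<And>k x. x\<in>ball p (fst (r k)) \<Longrightarrow> norm (C k x) \<le> snd (r k)"
    "\<And>k x y. x\<in>ball p (fst (r k)) \<Longrightarrow> y\<in>ball p (fst (r k)) \<Longrightarrow>
       norm (A x $ k - A y $ k - C k y *v (x - y)) \<le> snd (r k) * norm (x - y)^2" by blast
  define \<rho>5 where "\<rho>5 = Min (range (\<lambda>k. fst (r k)))"
  have \<rho>5: "\<rho>5 > 0" "\<And>k. \<rho>5 \<le> fst (r k)" unfolding \<rho>5_def using r(1) by (auto simp: Min_gr_iff)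
  define K5 where "K5 = (\<Sum>k\<in>UNIV. snd (r k))"
  have K5: "K5 \<ge> 0" unfolding K5_def using r(2) by (simp add: sum_nonneg)
  \<comment> \<open>The factor 2 bounds the distance of two points in a ball of radius at most 1; it
    turns the quadratic remainder of \<phi> into a linear one.\<close>
  define K\<phi> where "K\<phi> = K1 + K3 * 2"
  have K\<phi>: "K\<phi> \<ge> 0" unfolding K\<phi>_def using 1 3 by simp
  define \<rho>' where "\<rho>' = min 1 (min \<rho>1 (min \<rho>3 \<rho>5))"
  have \<rho>': "\<rho>' > 0" "\<rho>' \<le> 1" "\<rho>' \<le> \<rho>1" "\<rho>' \<le> \<rho>3" "\<rho>' \<le> \<rho>5" unfolding \<rho>'_def using 1 3 \<rho>5 by auto
  have n2: "norm (\<alpha> - \<beta>) \<le> 2" if "\<alpha> \<in> ball p \<rho>'" "\<beta> \<in> ball p \<rho>'" for \<alpha> \<beta>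
    using that \<rho>'(2) dist_triangle3[of \<alpha> \<beta> p] by (simp add: dist_norm)
  have l\<phi>: "norm (\<phi> \<alpha> - \<phi> \<beta>) \<le> K\<phi> * norm (\<alpha> - \<beta>)" if ab: "\<alpha> \<in> ball p \<rho>'" "\<beta> \<in> ball p \<rho>'" for \<alpha> \<beta>
  proof -
    have "norm (\<phi> \<alpha> - \<phi> \<beta>) \<le> norm (\<phi> \<alpha> - \<phi> \<beta> - A \<beta> *v (\<alpha> - \<beta>)) + norm (A \<beta> *v (\<alpha> - \<beta>))"
      using norm_triangle_ineq[of "\<phi> \<alpha> - \<phi> \<beta> - A \<beta> *v (\<alpha> - \<beta>)" "A \<beta> *v (\<alpha> - \<beta>)"] by simp
    also have "\<dots> \<le> K3 * norm (\<alpha> - \<beta>)^2 + K1 * norm (\<alpha> - \<beta>)"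
    proof (intro add_mono)
      have "norm (A \<beta> *v (\<alpha> - \<beta>)) \<le> norm (A \<beta>) * norm (\<alpha> - \<beta>)" by (rule norm_matrix_vector_mult_le)
      also have "\<dots> \<le> K1 * norm (\<alpha> - \<beta>)" using 1(5)[of \<beta>] ab \<rho>' by (intro mult_right_mono) auto
      finally show "norm (A \<beta> *v (\<alpha> - \<beta>)) \<le> K1 * norm (\<alpha> - \<beta>)" .
    qed (use 3(3)[of \<alpha> \<beta>] ab \<rho>' in auto)
    also have "K3 * norm (\<alpha> - \<beta>)^2 \<le> K3 * (2 * norm (\<alpha> - \<beta>))"
      unfolding power2_eq_square using n2[OF ab] 3(2) by (intro mult_left_mono mult_right_mono) auto
    finally show ?thesis unfolding K\<phi>_def by (simp add: algebra_simps)
  qed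
  \<comment> \<open>Small enough that \<phi>, with Lipschitz constant \<open>K\<phi>\<close>, maps
    the ball into both balls at \<open>\<phi> p\<close> on which \<open>B\<close> and the remainder
    of \<psi> are controlled.\<close>
  define \<rho> where "\<rho> = min \<rho>' (min \<rho>2 \<rho>4 / (K\<phi> + 1))"
  have \<rho>: "\<rho> > 0" "\<rho> \<le> \<rho>'" unfolding \<rho>_def using \<rho>'(1) 2(1) 4(1) K\<phi> by simp_all
  have "\<rho> \<le> min \<rho>2 \<rho>4 / (K\<phi> + 1)" unfolding \<rho>_def by simp
  with K\<phi> have "\<rho> * (K\<phi> + 1) \<le> min \<rho>2 \<rho>4" by (simp add: pos_le_divide_eq)
  note \<rho> = \<rho> this
  have \<phi>ball: "\<phi> \<alpha> \<in> ball (\<phi> p) \<rho>2 \<inter> ball (\<phi> p) \<rho>4" if "\<alpha> \<in> ball p \<rho>" for \<alpha>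
  proof -
    have "norm (\<phi> \<alpha> - \<phi> p) \<le> K\<phi> * norm (\<alpha> - p)" using that \<rho> by (intro l\<phi>) auto
    also have "\<dots> \<le> (K\<phi> + 1) * norm (\<alpha> - p)" by (intro mult_right_mono) auto
    also have "\<dots> < (K\<phi> + 1) * \<rho>" using that K\<phi> by (intro mult_strict_left_mono) (auto simp: dist_norm norm_minus_commute)
    finally have "dist (\<phi> p) (\<phi> \<alpha>) < min \<rho>2 \<rho>4" using \<rho>(3) by (simp add: dist_norm norm_minus_commute mult.commute)
    then show ?thesis by auto
  qed
  define K where "K = K1 + K2 + K\<phi> + K2 * K\<phi> + K4 + K5 + (K1 + K5 * 2)"
  have K: "K1 \<le> K" "K2 \<le> K" "K\<phi> \<le> K" "K2 * K\<phi> \<le> K" "K4 \<le> K" "K5 \<le> K" "K1 + K5 * 2 \<le> K" "K \<ge> 0"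
    unfolding K_def using 1(2) 2(2) 3(2) 4(2) K5 K\<phi> by (simp_all add: add_nonneg_nonneg)
  have r\<rho>: "\<rho> \<le> fst (r k)" for k using \<rho>(2) \<rho>'(5) \<rho>5(2)[of k] by linarith
  have lin_est: "norm (\<Sum>k\<in>UNIV. u $ k *\<^sub>R f k) \<le> K5 * X * norm u"
    if "\<And>k. norm (f k) \<le> snd (r k) * X" for f :: "'n \<Rightarrow> 'c::real_normed_vector" and X u
  proof -
    have "norm (\<Sum>k\<in>UNIV. u $ k *\<^sub>R f k) \<le> (\<Sum>k\<in>UNIV. norm u * (snd (r k) * X))"
    proof (rule order_trans[OF norm_sum sum_mono])
      fix k show "norm (u $ k *\<^sub>R f k) \<le> norm u * (snd (r k) * X)"
        using that[of k] component_le_norm_cart[of u k] unfolding norm_scaleR by (intro mult_mono) auto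
    qed
    also have "\<dots> = K5 * X * norm u" unfolding K5_def by (simp add: sum_distrib_left sum_distrib_right mult_ac)
    finally show ?thesis .
  qed
  have D: "norm (nfield_deriv u \<alpha>) \<le> K5 * norm u" if "\<alpha> \<in> ball p \<rho>" for \<alpha> u
    using lin_est[of "\<lambda>k. C k \<alpha>" 1 u] r(3)[of \<alpha>] that r\<rho> unfolding nfield_deriv_def by (auto simp: less_le_trans)
  have R: "norm (nfield u \<alpha> - nfield u \<beta> - nfield_deriv u \<beta> *v (\<alpha> - \<beta>)) \<le> K5 * norm u * norm (\<alpha> - \<beta>)^2"
    if ab: "\<alpha> \<in> ball p \<rho>" "\<beta> \<in> ball p \<rho>" for \<alpha> \<beta> u
  proof -
    have "nfield u \<alpha> - nfield u \<beta> - nfield_deriv u \<beta> *v (\<alpha> - \<beta>)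
      = (\<Sum>k\<in>UNIV. u $ k *\<^sub>R (A \<alpha> $ k - A \<beta> $ k - C k \<beta> *v (\<alpha> - \<beta>)))"
      unfolding nfield_def nfield_deriv_apply by (simp add: sum_subtractf scaleR_diff_right)
    also have "norm \<dots> \<le> K5 * norm (\<alpha> - \<beta>)^2 * norm u"
    proof (rule lin_est)
      fix k
      have "\<alpha> \<in> ball p (fst (r k))" "\<beta> \<in> ball p (fst (r k))" using ab r\<rho>[of k] by auto
      then show "norm (A \<alpha> $ k - A \<beta> $ k - C k \<beta> *v (\<alpha> - \<beta>)) \<le> snd (r k) * norm (\<alpha> - \<beta>)^2" by (rule r(4))
    qed
    finally show ?thesis by (simp add: mult_ac)
  qed
  show thesis
  proof (rule that[of \<rho> K])
    show "\<rho> > 0" "K \<ge> 0" using \<rho> K by auto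
    show "ball p \<rho> \<subseteq> U" using 1(3) \<rho>(2) \<rho>'(3) by (meson order_trans subset_ball)
  next
    fix \<alpha> assume a: "\<alpha> \<in> ball p \<rho>"
    show "norm (A \<alpha>) \<le> K" using 1(5)[of \<alpha>] a \<rho> \<rho>' K by auto
    show "norm (B (\<phi> \<alpha>)) \<le> K" using 2(4)[of "\<phi> \<alpha>"] \<phi>ball[OF a] K by auto
    fix u show "norm (nfield_deriv u \<alpha>) \<le> K * norm u"
      using D[OF a, of u] mult_right_mono[OF K(6), of "norm u"] by auto
  next
    fix \<alpha> \<beta> assume ab: "\<alpha> \<in> ball p \<rho>" "\<beta> \<in> ball p \<rho>"
    then have ab': "\<alpha> \<in> ball p \<rho>'" "\<beta> \<in> ball p \<rho>'" using \<rho> by auto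
    show "norm (\<phi> \<alpha> - \<phi> \<beta>) \<le> K * norm (\<alpha> - \<beta>)"
      using l\<phi>[OF ab'] mult_right_mono[OF K(3), of "norm (\<alpha> - \<beta>)"] by auto
    have "norm (B (\<phi> \<alpha>) - B (\<phi> \<beta>)) \<le> K2 * norm (\<phi> \<alpha> - \<phi> \<beta>)"
      using 2(3) \<phi>ball ab by blast
    also have "\<dots> \<le> K2 * (K\<phi> * norm (\<alpha> - \<beta>))" using l\<phi>[OF ab'] 2(2) by (intro mult_left_mono)
    also have "\<dots> \<le> K * norm (\<alpha> - \<beta>)" using mult_right_mono[OF K(4), of "norm (\<alpha> - \<beta>)"] by (simp add: mult_ac)
    finally show "norm (B (\<phi> \<alpha>) - B (\<phi> \<beta>)) \<le> K * norm (\<alpha> - \<beta>)" .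
    have "\<alpha> \<in> U" "\<beta> \<in> U" using ab' 1(3) \<rho>' by auto
    then have "norm (\<alpha> - \<beta> - B (\<phi> \<beta>) *v (\<phi> \<alpha> - \<phi> \<beta>)) \<le> K4 * norm (\<phi> \<alpha> - \<phi> \<beta>)^2"
      using 4(3)[of "\<phi> \<alpha>" "\<phi> \<beta>"] \<phi>ball ab \<psi>\<phi> by auto
    also have "\<dots> \<le> K * norm (\<phi> \<alpha> - \<phi> \<beta>)^2" using K(5) by (intro mult_right_mono) auto
    finally show "norm (\<alpha> - \<beta> - B (\<phi> \<beta>) *v (\<phi> \<alpha> - \<phi> \<beta>)) \<le> K * norm (\<phi> \<alpha> - \<phi> \<beta>)^2" .
    fix u :: "real^'n"
    have "K5 * norm u * norm (\<alpha> - \<beta>)^2 \<le> K * norm u * norm (\<alpha> - \<beta>)^2" using K(6) by (intro mult_right_mono) auto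
    then show "norm (nfield u \<alpha> - nfield u \<beta> - nfield_deriv u \<beta> *v (\<alpha> - \<beta>)) \<le> K * norm u * norm (\<alpha> - \<beta>)^2"
      using R[OF ab, of u] by linarith
    have "norm (nfield u \<alpha> - nfield u \<beta>) \<le> norm u * norm (A \<alpha> - A \<beta>)" by (rule norm_nfield_diff_le)
    also have "\<dots> \<le> norm u * (K * norm (\<alpha> - \<beta>))"
    proof (rule mult_left_mono)
      have "norm (A \<alpha> - A \<beta>) \<le> K1 * norm (\<alpha> - \<beta>)" using 1(4)[of \<alpha> \<beta>] ab' \<rho>' by auto
      also have "\<dots> \<le> K * norm (\<alpha> - \<beta>)" using K(1) by (intro mult_right_mono) auto
      finally show "norm (A \<alpha> - A \<beta>) \<le> K * norm (\<alpha> - \<beta>)" .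
    qed simp
    finally show "norm (nfield u \<alpha> - nfield u \<beta>) \<le> K * norm u * norm (\<alpha> - \<beta>)" by (simp add: mult_ac)
  qed
qed

lemma norm_coframe_le: "norm (B (\<phi> \<mu>)) \<le> K \<Longrightarrow> norm (coframe \<mu> v) \<le> K * norm v"
proof -
  assume K: "norm (B (\<phi> \<mu>)) \<le> K"
  define u where "u = coframe \<mu> v"
  have "u \<bullet> u = v \<bullet> (B (\<phi> \<mu>) *v u)" unfolding u_def by (rule coframe_inner)
  also have "\<dots> \<le> norm v * (norm (B (\<phi> \<mu>)) * norm u)"
    by (intro order_trans[OF norm_cauchy_schwarz] mult_left_mono norm_matrix_vector_mult_le) auto
  also have "\<dots> \<le> norm v * (K * norm u)" using K by (intro mult_left_mono mult_right_mono) auto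
  finally have "norm u * norm u \<le> K * norm v * norm u"
    by (simp add: power2_norm_eq_inner[symmetric] power2_eq_square mult_ac)
  moreover have "0 \<le> K * norm v" using order_trans[OF norm_ge_zero K] by simp
  ultimately show ?thesis unfolding u_def[symmetric] by (cases "norm u = 0") auto
qed

end

text \<open>The three facts of second-order geometry that the limit theorem uses: flatness of
  \<open>M\<close> to first order, Lipschitz dependence of the normal spaces, and the Weingarten map
  as the first-order turning of a normal vector. In the last one the error separates the size of
  \<open>v\<close> from the change \<open>n - v\<close>, since both have different bounds
  later.\<close>

definition tangential_estimates :: "(real^'n) set \<Rightarrow> real \<Rightarrow> real^'n \<Rightarrow> real^'n \<Rightarrow> bool" where
  "tangential_estimates M K \<mu> \<mu>' \<longleftrightarrow>
     norm (\<mu>' - \<mu> - tanproj M \<mu> *v (\<mu>' - \<mu>)) \<le> K * norm (\<mu>' - \<mu>)^2 \<and>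
     (\<forall>z\<in>normal_space M \<mu>'. norm (tanproj M \<mu> *v z) \<le> K * (norm (\<mu>' - \<mu>) * norm z)) \<and>
     (\<forall>v\<in>normal_space M \<mu>. \<forall>n\<in>normal_space M \<mu>'.
        norm (tanproj M \<mu> *v n + weingarten_tan M \<mu> v *v (\<mu>' - \<mu>))
          \<le> K * (norm v * norm (\<mu>' - \<mu>)^2 + norm (\<mu>' - \<mu>) * norm (n - v)))"

lemma tangential_estimates_mono:
  assumes "tangential_estimates M K \<mu> \<mu>'" "K \<le> K'"
  shows "tangential_estimates M K' \<mu> \<mu>'"
proof -
  have m: "x \<le> K * y \<Longrightarrow> 0 \<le> y \<Longrightarrow> x \<le> K' * y" for x y
    using mult_right_mono[OF assms(2)] by (meson order_trans)
  show ?thesis using assms(1) unfolding tangential_estimates_def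
    by (auto intro!: m add_nonneg_nonneg mult_nonneg_nonneg)
qed

context straightening begin

lemma local_tangential_estimates:
  obtains \<rho> K where "\<rho> > 0" "K \<ge> 0"
    "\<And>\<mu> \<mu>'. \<mu> \<in> M \<Longrightarrow> \<mu>' \<in> M \<Longrightarrow> \<mu> \<in> ball p \<rho> \<Longrightarrow> \<mu>' \<in> ball p \<rho> \<Longrightarrow> tangential_estimates M K \<mu> \<mu>'"
proof -
  obtain \<rho> K where \<rho>: "\<rho> > 0" "K \<ge> 0" "ball p \<rho> \<subseteq> U"
    and bA: "\<And>\<alpha>. \<alpha> \<in> ball p \<rho> \<Longrightarrow> norm (A \<alpha>) \<le> K"
    and bB: "\<And>\<alpha>. \<alpha> \<in> ball p \<rho> \<Longrightarrow> norm (B (\<phi> \<alpha>)) \<le> K"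
    and l\<phi>: "\<And>\<alpha> \<beta>. \<alpha> \<in> ball p \<rho> \<Longrightarrow> \<beta> \<in> ball p \<rho> \<Longrightarrow> norm (\<phi> \<alpha> - \<phi> \<beta>) \<le> K * norm (\<alpha> - \<beta>)"
    and lB: "\<And>\<alpha> \<beta>. \<alpha> \<in> ball p \<rho> \<Longrightarrow> \<beta> \<in> ball p \<rho> \<Longrightarrow> norm (B (\<phi> \<alpha>) - B (\<phi> \<beta>)) \<le> K * norm (\<alpha> - \<beta>)"
    and r\<psi>: "\<And>\<alpha> \<beta>. \<alpha> \<in> ball p \<rho> \<Longrightarrow> \<beta> \<in> ball p \<rho> \<Longrightarrow>
       norm (\<alpha> - \<beta> - B (\<phi> \<beta>) *v (\<phi> \<alpha> - \<phi> \<beta>)) \<le> K * norm (\<phi> \<alpha> - \<phi> \<beta>)^2"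
    and bN: "\<And>\<alpha> u. \<alpha> \<in> ball p \<rho> \<Longrightarrow> norm (nfield_deriv u \<alpha>) \<le> K * norm u"
    and lN: "\<And>\<alpha> \<beta> u. \<alpha> \<in> ball p \<rho> \<Longrightarrow> \<beta> \<in> ball p \<rho> \<Longrightarrow> norm (nfield u \<alpha> - nfield u \<beta>) \<le> K * norm u * norm (\<alpha> - \<beta>)"
    and rN: "\<And>\<alpha> \<beta> u. \<alpha> \<in> ball p \<rho> \<Longrightarrow> \<beta> \<in> ball p \<rho> \<Longrightarrow>
       norm (nfield u \<alpha> - nfield u \<beta> - nfield_deriv u \<beta> *v (\<alpha> - \<beta>)) \<le> K * norm u * norm (\<alpha> - \<beta>)^2"
    by (fact local_bounds)
  \<comment> \<open>\<open>K^3\<close> comes from the first estimate, \<open>K^2\<close> from the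
    second, and the bracket collects the three terms quadratic in \<Delta> of the third.\<close>
  define K' where "K' = K^2 + K^3 + (K^4 + K^2 + K^5)"
  have K': "K^2 \<le> K'" "K^3 \<le> K'" "K^4 + K^2 + K^5 \<le> K'" "0 \<le> K'" unfolding K'_def using \<rho>(2) by simp_all
  have "tangential_estimates M K' \<mu> \<mu>'" if M: "\<mu> \<in> M" "\<mu>' \<in> M" and b: "\<mu> \<in> ball p \<rho>" "\<mu>' \<in> ball p \<rho>" for \<mu> \<mu>'
  proof -
    have U: "\<mu> \<in> U" "\<mu>' \<in> U" using b \<rho>(3) by auto
    note T = subspace_tangent[OF M(1) U(1)]
    define P where "P = tanproj M \<mu>"
    define \<Delta> where "\<Delta> = \<mu>' - \<mu>"
    have E2: "norm (\<Delta> - P *v \<Delta>) \<le> K^3 * norm \<Delta>^2"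
    proof -
      \<comment> \<open>The linearized chart displacement is tangent at \<mu>, hence at least as far
        from \<Delta> as the projection of \<Delta>.\<close>
      have w: "B (\<phi> \<mu>) *v (\<phi> \<mu>' - \<phi> \<mu>) \<in> tangent_space M \<mu>"
        by (intro B_tangent M U subspace_diff L \<phi>_L)
      have "norm (\<Delta> - P *v \<Delta>) \<le> norm (\<mu>' - \<mu> - B (\<phi> \<mu>) *v (\<phi> \<mu>' - \<phi> \<mu>))"
        unfolding P_def \<Delta>_def by (rule norm_diff_tanproj_le[OF T w])
      also have "\<dots> \<le> K * norm (\<phi> \<mu>' - \<phi> \<mu>)^2" by (rule r\<psi>[OF b(2,1)])
      also have "\<dots> \<le> K * (K * norm \<Delta>)^2"
        unfolding \<Delta>_def using l\<phi>[OF b(2,1)] \<rho>(2) by (intro mult_left_mono power_mono) auto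
      finally show ?thesis by (simp add: power2_eq_square power3_eq_cube mult_ac)
    qed
    have E1: "norm (P *v z) \<le> K^2 * (norm \<Delta> * norm z)" if z: "z \<in> normal_space M \<mu>'" for z
    proof -
      define w where "w = P *v z"
      have wT: "w \<in> tangent_space M \<mu>" unfolding w_def P_def by (rule tanproj_in[OF T])
      define l where "l = A \<mu> *v w"
      have l: "l \<in> L" unfolding l_def by (rule A_tangent[OF M(1) U(1) wT])
      have nl: "norm l \<le> K * norm w" unfolding l_def
        by (intro order_trans[OF norm_matrix_vector_mult_le] mult_right_mono bA b) auto
      have wl: "w = B (\<phi> \<mu>) *v l" unfolding l_def using B_A[OF U(1)] by simp
      \<comment> \<open>The same coordinates \<open>l\<close> give a tangent vector at \<mu>', to
        which \<open>z\<close> is orthogonal; hence only the change of the frame \<open>B\<close>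
        between the two points contributes to w \<bullet> w.\<close>
      have "z \<bullet> (B (\<phi> \<mu>') *v l) = 0" using z l normal_space_iff[OF M(2) U(2)] by blast
      moreover have "w \<bullet> w = z \<bullet> w"
        using tanproj_normal[OF T, of z] wT unfolding normal_space_def w_def P_def by (auto simp: inner_diff_left)
      ultimately have "w \<bullet> w = z \<bullet> ((B (\<phi> \<mu>) - B (\<phi> \<mu>')) *v l)"
        using wl by (simp add: matrix_vector_mult_diff_rdistrib inner_diff_right)
      also have "\<dots> \<le> norm z * (norm (B (\<phi> \<mu>) - B (\<phi> \<mu>')) * norm l)"
        by (intro order_trans[OF norm_cauchy_schwarz] mult_left_mono norm_matrix_vector_mult_le) auto
      also have "\<dots> \<le> norm z * ((K * norm \<Delta>) * (K * norm w))"
        using lB[OF b] nl \<rho>(2) unfolding \<Delta>_def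
        by (intro mult_left_mono mult_mono) (auto simp: norm_minus_commute)
      finally have "norm w * norm w \<le> K^2 * (norm \<Delta> * norm z) * norm w"
        by (simp add: power2_norm_eq_inner[symmetric] power2_eq_square mult_ac)
      then show ?thesis unfolding w_def[symmetric] using \<rho>(2) by (cases "norm w = 0") auto
    qed
    have E3: "norm (P *v n + weingarten_tan M \<mu> v *v \<Delta>)
          \<le> K' * (norm v * norm \<Delta>^2 + norm \<Delta> * norm (n - v))"
      if v: "v \<in> normal_space M \<mu>" and n: "n \<in> normal_space M \<mu>'" for v n
    proof -
      define u where "u = coframe \<mu> v"
      \<comment> \<open>The normal field extending \<open>v\<close>, evaluated at \<mu>'. It splits
        the error: \<open>n - \<nu>\<close> is normal at \<mu>' and falls under the second estimate,
        while \<open>\<nu> - v\<close> is expanded along the field.\<close>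
      define \<nu> where "\<nu> = nfield u \<mu>'"
      define N where "N = nfield_deriv u \<mu>"
      have u: "norm u \<le> K * norm v" unfolding u_def by (rule norm_coframe_le[OF bB[OF b(1)]])
      have \<nu>: "\<nu> \<in> normal_space M \<mu>'" unfolding \<nu>_def u_def by (rule nfield_normal[OF M(1) U(1) v M(2) U(2)])
      have v0: "nfield u \<mu> = v" unfolding u_def by (rule nfield_base[OF U(1)])
      have Pv: "P *v v = 0" unfolding P_def by (rule tanproj_normal_zero[OF T v])
      have W: "weingarten_tan M \<mu> v *v \<Delta> = - (P *v (N *v (P *v \<Delta>)))"
        unfolding weingarten_tan_eq[OF M(1) U(1) v] P_def N_def u_def
        by (simp add: matrix_vector_mul_assoc[symmetric] matrix_vector_mult_uminus)
      have nP: "norm (P *v x) \<le> norm x" for x unfolding P_def by (rule norm_tanproj_le[OF T])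
      have "n - \<nu> \<in> normal_space M \<mu>'" using n \<nu> unfolding normal_space_def by (auto simp: inner_diff_left)
      note t1 = E1[OF this]
      have "norm (n - \<nu>) \<le> norm (n - v) + norm (\<nu> - v)" using norm_triangle_ineq4[of "n - v" "\<nu> - v"] by simp
      also have "norm (\<nu> - v) \<le> K * norm u * norm \<Delta>" using lN[OF b(2,1), of u] unfolding \<nu>_def v0 \<Delta>_def .
      also have "\<dots> \<le> K * (K * norm v) * norm \<Delta>" using u \<rho>(2) by (intro mult_right_mono mult_left_mono) auto
      finally have "norm (n - \<nu>) \<le> norm (n - v) + K * (K * norm v) * norm \<Delta>" by simp
      then have "K^2 * (norm \<Delta> * norm (n - \<nu>)) \<le> K^2 * (norm \<Delta> * (norm (n - v) + K * (K * norm v) * norm \<Delta>))"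
        by (intro mult_left_mono) auto
      with t1 have s1: "norm (P *v (n - \<nu>)) \<le> K^2 * (norm \<Delta> * norm (n - v)) + K^4 * (norm v * norm \<Delta>^2)"
        by (simp add: algebra_simps power2_eq_square power4_eq_xxxx)
      have "norm (P *v (\<nu> - v - N *v \<Delta>)) \<le> K * norm u * norm \<Delta>^2"
        using order_trans[OF nP rN[OF b(2,1), of u]] unfolding \<nu>_def v0 \<Delta>_def N_def .
      also have "\<dots> \<le> K * (K * norm v) * norm \<Delta>^2" using u \<rho>(2) by (intro mult_right_mono mult_left_mono) auto
      finally have s2: "norm (P *v (\<nu> - v - N *v \<Delta>)) \<le> K^2 * (norm v * norm \<Delta>^2)" by (simp add: power2_eq_square mult_ac)
      have "norm (P *v (N *v (\<Delta> - P *v \<Delta>))) \<le> norm N * norm (\<Delta> - P *v \<Delta>)"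
        by (rule order_trans[OF nP norm_matrix_vector_mult_le])
      also have "\<dots> \<le> (K * (K * norm v)) * (K^3 * norm \<Delta>^2)"
      proof (intro mult_mono E2)
        show "norm N \<le> K * (K * norm v)" unfolding N_def
          using bN[OF b(1), of u] mult_left_mono[OF u \<rho>(2)] by linarith
      qed (use \<rho>(2) in auto)
      finally have s3: "norm (P *v (N *v (\<Delta> - P *v \<Delta>))) \<le> K^5 * (norm v * norm \<Delta>^2)"
        by (simp add: power2_eq_square power3_eq_cube eval_nat_numeral mult_ac)
      \<comment> \<open>P v = 0 as \<open>v\<close> is normal. The last term arises because the
        Weingarten matrix sees only the tangential part of \<Delta>, whereas the expansion of the
        field uses all of it.\<close>
      have "P *v n + weingarten_tan M \<mu> v *v \<Delta> = P *v (n - \<nu>) + P *v (\<nu> - v - N *v \<Delta>) + P *v (N *v (\<Delta> - P *v \<Delta>))"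
        unfolding W by (simp add: matrix_vector_mult_diff_distrib Pv)
      then have "norm (P *v n + weingarten_tan M \<mu> v *v \<Delta>) \<le>
         norm (P *v (n - \<nu>)) + norm (P *v (\<nu> - v - N *v \<Delta>)) + norm (P *v (N *v (\<Delta> - P *v \<Delta>)))"
        by (simp add: norm_triangle_le norm_triangle_ineq)
      also have "\<dots> \<le> K^2 * (norm \<Delta> * norm (n - v)) + (K^4 + K^2 + K^5) * (norm v * norm \<Delta>^2)"
        using s1 s2 s3 by (simp add: algebra_simps)
      also have "\<dots> \<le> K' * (norm \<Delta> * norm (n - v)) + K' * (norm v * norm \<Delta>^2)"
        using K' by (intro add_mono mult_right_mono) auto
      finally show ?thesis by (simp add: algebra_simps)
    qed
    have "norm (\<Delta> - P *v \<Delta>) \<le> K' * norm \<Delta>^2" 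
      using E2 mult_right_mono[OF K'(2), of "norm \<Delta>^2"] by auto
    moreover have "norm (P *v z) \<le> K' * (norm \<Delta> * norm z)" if "z \<in> normal_space M \<mu>'" for z
      using E1[OF that] mult_right_mono[OF K'(1), of "norm \<Delta> * norm z"] by auto
    ultimately show ?thesis using E3 unfolding tangential_estimates_def P_def \<Delta>_def by blast
  qed
  then show thesis using that[of \<rho> K'] \<rho>(1) K'(4) by blast
qed

end

lemma uniform_tangential_estimates:
  assumes "compact M" "submanifold m M"
  obtains \<rho> K where "\<rho> > 0" "K \<ge> 0"
    "\<And>\<mu> \<mu>'. \<mu> \<in> M \<Longrightarrow> \<mu>' \<in> M \<Longrightarrow> norm (\<mu>' - \<mu>) < \<rho> \<Longrightarrow> tangential_estimates M K \<mu> \<mu>'"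
proof -
  have "\<exists>r. fst r > 0 \<and> snd r \<ge> 0 \<and>
     (\<forall>\<mu>\<in>M \<inter> ball p (fst r). \<forall>\<mu>'\<in>M \<inter> ball p (fst r). tangential_estimates M (snd r) \<mu> \<mu>')" if p: "p \<in> M" for p
  proof -
    obtain U V \<phi> \<psi> L A B C where "straightening M p U V \<phi> \<psi> L A B C"
      using submanifold_straightening[OF assms(2) p] by metis
    from straightening.local_tangential_estimates[OF this] obtain \<rho> K where "\<rho> > 0" "K \<ge> 0"
    "\<And>\<mu> \<mu>'. \<mu> \<in> M \<Longrightarrow> \<mu>' \<in> M \<Longrightarrow> \<mu> \<in> ball p \<rho> \<Longrightarrow> \<mu>' \<in> ball p \<rho> \<Longrightarrow> tangential_estimates M K \<mu> \<mu>'"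
      by metis
    then show ?thesis by (intro exI[of _ "(\<rho>, K)"]) auto
  qed
  then have "\<exists>r. \<forall>p\<in>M. fst (r p) > 0 \<and> snd (r p) \<ge> 0 \<and>
     (\<forall>\<mu>\<in>M \<inter> ball p (fst (r p)). \<forall>\<mu>'\<in>M \<inter> ball p (fst (r p)). tangential_estimates M (snd (r p)) \<mu> \<mu>')"
    by (intro bchoice ballI)
  then obtain r where r: "\<And>p. p \<in> M \<Longrightarrow> fst (r p) > 0" "\<And>p. p \<in> M \<Longrightarrow> snd (r p) \<ge> 0"
    "\<And>p \<mu> \<mu>'. p \<in> M \<Longrightarrow> \<mu> \<in> M \<Longrightarrow> \<mu> \<in> ball p (fst (r p)) \<Longrightarrow> \<mu>' \<in> M \<Longrightarrow> \<mu>' \<in> ball p (fst (r p)) \<Longrightarrow>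
       tangential_estimates M (snd (r p)) \<mu> \<mu>'" by blast
  \<comment> \<open>Half radii leave room: if \<mu> lies in a half ball, every point closer to \<mu>
    than \<rho> still lies in the full ball.\<close>
  have "M \<subseteq> (\<Union>p\<in>M. ball p (fst (r p) / 2))" using r(1) by fastforce
  then obtain F where F: "F \<subseteq> M" "finite F" "M \<subseteq> (\<Union>p\<in>F. ball p (fst (r p) / 2))"
    using compactE_image[OF assms(1), of M "\<lambda>p. ball p (fst (r p) / 2)"] by blast
  define \<rho> where "\<rho> = Min (insert 1 ((\<lambda>p. fst (r p) / 2) ` F))"
  define K where "K = Max (insert 0 ((\<lambda>p. snd (r p)) ` F))"
  have "\<And>p. p \<in> F \<Longrightarrow> \<rho> \<le> fst (r p) / 2" unfolding \<rho>_def using F(2) by (intro Min_le) auto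
  moreover have "\<rho> > 0" unfolding \<rho>_def using F(1,2) r(1) by (auto simp: Min_gr_iff subset_iff)
  ultimately have \<rho>: "\<rho> > 0" "\<And>p. p \<in> F \<Longrightarrow> \<rho> \<le> fst (r p) / 2" by blast+
  have K: "K \<ge> 0" "\<And>p. p \<in> F \<Longrightarrow> snd (r p) \<le> K" unfolding K_def using F(2) by auto
  show thesis
  proof (rule that[OF \<rho>(1) K(1)])
    fix \<mu> \<mu>' assume \<mu>: "\<mu> \<in> M" "\<mu>' \<in> M" "norm (\<mu>' - \<mu>) < \<rho>"
    then obtain p where p: "p \<in> F" "\<mu> \<in> ball p (fst (r p) / 2)" using F(3) by blast
    have "dist p \<mu>' \<le> dist p \<mu> + dist \<mu> \<mu>'" by (rule dist_triangle)
    also have "\<dots> < fst (r p)" using p \<mu>(3) \<rho>(2)[OF p(1)] by (simp add: dist_norm norm_minus_commute)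
    finally have "\<mu>' \<in> ball p (fst (r p))" by simp
    moreover have "\<mu> \<in> ball p (fst (r p))" using p F(1) r(1)[of p] by auto
    ultimately have "tangential_estimates M (snd (r p)) \<mu> \<mu>'" using r(3) \<mu> p F(1) by blast
    then show "tangential_estimates M K \<mu> \<mu>'" using tangential_estimates_mono K(2)[OF p(1)] by blast
  qed
qed

section \<open>Quadratic growth and the cut locus\<close>

text \<open>A relation rather than the function \<open>nearest\<close>: it also makes sense on the
  cut locus, where nearest points need not be unique and \<open>nearest\<close> takes the default
  value 0.\<close>

definition is_nearest :: "(real^'n) set \<Rightarrow> real^'n \<Rightarrow> real^'n \<Rightarrow> bool" where
  "is_nearest M y b \<longleftrightarrow> b \<in> M \<and> (\<forall>\<alpha>\<in>M. norm (b - y) \<le> norm (\<alpha> - y))"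

definition quadratic_growth :: "(real^'n) set \<Rightarrow> real^'n \<Rightarrow> real^'n \<Rightarrow> bool" where
  "quadratic_growth M y b \<longleftrightarrow> b \<in> M \<and> (\<exists>c>0. \<forall>\<alpha>\<in>M. (norm (b - y))^2 + c * (norm (\<alpha> - b))^2 \<le> (norm (\<alpha> - y))^2)"

lemma is_nearest_exists:
  assumes "compact M" "M \<noteq> {}"
  obtains b where "is_nearest M y b"
proof -
  have "continuous_on M (\<lambda>\<alpha>. norm (\<alpha> - y))" by (intro continuous_intros)
  from continuous_attains_inf[OF assms this] show thesis using that unfolding is_nearest_def by blast
qed

section \<open>First and second order conditions at a nearest point\<close>

lemma squared_distance_curve_derivative:
  fixes \<gamma> :: "real \<Rightarrow> real^'n"
  assumes \<gamma>: "(\<gamma> has_vector_derivative w) (at t)" "\<gamma> t = b"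
  shows "((\<lambda>t. (\<gamma> t - y) \<bullet> (\<gamma> t - y)) has_real_derivative (2 * ((b - y) \<bullet> w))) (at t)"
proof -
  have "((\<lambda>t. \<gamma> t - y) has_vector_derivative w) (at t)" using \<gamma>(1) by (auto intro!: derivative_eq_intros)
  from bounded_bilinear.has_vector_derivative[OF bounded_bilinear_inner this this]
  have "((\<lambda>t. (\<gamma> t - y) \<bullet> (\<gamma> t - y)) has_vector_derivative (2 * ((b - y) \<bullet> w))) (at t)"
    using \<gamma>(2) by (simp add: inner_commute)
  then show ?thesis by (simp add: has_real_derivative_iff_has_vector_derivative)
qed

lemma nearest_normal:
  assumes b: "is_nearest M y b"
  shows "y - b \<in> normal_space M b"
  unfolding normal_space_def
proof (intro CollectI ballI)
  fix w assume "w \<in> tangent_space M b"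
  then obtain \<gamma> e where g: "0 < e" "\<And>t. t\<in>{-e<..<e} \<Longrightarrow> \<gamma> t \<in> M" "\<gamma> 0 = b" "(\<gamma> has_vector_derivative w) (at 0)"
    unfolding tangent_space_def by blast
  note d = squared_distance_curve_derivative[OF g(4,3), of y]
  have "2 * ((b - y) \<bullet> w) = 0"
  proof (rule DERIV_local_min[OF d g(1)], intro allI impI)
    fix t assume "\<bar>0 - t\<bar> < e"
    then have "norm (b - y) \<le> norm (\<gamma> t - y)" using b g(2)[of t] unfolding is_nearest_def by (auto simp: abs_less_iff)
    then show "(\<gamma> 0 - y) \<bullet> (\<gamma> 0 - y) \<le> (\<gamma> t - y) \<bullet> (\<gamma> t - y)"
      using g(3) by (simp add: norm_le)
  qed
  then show "(y - b) \<bullet> w = 0" by (simp add: inner_diff_left)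
qed

lemma linear_coefficient_zero:
  fixes b q :: real
  assumes q: "q \<ge> 0" and nonneg: "\<And>s. 0 \<le> 2 * s * b + s^2 * q"
  shows "b = 0"
proof -
  \<comment> \<open>The polynomial is tested near its minimizer -b/q; the 1 covers q = 0.\<close>
  define t where "t = 1 / (q + 1)"
  have t: "t > 0" "t * q \<le> 1" unfolding t_def using q by (simp_all add: field_simps)
  have "0 \<le> 2 * (- b * t) * b + (- b * t)^2 * q" by (rule nonneg)
  also have "\<dots> = b^2 * (t * (t * q - 2))" by (simp add: algebra_simps power2_eq_square)
  finally have "0 \<le> b^2 * (t * (t * q - 2))" .
  moreover have "t * (t * q - 2) < 0" using t by (simp add: mult_pos_neg)
  ultimately have "b^2 \<le> 0" by (meson mult_pos_neg not_le)
  then show ?thesis by simp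
qed

text \<open>A null vector of a nonnegative form lies in its radical, by a first-order variation, so
  nondegeneracy excludes it. Compactness of the unit sphere of \<open>L\<close> then turns strict
  positivity into a constant.\<close>

lemma quadratic_form_positive_definite:
  fixes H :: "real^'n^'n"
  assumes L: "subspace L" and sym: "\<And>u w. u \<bullet> (H *v w) = w \<bullet> (H *v u)"
    and psd: "\<And>w. w \<in> L \<Longrightarrow> 0 \<le> w \<bullet> (H *v w)"
    and nondeg: "\<And>w. w \<in> L \<Longrightarrow> \<forall>u\<in>L. u \<bullet> (H *v w) = 0 \<Longrightarrow> w = 0"
  obtains c where "c > 0" "\<And>w. w \<in> L \<Longrightarrow> c * (norm w)^2 \<le> w \<bullet> (H *v w)"
proof -
  have pos: "0 < w \<bullet> (H *v w)" if w: "w \<in> L" "w \<noteq> 0" for w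
  proof (rule ccontr)
    assume "\<not> 0 < w \<bullet> (H *v w)"
    with psd[OF w(1)] have w0: "w \<bullet> (H *v w) = 0" by simp
    have "u \<bullet> (H *v w) = 0" if u: "u \<in> L" for u
    proof (rule linear_coefficient_zero[OF psd[OF u]])
      fix s :: real
      have "0 \<le> (w + s *\<^sub>R u) \<bullet> (H *v (w + s *\<^sub>R u))"
        using L w u by (intro psd) (simp add: subspace_add subspace_scale)
      also have "\<dots> = 2 * s * (u \<bullet> (H *v w)) + s^2 * (u \<bullet> (H *v u))"
        using w0 sym[of w u]
        by (simp add: matrix_vector_right_distrib matrix_vector_mult_scaleR inner_add_left inner_add_right
            power2_eq_square algebra_simps)
      finally show "0 \<le> 2 * s * (u \<bullet> (H *v w)) + s^2 * (u \<bullet> (H *v u))" .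
    qed
    then show False using nondeg[OF w(1)] w(2) by blast
  qed
  define S where "S = sphere 0 1 \<inter> L"
  have cS: "compact S" unfolding S_def using closed_subspace[OF L] by (simp add: compact_Int_closed)
  have scale: "(inverse (norm w)) *\<^sub>R w \<in> S" if "w \<in> L" "w \<noteq> 0" for w
    using that L unfolding S_def by (simp add: subspace_scale)
  show thesis
  \<comment> \<open>If the sphere is empty, then \<open>L\<close> contains only 0, as for a discrete
    \<open>M\<close>, and any constant works.\<close>
  proof (cases "S = {}")
    case True
    then have "w = 0" if "w \<in> L" for w using scale[OF that] by auto
    then show thesis by (intro that[of 1]) fastforce+
  next
    case False
    have "continuous_on S (\<lambda>w. w \<bullet> (H *v w))"
      by (intro continuous_intros linear_continuous_on matrix_vector_mul_bounded_linear)
    from continuous_attains_inf[OF cS False this] obtain w0 where w0: "w0 \<in> S"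
      "\<And>w. w \<in> S \<Longrightarrow> w0 \<bullet> (H *v w0) \<le> w \<bullet> (H *v w)" by blast
    have "w0 \<in> L" "w0 \<noteq> 0" using w0(1) unfolding S_def by auto
    show thesis
    proof (rule that[of "w0 \<bullet> (H *v w0)"])
      fix w assume w: "w \<in> L"
      show "w0 \<bullet> (H *v w0) * (norm w)^2 \<le> w \<bullet> (H *v w)"
      proof (cases "w = 0")
        case False
        have "w0 \<bullet> (H *v w0) \<le> (inverse (norm w) *\<^sub>R w) \<bullet> (H *v (inverse (norm w) *\<^sub>R w))"
          by (rule w0(2)[OF scale[OF w False]])
        also have "\<dots> = (w \<bullet> (H *v w)) / (norm w)^2"
          by (simp add: matrix_vector_mult_scaleR power2_eq_square field_simps)
        finally show ?thesis using False by (simp add: field_simps)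
      qed simp
    qed (use pos \<open>w0 \<in> L\<close> \<open>w0 \<noteq> 0\<close> in auto)
  qed
qed

lemma norm_quadratic_form_diff:
  fixes X Y :: "real^'n^'n"
  shows "\<bar>d \<bullet> (X *v d) - d \<bullet> (Y *v d)\<bar> \<le> norm (X - Y) * (norm d)^2"
proof -
  have "\<bar>d \<bullet> (X *v d) - d \<bullet> (Y *v d)\<bar> = \<bar>d \<bullet> ((X - Y) *v d)\<bar>"
    by (simp add: matrix_vector_mult_diff_rdistrib inner_diff_right)
  also have "\<dots> \<le> norm d * (norm (X - Y) * norm d)"
    by (intro order_trans[OF Cauchy_Schwarz_ineq2] mult_left_mono norm_matrix_vector_mult_le) auto
  finally show ?thesis by (simp add: power2_eq_square mult_ac)
qed

context straightening begin

lemma squared_distance_hessian: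
  obtains g H where
    "\<And>k. k \<in> V \<Longrightarrow> ((\<lambda>k. (norm (\<psi> k - x))\<^sup>2) has_derivative (\<lambda>h. g k \<bullet> h)) (at k)"
    "\<And>k. k \<in> V \<Longrightarrow> (g has_derivative ((*v) (H k))) (at k)"
    "smooth_mat V H" "\<And>k h. g k \<bullet> h = 2 * ((\<psi> k - x) \<bullet> (B k *v h))"
proof -
  define g where "g k = 2 *\<^sub>R (transpose (B k) *v (\<psi> k - x))" for k
  have gi: "g k \<bullet> h = 2 * ((\<psi> k - x) \<bullet> (B k *v h))" for k h unfolding g_def by (simp add: dot_lmul_matrix)
  have "smooth_on V g" unfolding smooth_on_def
  proof safe
    fix k j
    have "g y $ j = (\<Sum>i\<in>UNIV. 2 * (B y $ i $ j * (\<psi> y $ i + (- x $ i))))" for y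
      unfolding g_def by (simp add: matrix_vector_mult_def transpose_def sum_distrib_left mult_ac)
    moreover have "Ck k V (\<lambda>y. \<Sum>i\<in>UNIV. 2 * (B y $ i $ j * (\<psi> y $ i + (- x $ i))))"
      using smooth_B smooth_\<psi> unfolding smooth_mat_def smooth_on_def
      by (intro Ck_sum Ck_mult Ck_add Ck_const) auto
    ultimately show "Ck k V (\<lambda>x. g x $ j)" by presburger
  qed
  then obtain H where H: "\<And>k. k \<in> V \<Longrightarrow> (g has_derivative ((*v) (H k))) (at k)" "smooth_mat V H"
    using smooth_jacobian[OF open_V] by metis
  have "((\<lambda>k. (norm (\<psi> k - x))\<^sup>2) has_derivative (\<lambda>h. g k \<bullet> h)) (at k)" if "k \<in> V" for k
  proof -
    have "((\<lambda>k. \<psi> k - x) has_derivative ((*v) (B k))) (at k)"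
      using d\<psi>[OF that] by (auto intro!: derivative_eq_intros)
    from has_derivative_inner[OF this this] show ?thesis
      unfolding power2_norm_eq_inner gi by (rule has_derivative_eq_rhs) (simp add: fun_eq_iff inner_commute)
  qed
  then show thesis using that H gi by blast
qed

lemma gradient_zero_at_nearest:
  assumes "is_nearest M y b" "b \<in> U" "l \<in> L"
  shows "(y - b) \<bullet> (B (\<phi> b) *v l) = 0"
  using nearest_normal[OF assms(1)] assms unfolding is_nearest_def by (auto simp: normal_space_iff)

text \<open>\<open>nondeg_hess\<close> excludes degeneracy on \<open>L\<close> but leaves the sign
  open. Minimality supplies the sign: a direction with negative second derivative would keep it on a
  whole ball, and since the gradient vanishes along \<open>L\<close>, moving in that direction
  inside \<open>M\<close> would decrease the squared distance.\<close>

lemma hessian_positive_definite: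
  assumes p: "is_nearest M x p" and nd: "nondeg_hess M x p"
    and F: "\<And>k. k \<in> V \<Longrightarrow> ((\<lambda>k. (norm (\<psi> k - x))\<^sup>2) has_derivative (\<lambda>h. g k \<bullet> h)) (at k)"
    and g: "\<And>k. k \<in> V \<Longrightarrow> (g has_derivative ((*v) (H k))) (at k)"
    and H: "smooth_mat V H" and gi: "\<And>k h. g k \<bullet> h = 2 * ((\<psi> k - x) \<bullet> (B k *v h))"
  obtains c where "c > 0" "\<And>w. w \<in> L \<Longrightarrow> c * (norm w)^2 \<le> w \<bullet> (H (\<phi> p) *v w)"
proof -
  have pM: "p \<in> M" using p unfolding is_nearest_def by simp
  define k0 where "k0 = \<phi> p"
  have k0: "k0 \<in> V" "k0 \<in> L" "\<psi> k0 = p" unfolding k0_def using \<phi>_V \<phi>_L \<psi>\<phi> p_U pM by auto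
  have sym: "u \<bullet> (H k0 *v w) = w \<bullet> (H k0 *v u)" for u w
    by (rule hessian_symmetric[OF open_V k0(1) F g[OF k0(1)]])
  have hess: "hess_at (\<lambda>k. (norm (\<psi> k - x))\<^sup>2) k0 (H k0)"
    unfolding hess_at_def
  proof (intro exI[of _ g] conjI)
    show "\<forall>\<^sub>F z in nhds k0. ((\<lambda>k. (norm (\<psi> k - x))\<^sup>2) has_derivative (\<lambda>u. g z \<bullet> u)) (at z)"
      unfolding eventually_nhds using open_V k0(1) F by blast
  qed (use g k0 in simp)
  have nondeg: "w = 0" if "w \<in> L" "\<forall>u\<in>L. u \<bullet> (H k0 *v w) = 0" for w
    using nd chart hess that unfolding nondeg_hess_def k0_def by blast
  obtain \<rho> K where \<rho>: "\<rho> > 0" "K \<ge> 0" "ball k0 \<rho> \<subseteq> V"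
    "\<And>x y. x \<in> ball k0 \<rho> \<Longrightarrow> y \<in> ball k0 \<rho> \<Longrightarrow> norm (H x - H y) \<le> K * norm (x - y)"
    using smooth_mat_lipschitz[OF open_V k0(1) H] by metis
  have psd: "0 \<le> w \<bullet> (H k0 *v w)" if w: "w \<in> L" for w
  proof (rule ccontr)
    assume neg: "\<not> 0 \<le> w \<bullet> (H k0 *v w)"
    define c where "c = - (w \<bullet> (H k0 *v w)) / 2"
    have c: "c > 0" using neg unfolding c_def by simp
    have w0: "w \<noteq> 0" using neg by auto
    define r where "r = min \<rho> (c / (K * (norm w)^2 + 1))"
    have Kw: "K * (norm w)^2 + 1 > 0" using \<rho>(2) by (simp add: add_nonneg_pos)
    have r: "r > 0" "r \<le> \<rho>" "r \<le> c / (K * (norm w)^2 + 1)" unfolding r_def using \<rho> c Kw by auto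
    define s where "s = r / (2 * norm w)"
    have s: "s > 0" "s * norm w < r" unfolding s_def using r w0 by auto
    have nearH: "w \<bullet> (H z *v w) \<le> - c" if z: "z \<in> ball k0 r" for z
    proof -
      have "\<bar>w \<bullet> (H z *v w) - w \<bullet> (H k0 *v w)\<bar> \<le> norm (H z - H k0) * (norm w)^2" by (rule norm_quadratic_form_diff)
      also have "\<dots> \<le> (K * norm (z - k0)) * (norm w)^2"
        using \<rho>(1) \<rho>(4)[of z k0] z r by (intro mult_right_mono) auto
      also have "\<dots> \<le> (K * (norm w)^2 + 1) * norm (z - k0)" by (simp add: algebra_simps)
      also have "\<dots> \<le> (K * (norm w)^2 + 1) * r" using z Kw by (intro mult_left_mono) (auto simp: dist_norm norm_minus_commute)
      also have "\<dots> \<le> c" using r(3) Kw by (simp add: field_simps)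
      finally show ?thesis unfolding c_def by linarith
    qed
    define d where "d = s *\<^sub>R w"
    have dist: "dist k0 (k0 + d) < r" unfolding d_def dist_norm using s by simp
    \<comment> \<open>The lower bound is applied to the negated function, and so bounds the squared
      distance from above.\<close>
    have "- ((norm (\<psi> (k0 + d) - x))\<^sup>2) \<ge> - ((norm (\<psi> k0 - x))\<^sup>2) + (- g k0) \<bullet> d + (s^2 * c) / 2"
    proof (rule second_order_lower_bound[where S="ball k0 r" and H="\<lambda>k. - H k" and F="\<lambda>k. - ((norm (\<psi> k - x))\<^sup>2)" and g="\<lambda>k. - g k"])
      fix z assume z: "z \<in> ball k0 r"
      then have zV: "z \<in> V" using r \<rho> by auto
      show "((\<lambda>k. - ((norm (\<psi> k - x))\<^sup>2)) has_derivative (\<lambda>h. (- g z) \<bullet> h)) (at z)"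
        using has_derivative_minus[OF F[OF zV]] by simp
      show "((\<lambda>k. - g k) has_derivative ((*v) (- H z))) (at z)"
        using has_derivative_minus[OF g[OF zV]] by (simp add: matrix_vector_mult_uminus[abs_def])
      have "s^2 * (w \<bullet> (H z *v w)) \<le> s^2 * (- c)" using nearH[OF z] by (intro mult_left_mono) auto
      then show "s^2 * c \<le> d \<bullet> (- H z *v d)" unfolding d_def
        by (simp add: matrix_vector_mult_uminus matrix_vector_mult_scaleR power2_eq_square mult_ac)
    qed (use r dist in auto)
    moreover have "g k0 \<bullet> d = 0"
    proof -
      have "(x - p) \<bullet> (B k0 *v d) = 0" unfolding k0_def
        by (rule gradient_zero_at_nearest[OF p p_U]) (use L w in \<open>auto simp: d_def subspace_scale\<close>)
      then show ?thesis unfolding gi k0(3) by (simp add: inner_diff_left)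
    qed
    moreover have "s^2 * c > 0" using s c by simp
    ultimately have "(norm (\<psi> (k0 + d) - x))\<^sup>2 < (norm (p - x))\<^sup>2" using k0(3) by simp
    then have "norm (\<psi> (k0 + d) - x) < norm (p - x)" by (rule power2_less_imp_less) simp
    moreover have "\<psi> (k0 + d) \<in> M"
    proof (rule \<psi>_M)
      show "k0 + d \<in> V" using dist r \<rho>(3) by auto
      show "k0 + d \<in> L" using k0 L w unfolding d_def by (simp add: subspace_add subspace_scale)
    qed
    ultimately show False using p unfolding is_nearest_def by force
  qed
  show thesis
    by (rule quadratic_form_positive_definite[OF L sym psd nondeg]) (use that k0_def in auto)
qed

text \<open>The positive Hessian belongs to \<open>x\<close>; a nearby \<open>y\<close> changes the
  squared distance only by a linear term in \<open>y - x\<close>, and stationarity of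
  \<open>b\<close> for \<open>y\<close> removes its first-order effect. Thus one constant serves all
  nearby \<open>y\<close> and their nearest points.\<close>

lemma local_uniform_growth:
  assumes p: "is_nearest M x p" and nd: "nondeg_hess M x p"
  obtains \<rho> c where "\<rho> > 0" "c > 0"
    "\<And>y b \<alpha>. y \<in> ball x \<rho> \<Longrightarrow> is_nearest M y b \<Longrightarrow> b \<in> ball p \<rho> \<Longrightarrow> \<alpha> \<in> M \<Longrightarrow> \<alpha> \<in> ball p \<rho> \<Longrightarrow>
       (norm (b - y))^2 + c * (norm (\<alpha> - b))^2 \<le> (norm (\<alpha> - y))^2"
proof -
  obtain g H where F: "\<And>k. k \<in> V \<Longrightarrow> ((\<lambda>k. (norm (\<psi> k - x))\<^sup>2) has_derivative (\<lambda>h. g k \<bullet> h)) (at k)"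
    and g: "\<And>k. k \<in> V \<Longrightarrow> (g has_derivative ((*v) (H k))) (at k)"
    and H: "smooth_mat V H" and gi: "\<And>k h. g k \<bullet> h = 2 * ((\<psi> k - x) \<bullet> (B k *v h))"
    by (rule squared_distance_hessian[of x]) blast
  define k0 where "k0 = \<phi> p"
  have pM: "p \<in> M" using p unfolding is_nearest_def by simp
  have k0: "k0 \<in> V" unfolding k0_def using \<phi>_V p_U by auto
  obtain c where c: "c > 0" "\<And>w. w \<in> L \<Longrightarrow> c * (norm w)^2 \<le> w \<bullet> (H k0 *v w)"
    using hessian_positive_definite[OF p nd F g H gi] unfolding k0_def by blast
  obtain r K0 where r: "r > 0" "K0 \<ge> 0" "ball k0 r \<subseteq> V"
    "\<And>x y. x \<in> ball k0 r \<Longrightarrow> y \<in> ball k0 r \<Longrightarrow> norm (H x - H y) \<le> K0 * norm (x - y)"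
    using smooth_mat_lipschitz[OF open_V k0 H] by metis
  obtain \<rho>0 K where \<rho>0: "\<rho>0 > 0" "K \<ge> 0" "ball p \<rho>0 \<subseteq> U"
    and bB: "\<And>\<alpha>. \<alpha> \<in> ball p \<rho>0 \<Longrightarrow> norm (B (\<phi> \<alpha>)) \<le> K"
    and l\<phi>: "\<And>\<alpha> \<beta>. \<alpha> \<in> ball p \<rho>0 \<Longrightarrow> \<beta> \<in> ball p \<rho>0 \<Longrightarrow> norm (\<phi> \<alpha> - \<phi> \<beta>) \<le> K * norm (\<alpha> - \<beta>)"
    and r\<psi>: "\<And>\<alpha> \<beta>. \<alpha> \<in> ball p \<rho>0 \<Longrightarrow> \<beta> \<in> ball p \<rho>0 \<Longrightarrow>
       norm (\<alpha> - \<beta> - B (\<phi> \<beta>) *v (\<phi> \<alpha> - \<phi> \<beta>)) \<le> K * norm (\<phi> \<alpha> - \<phi> \<beta>)^2"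
    by (rule local_bounds) metis
  \<comment> \<open>On this ball the Hessian varies by at most c/2, so half of its lower bound
    survives.\<close>
  define r1 where "r1 = min r (c / (2 * (K0 + 1)))"
  have r1: "r1 > 0" "r1 \<le> r" "K0 * r1 \<le> c / 2"
  proof -
    show "r1 > 0" "r1 \<le> r" unfolding r1_def using r c by auto
    have "r1 \<le> c / (2 * (K0 + 1))" unfolding r1_def by simp
    then have "(K0 + 1) * r1 \<le> c / 2" using r(2) by (simp add: field_simps)
    then show "K0 * r1 \<le> c / 2" using \<open>r1 > 0\<close> by (simp add: algebra_simps)
  qed
  have pd: "c / 2 * (norm d)^2 \<le> d \<bullet> (H z *v d)" if "z \<in> ball k0 r1" "d \<in> L" for z d
  proof -
    have "\<bar>d \<bullet> (H z *v d) - d \<bullet> (H k0 *v d)\<bar> \<le> norm (H z - H k0) * (norm d)^2" by (rule norm_quadratic_form_diff)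
    also have "\<dots> \<le> (c / 2) * (norm d)^2"
    proof (rule mult_right_mono)
      have "norm (H z - H k0) \<le> K0 * norm (z - k0)" using r(4)[of z k0] that r1 r(1) by auto
      also have "\<dots> \<le> K0 * r1" using that r(2) by (intro mult_left_mono) (auto simp: dist_norm norm_minus_commute)
      finally show "norm (H z - H k0) \<le> c / 2" using r1(3) by linarith
    qed simp
    finally show ?thesis using c(2)[OF that(2)] by linarith
  qed
  \<comment> \<open>The entry with 16 keeps the cross term with \<open>y - x\<close> below c/16;
    doubled, it takes c/8 from the c/4 of the second-order bound and leaves c/8. The other entries
    keep the chart bounds valid and send the ball into that of radius \<open>r1\<close>.\<close>
  define \<rho>1 where "\<rho>1 = min 1 (min \<rho>0 (min (r1 / (K + 1)) (c / (16 * (K + 1)))))"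
  have \<rho>1: "\<rho>1 > 0" "\<rho>1 \<le> 1" "\<rho>1 \<le> \<rho>0" "(K + 1) * \<rho>1 \<le> r1" "16 * ((K + 1) * \<rho>1) \<le> c"
  proof -
    show "\<rho>1 > 0" "\<rho>1 \<le> 1" "\<rho>1 \<le> \<rho>0" unfolding \<rho>1_def using \<rho>0 r1 c by auto
    have "\<rho>1 \<le> r1 / (K + 1)" "\<rho>1 \<le> c / (16 * (K + 1))" unfolding \<rho>1_def by auto
    then show "(K + 1) * \<rho>1 \<le> r1" "16 * ((K + 1) * \<rho>1) \<le> c" using \<rho>0(2) by (simp_all add: field_simps)
  qed
  \<comment> \<open>Since |d| \<le> 2 K, the chart gives |\<alpha> - b| \<le> (K + 2 K^2) |d|; this
    converts growth in the chart displacement \<open>d\<close> into growth in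
    \<open>\<alpha> - b\<close>.\<close>
  define K1 where "K1 = K + K * (2 * K) + 1"
  have K1: "K1 > 0" unfolding K1_def using \<rho>0(2) by (simp add: add_nonneg_pos)
  have \<phi>ball: "\<phi> \<alpha> \<in> ball k0 r1" if "\<alpha> \<in> ball p \<rho>1" for \<alpha>
  proof -
    have "norm (\<phi> \<alpha> - \<phi> p) \<le> K * norm (\<alpha> - p)" using that \<rho>1 \<rho>0 by (intro l\<phi>) auto
    also have "\<dots> \<le> (K + 1) * norm (\<alpha> - p)" by (intro mult_right_mono) auto
    also have "\<dots> < (K + 1) * \<rho>1" using that \<rho>0(2) by (intro mult_strict_left_mono) (auto simp: dist_norm norm_minus_commute)
    finally show ?thesis using \<rho>1(4) unfolding k0_def by (simp add: dist_norm norm_minus_commute)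
  qed
  show thesis
  proof (rule that[of \<rho>1 "c / 8 / K1^2"])
    show "\<rho>1 > 0" "c / 8 / K1^2 > 0" using \<rho>1 c K1 by auto
  next
    fix y b \<alpha> assume y: "y \<in> ball x \<rho>1" and b: "is_nearest M y b" "b \<in> ball p \<rho>1" and \<alpha>: "\<alpha> \<in> M" "\<alpha> \<in> ball p \<rho>1"
    have bM: "b \<in> M" using b unfolding is_nearest_def by simp
    have U: "b \<in> U" "\<alpha> \<in> U" using b \<alpha> \<rho>1(3) \<rho>0(3) by auto
    have b0: "b \<in> ball p \<rho>0" "\<alpha> \<in> ball p \<rho>0" using b \<alpha> \<rho>1(3) by auto
    define k d where "k = \<phi> b" and "d = \<phi> \<alpha> - \<phi> b"
    have dL: "d \<in> L" unfolding d_def by (intro subspace_diff L \<phi>_L \<alpha> U bM)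
    have kd: "k + d = \<phi> \<alpha>" unfolding k_def d_def by simp
    have \<psi>k: "\<psi> k = b" "\<psi> (k + d) = \<alpha>" unfolding kd unfolding k_def using \<psi>\<phi> U by auto
    have "(norm (\<psi> (k + d) - x))^2 \<ge> (norm (\<psi> k - x))^2 + g k \<bullet> d + (c / 2 * (norm d)^2) / 2"
    proof (rule second_order_lower_bound[where S="ball k0 r1" and H=H])
      show "k \<in> ball k0 r1" "k + d \<in> ball k0 r1" unfolding kd unfolding k_def using \<phi>ball b \<alpha> by auto
    next
      fix z assume z: "z \<in> ball k0 r1"
      then have "z \<in> V" using r1(2) r(3) by auto
      then show "((\<lambda>k. (norm (\<psi> k - x))\<^sup>2) has_derivative (\<lambda>h. g z \<bullet> h)) (at z)" "(g has_derivative ((*v) (H z))) (at z)"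
        using F g by auto
      show "c / 2 * (norm d)^2 \<le> d \<bullet> (H z *v d)" by (rule pd[OF z dL])
    qed simp
    then have main: "(norm (\<alpha> - x))^2 \<ge> (norm (b - x))^2 + 2 * ((b - x) \<bullet> (B k *v d)) + c / 4 * (norm d)^2"
      unfolding \<psi>k gi by simp
    \<comment> \<open>\<open>b\<close> is critical for \<open>y\<close>, not for \<open>x\<close>.
      This trades the linear term of the bound at \<open>x\<close> for one in \<open>y - x\<close>,
      which combines with the chord into a remainder quadratic in \<open>d\<close>.\<close>
    have crit: "(y - b) \<bullet> (B k *v d) = 0" unfolding k_def by (rule gradient_zero_at_nearest[OF b(1) U(1) dL])
    have R: "norm (\<alpha> - b - B k *v d) \<le> K * norm d^2" unfolding k_def d_def by (rule r\<psi>[OF b0(2,1)])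
    have cs: "\<bar>(y - x) \<bullet> (\<alpha> - b - B k *v d)\<bar> \<le> c / 16 * (norm d)^2"
    proof -
      have "\<bar>(y - x) \<bullet> (\<alpha> - b - B k *v d)\<bar> \<le> norm (y - x) * norm (\<alpha> - b - B k *v d)" by (rule Cauchy_Schwarz_ineq2)
      also have "\<dots> \<le> \<rho>1 * (K * norm d^2)"
        using y R \<rho>1(1) by (intro mult_mono) (auto simp: dist_norm norm_minus_commute)
      also have "\<dots> \<le> c / 16 * (norm d)^2"
      proof -
        have "\<rho>1 * K \<le> c / 16" using \<rho>1(1,5) by (simp add: algebra_simps)
        from mult_right_mono[OF this, of "norm d^2"] show ?thesis by (simp add: mult_ac)
      qed
      finally show ?thesis .
    qed
    have e1: "(norm (\<alpha> - y))^2 = (norm (\<alpha> - x))^2 - 2 * ((y - x) \<bullet> (\<alpha> - x)) + (norm (y - x))^2"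
      "(norm (b - y))^2 = (norm (b - x))^2 - 2 * ((y - x) \<bullet> (b - x)) + (norm (y - x))^2"
      by (simp_all add: power2_norm_eq_inner inner_diff_left inner_diff_right inner_commute algebra_simps)
    have e2: "(y - x) \<bullet> (\<alpha> - b - B k *v d) = (y - x) \<bullet> (\<alpha> - x) - (y - x) \<bullet> (b - x) - (b - x) \<bullet> (B k *v d)"
      using crit by (simp add: inner_diff_left inner_diff_right algebra_simps)
    have "(norm (b - y))^2 + c / 8 * (norm d)^2 \<le> (norm (\<alpha> - y))^2"
      using main cs e1 e2 by linarith
    moreover have "norm (\<alpha> - b) \<le> K1 * norm d"
    proof -
      have "norm d \<le> K * norm (\<alpha> - b)" unfolding d_def by (rule l\<phi>[OF b0(2,1)])
      also have "\<dots> \<le> K * 2"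
      proof (intro mult_left_mono \<rho>0(2))
        show "norm (\<alpha> - b) \<le> 2" using b(2) \<alpha>(2) \<rho>1(2) dist_triangle3[of \<alpha> b p] by (simp add: dist_norm)
      qed
      finally have d2: "norm d \<le> 2 * K" by simp
      have "norm (\<alpha> - b) \<le> norm (\<alpha> - b - B k *v d) + norm (B k *v d)"
        using norm_triangle_ineq[of "\<alpha> - b - B k *v d" "B k *v d"] by simp
      also have "\<dots> \<le> K * norm d^2 + K * norm d"
      proof (intro add_mono R)
        show "norm (B k *v d) \<le> K * norm d" unfolding k_def
          by (intro order_trans[OF norm_matrix_vector_mult_le] mult_right_mono bB b0) auto
      qed
      also have "K * norm d^2 \<le> K * (2 * K * norm d)"
        unfolding power2_eq_square using d2 \<rho>0(2) by (intro mult_left_mono mult_right_mono) auto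
      finally have "norm (\<alpha> - b) \<le> (K1 - 1) * norm d" unfolding K1_def by (simp add: algebra_simps)
      also have "\<dots> \<le> K1 * norm d" by (intro mult_right_mono) auto
      finally show ?thesis .
    qed
    then have "(norm (\<alpha> - b))^2 \<le> K1^2 * (norm d)^2" unfolding power_mult_distrib[symmetric] by (intro power_mono) auto
    then have "c / 8 / K1^2 * (norm (\<alpha> - b))^2 \<le> c / 8 / K1^2 * (K1^2 * (norm d)^2)" using c by (intro mult_left_mono) auto
    then have "c / 8 / K1^2 * (norm (\<alpha> - b))^2 \<le> c / 8 * (norm d)^2" using K1 by simp
    ultimately show "(norm (b - y))^2 + c / 8 / K1^2 * (norm (\<alpha> - b))^2 \<le> (norm (\<alpha> - y))^2" by linarith
  qed
qed

text \<open>Along a degenerate direction the squared distance would increase by o(s^2) only, against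
  quadratic growth. \<open>hess_at\<close> offers some gradient near the point whose derivative is
  known at that point, so a single mean value step is combined with the expansion of the gradient
  there.\<close>

lemma growth_nondegenerate:
  assumes gr: "quadratic_growth M y p" and H: "hess_at (\<lambda>k. (norm (\<psi> k - y))\<^sup>2) (\<phi> p) H"
    and w: "w \<in> L" and deg: "\<forall>u\<in>L. u \<bullet> (H *v w) = 0"
  shows "w = 0"
proof (rule ccontr)
  assume w0: "w \<noteq> 0"
  obtain c where pM: "p \<in> M" and c: "c > 0" "\<And>\<alpha>. \<alpha> \<in> M \<Longrightarrow> (norm (p - y))^2 + c * (norm (\<alpha> - p))^2 \<le> (norm (\<alpha> - y))^2"
    using gr unfolding quadratic_growth_def by blast
  define F where "F k = (norm (\<psi> k - y))\<^sup>2" for k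
  define k0 where "k0 = \<phi> p"
  have k0: "k0 \<in> V" "k0 \<in> L" "\<psi> k0 = p" unfolding k0_def using \<phi>_V \<phi>_L \<psi>\<phi> p_U pM by auto
  have near: "is_nearest M y p" unfolding is_nearest_def
  proof (intro conjI ballI pM)
    fix \<alpha> assume "\<alpha> \<in> M"
    have "(norm (p - y))^2 \<le> (norm (p - y))^2 + c * (norm (\<alpha> - p))^2" using c(1) by simp
    also have "\<dots> \<le> (norm (\<alpha> - y))^2" by (rule c(2)[OF \<open>\<alpha> \<in> M\<close>])
    finally show "norm (p - y) \<le> norm (\<alpha> - y)" by (rule power2_le_imp_le) simp
  qed
  obtain g where ev: "\<forall>\<^sub>F z in nhds k0. (F has_derivative (\<lambda>u. g z \<bullet> u)) (at z)"
    and g: "(g has_derivative ((*v) H)) (at k0)"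
    using H unfolding hess_at_def F_def k0_def by blast
  obtain S where S: "open S" "k0 \<in> S" "\<And>z. z \<in> S \<Longrightarrow> (F has_derivative (\<lambda>u. g z \<bullet> u)) (at z)"
    using ev unfolding eventually_nhds by blast
  obtain r0 where r0: "r0 > 0" "ball k0 r0 \<subseteq> S \<inter> V" using S open_V k0 by (meson IntI open_Int openE)
  obtain g1 where g1: "(F has_derivative (\<lambda>h. g1 \<bullet> h)) (at k0)" "\<And>h. g1 \<bullet> h = 2 * ((p - y) \<bullet> (B k0 *v h))"
    using squared_distance_hessian[of y] k0 unfolding F_def by metis
  \<comment> \<open>The gradient from \<open>hess_at\<close> is arbitrary; at \<open>k0\<close> it
    must agree with the explicit one, which vanishes along \<open>L\<close>.\<close>
  have "(\<lambda>h. g k0 \<bullet> h) = (\<lambda>h. g1 \<bullet> h)" using has_derivative_unique[OF S(3)[OF S(2)] g1(1)] .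
  then have "g k0 \<bullet> w = 2 * ((p - y) \<bullet> (B k0 *v w))" using g1(2) by metis
  also have "\<dots> = 0" using gradient_zero_at_nearest[OF near p_U w] unfolding k0_def by (simp add: inner_diff_left)
  finally have gw: "g k0 \<bullet> w = 0" .
  obtain \<rho> K where \<rho>: "\<rho> > 0" "K \<ge> 0" "ball p \<rho> \<subseteq> U"
    and l\<phi>: "\<And>\<alpha> \<beta>. \<alpha> \<in> ball p \<rho> \<Longrightarrow> \<beta> \<in> ball p \<rho> \<Longrightarrow> norm (\<phi> \<alpha> - \<phi> \<beta>) \<le> K * norm (\<alpha> - \<beta>)"
    by (rule local_bounds) metis
  have "isCont \<psi> k0" using has_derivative_continuous[OF d\<psi>[OF k0(1)]] .
  then obtain r1 where r1: "r1 > 0" "\<And>z. dist z k0 < r1 \<Longrightarrow> dist (\<psi> z) p < \<rho>"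
    using \<rho>(1) k0(3) unfolding continuous_at_eps_delta by metis
  \<comment> \<open>The comparison at the end yields c \<le> e K^2, which fails for this
    \<open>e\<close>; the 1 covers K = 0.\<close>
  define e where "e = c / (2 * K^2 + 1)"
  have K2: "2 * K^2 + 1 > 0" by (simp add: add_nonneg_pos)
  have e: "e > 0" unfolding e_def using c K2 by simp
  obtain r2 where r2: "r2 > 0" "\<And>z. norm (z - k0) < r2 \<Longrightarrow> norm (g z - g k0 - H *v (z - k0)) \<le> e * norm (z - k0)"
    using g e unfolding has_derivative_at_alt by blast
  define r where "r = min r0 (min r1 r2)"
  have r: "r > 0" "r \<le> r0" "r \<le> r1" "r \<le> r2" unfolding r_def using r0 r1 r2 by auto
  define s where "s = r / (2 * norm w)"
  have s: "s > 0" "s * norm w < r" unfolding s_def using r w0 by auto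
  have sw: "norm (t *\<^sub>R w) < r" if "0 \<le> t" "t \<le> s" for t
  proof -
    have "norm (t *\<^sub>R w) \<le> s * norm w" using that by (simp add: mult_right_mono)
    then show ?thesis using s by simp
  qed
  have dF: "((\<lambda>t. F (k0 + t *\<^sub>R w)) has_real_derivative (g (k0 + t *\<^sub>R w) \<bullet> w)) (at t)" if "0 \<le> t" "t \<le> s" for t
  proof -
    have "k0 + t *\<^sub>R w \<in> S" using sw[OF that] r0 r by (auto simp: subset_iff dist_norm)
    moreover have "((\<lambda>s. k0 + s *\<^sub>R w) has_derivative (\<lambda>s. s *\<^sub>R w)) (at t)"
      by (auto intro!: derivative_eq_intros)
    ultimately have "((\<lambda>s. F (k0 + s *\<^sub>R w)) has_derivative (\<lambda>x. g (k0 + t *\<^sub>R w) \<bullet> (x *\<^sub>R w))) (at t)"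
      using has_derivative_compose S(3) by blast
    then show ?thesis unfolding has_field_derivative_def by (rule has_derivative_eq_rhs) (simp add: fun_eq_iff)
  qed
  obtain \<xi> where \<xi>: "0 < \<xi>" "\<xi> < s" and mvt: "F (k0 + s *\<^sub>R w) - F (k0 + 0 *\<^sub>R w) = (s - 0) * (g (k0 + \<xi> *\<^sub>R w) \<bullet> w)"
    using MVT2[OF s(1), of "\<lambda>t. F (k0 + t *\<^sub>R w)" "\<lambda>t. g (k0 + t *\<^sub>R w) \<bullet> w", OF dF] by auto
  have "g (k0 + \<xi> *\<^sub>R w) \<bullet> w \<le> e * s * (norm w)^2"
  proof -
    have "g (k0 + \<xi> *\<^sub>R w) \<bullet> w = (g (k0 + \<xi> *\<^sub>R w) - g k0 - H *v (\<xi> *\<^sub>R w)) \<bullet> w"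
      using gw bspec[OF deg w] by (simp add: inner_diff_left matrix_vector_mult_scaleR inner_commute[of "H *v w"])
    also have "\<dots> \<le> norm (g (k0 + \<xi> *\<^sub>R w) - g k0 - H *v (\<xi> *\<^sub>R w)) * norm w" by (rule norm_cauchy_schwarz)
    also have "\<dots> \<le> (e * norm (\<xi> *\<^sub>R w)) * norm w"
      using r2(2)[of "k0 + \<xi> *\<^sub>R w"] sw[of \<xi>] \<xi> r by (intro mult_right_mono) auto
    also have "\<dots> \<le> (e * (s * norm w)) * norm w" using \<xi> e by (intro mult_right_mono mult_left_mono) (auto intro: mult_right_mono)
    finally show ?thesis by (simp add: power2_eq_square mult_ac)
  qed
  then have up: "F (k0 + s *\<^sub>R w) - F k0 \<le> e * (s * norm w)^2"
    using mvt mult_left_mono[of "g (k0 + \<xi> *\<^sub>R w) \<bullet> w" "e * s * (norm w)^2" s] s(1)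
    by (simp add: power2_eq_square mult_ac)
  define \<alpha> where "\<alpha> = \<psi> (k0 + s *\<^sub>R w)"
  have "k0 + s *\<^sub>R w \<in> V" using sw[of s] s r0 r by (auto simp: subset_iff dist_norm)
  moreover have "k0 + s *\<^sub>R w \<in> L" using k0 L w by (simp add: subspace_add subspace_scale)
  ultimately have \<alpha>: "\<alpha> \<in> M" "\<phi> \<alpha> = k0 + s *\<^sub>R w" unfolding \<alpha>_def using \<psi>_M \<phi>\<psi> by auto
  have "dist \<alpha> p < \<rho>" unfolding \<alpha>_def by (rule r1(2)) (use sw[of s] s r in \<open>simp add: dist_norm\<close>)
  then have "norm (\<phi> \<alpha> - \<phi> p) \<le> K * norm (\<alpha> - p)" using \<rho>(1) by (intro l\<phi>) (auto simp: dist_commute)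
  then have "s * norm w \<le> K * norm (\<alpha> - p)" using \<alpha>(2) s(1) unfolding k0_def by simp
  then have "(s * norm w)^2 \<le> K^2 * (norm (\<alpha> - p))^2"
    unfolding power_mult_distrib[symmetric] using s(1) by (intro power_mono) auto
  then have "e * (s * norm w)^2 \<le> e * (K^2 * (norm (\<alpha> - p))^2)" using e by (intro mult_left_mono) auto
  moreover have "c * (norm (\<alpha> - p))^2 \<le> e * (s * norm w)^2"
    using up c(2)[OF \<alpha>(1)] unfolding F_def \<alpha>_def[symmetric] k0(3) by simp
  ultimately have "c * (norm (\<alpha> - p))^2 \<le> e * K^2 * (norm (\<alpha> - p))^2" by simp
  moreover have "norm (\<alpha> - p) \<noteq> 0" using \<open>s * norm w \<le> K * norm (\<alpha> - p)\<close> s(1) w0 by (auto simp: mult_le_0_iff)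
  ultimately have "c \<le> e * K^2" by simp
  then have "c * (2 * K^2 + 1) \<le> c * K^2" unfolding e_def using K2 by (simp add: field_simps)
  then have "2 * K^2 + 1 \<le> K^2" using c(1) by simp
  then show False using zero_le_power2[of K] by linarith
qed

end

section \<open>Quadratic growth around points off the cut locus\<close>

lemma growth_unique_nondeg_min:
  assumes gr: "quadratic_growth M y b"
  shows "unique_nondeg_min M y b"
proof -
  obtain c where b: "b \<in> M" and c: "c > 0" "\<And>\<alpha>. \<alpha> \<in> M \<Longrightarrow> (norm (b - y))^2 + c * (norm (\<alpha> - b))^2 \<le> (norm (\<alpha> - y))^2"
    using gr unfolding quadratic_growth_def by blast
  have "(norm (b - y))^2 < (norm (\<alpha> - y))^2" if "\<alpha> \<in> M" "\<alpha> \<noteq> b" for \<alpha>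
  proof -
    have "0 < c * (norm (\<alpha> - b))^2" using c(1) that by simp
    then show ?thesis using c(2)[OF that(1)] by linarith
  qed
  moreover have "nondeg_hess M y b" unfolding nondeg_hess_def
  proof (intro allI impI ballI, elim conjE)
    fix U V \<phi> \<psi> L H w
    assume ch: "chart M b U V \<phi> \<psi> L" and H: "hess_at (\<lambda>k. (norm (\<psi> k - y))\<^sup>2) (\<phi> b) H"
      and w: "w \<in> L" "\<forall>u\<in>L. u \<bullet> (H *v w) = 0"
    obtain A B C where "straightening M b U V \<phi> \<psi> L A B C" using straightening_exists[OF ch] .
    from straightening.growth_nondegenerate[OF this gr H w] show "w = 0" .
  qed
  ultimately show ?thesis unfolding unique_nondeg_min_def using b by blast
qed

lemma unique_nondeg_min_is_nearest: "unique_nondeg_min M x a \<Longrightarrow> is_nearest M x a"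
  unfolding unique_nondeg_min_def is_nearest_def
  by (metis less_imp_le norm_ge_zero order_refl power2_le_imp_le)

lemma is_nearest_unique: "unique_nondeg_min M x a \<Longrightarrow> is_nearest M x b \<Longrightarrow> b = a"
  unfolding unique_nondeg_min_def is_nearest_def
  by (metis linorder_not_less norm_ge_zero power_mono)

text \<open>Outside a ball around \<open>a\<close> the distance to \<open>x\<close> exceeds its
  minimum by a gap. For \<open>y\<close> near \<open>x\<close> this forces the nearest points into
  the ball, where the local bound applies; outside, the gap itself beats a multiple of the squared
  distance because \<open>M\<close> is bounded. Having growth near \<open>x\<close>, and not only at
  \<open>x\<close>, also shows that the complement of the cut locus is open.\<close>

lemma growth_near_unique_nondeg_min:
  assumes M: "compact M" "submanifold m M" and x: "unique_nondeg_min M x a"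
  obtains \<rho> where "\<rho> > 0" "\<And>y b. y \<in> ball x \<rho> \<Longrightarrow> is_nearest M y b \<Longrightarrow> quadratic_growth M y b"
proof -
  have a: "a \<in> M" "nondeg_hess M x a" "\<And>\<alpha>. \<alpha> \<in> M \<Longrightarrow> \<alpha> \<noteq> a \<Longrightarrow> norm (a - x) < norm (\<alpha> - x)"
    using x unfolding unique_nondeg_min_def by (auto intro: power2_less_imp_less)
  have near: "is_nearest M x a" by (rule unique_nondeg_min_is_nearest[OF x])
  obtain U V \<phi> \<psi> L A B C where s: "straightening M a U V \<phi> \<psi> L A B C"
    using submanifold_straightening[OF M(2) a(1)] by metis
  obtain \<rho> c where \<rho>: "\<rho> > 0" and c: "c > 0" and loc:
    "\<And>y b \<alpha>. y \<in> ball x \<rho> \<Longrightarrow> is_nearest M y b \<Longrightarrow> b \<in> ball a \<rho> \<Longrightarrow> \<alpha> \<in> M \<Longrightarrow> \<alpha> \<in> ball a \<rho> \<Longrightarrow>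
       (norm (b - y))^2 + c * (norm (\<alpha> - b))^2 \<le> (norm (\<alpha> - y))^2"
    using straightening.local_uniform_growth[OF s near a(2)] by metis
  define N where "N = M - ball a \<rho>"
  have "compact N" unfolding N_def by (rule compact_diff[OF M(1) open_ball])
  \<comment> \<open>Passing from \<open>x\<close> to \<open>y\<close> costs one \<eta> for the
    nearest point and one for \<alpha>; the third is the gap that remains.\<close>
  have "\<exists>\<eta>>0. \<forall>\<alpha>\<in>N. norm (a - x) + 3 * \<eta> \<le> norm (\<alpha> - x)"
  proof (cases "N = {}")
    case True then show ?thesis by (intro exI[of _ 1]) auto
  next
    case False
    have "continuous_on N (\<lambda>\<alpha>. norm (\<alpha> - x))" by (intro continuous_intros)
    from continuous_attains_inf[OF \<open>compact N\<close> False this] obtain \<alpha>0 where \<alpha>0: "\<alpha>0 \<in> N"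
      "\<And>\<alpha>. \<alpha> \<in> N \<Longrightarrow> norm (\<alpha>0 - x) \<le> norm (\<alpha> - x)" by blast
    then have "norm (a - x) < norm (\<alpha>0 - x)" using a(3)[of \<alpha>0] \<rho> unfolding N_def by (cases "\<alpha>0 = a") auto
    then show ?thesis using \<alpha>0 by (intro exI[of _ "(norm (\<alpha>0 - x) - norm (a - x)) / 3"]) (auto simp: diff_divide_distrib)
  qed
  then obtain \<eta> where \<eta>: "\<eta> > 0" "\<And>\<alpha>. \<alpha> \<in> N \<Longrightarrow> norm (a - x) + 3 * \<eta> \<le> norm (\<alpha> - x)" by blast
  obtain R where R: "\<And>\<alpha>. \<alpha> \<in> M \<Longrightarrow> norm \<alpha> \<le> R"
    using compact_imp_bounded[OF M(1)] unfolding bounded_iff by blast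
  have R0: "R \<ge> 0" using R[OF a(1)] norm_ge_zero order_trans by blast
  show thesis
  proof (rule that[of "min \<rho> \<eta>"])
    show "min \<rho> \<eta> > 0" using \<rho> \<eta> by simp
  next
    fix y b assume y: "y \<in> ball x (min \<rho> \<eta>)" and b: "is_nearest M y b"
    have bM: "b \<in> M" "norm (b - y) \<le> norm (a - y)" using b a(1) unfolding is_nearest_def by auto
    have xy: "norm (x - y) < \<eta>" using y by (simp add: dist_norm)
    have by1: "norm (b - y) < norm (a - x) + \<eta>"
      using bM(2) norm_triangle_ineq[of "a - x" "x - y"] xy by simp
    have far: "norm (b - y) + \<eta> \<le> norm (\<alpha> - y)" if "\<alpha> \<in> N" for \<alpha>
      using \<eta>(2)[OF that] by1 norm_triangle_ineq[of "\<alpha> - y" "y - x"] xy by (simp add: norm_minus_commute)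
    have bb: "b \<in> ball a \<rho>"
    proof (rule ccontr)
      assume "b \<notin> ball a \<rho>"
      then have "b \<in> N" using bM unfolding N_def by simp
      from far[OF this] show False using \<eta>(1) by simp
    qed
    \<comment> \<open>Away from \<open>a\<close> the gap yields \<eta>^2, while |\<alpha> - b| is at
      most 2 R; the 1 covers R = 0.\<close>
    define c' where "c' = min c (\<eta>^2 / (4 * R^2 + 1))"
    have R4: "4 * R^2 + 1 > 0" by (simp add: add_nonneg_pos)
    have c': "c' > 0" "c' \<le> c" "c' \<le> \<eta>^2 / (4 * R^2 + 1)" unfolding c'_def using c \<eta>(1) R4 by auto
    show "quadratic_growth M y b" unfolding quadratic_growth_def
    proof (intro conjI bM exI[of _ c'] ballI c')
      fix \<alpha> assume \<alpha>: "\<alpha> \<in> M"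
      show "(norm (b - y))^2 + c' * (norm (\<alpha> - b))^2 \<le> (norm (\<alpha> - y))^2"
      proof (cases "\<alpha> \<in> ball a \<rho>")
        case True
        have "(norm (b - y))^2 + c' * (norm (\<alpha> - b))^2 \<le> (norm (b - y))^2 + c * (norm (\<alpha> - b))^2"
          using c' by (intro add_left_mono mult_right_mono) auto
        also have "\<dots> \<le> (norm (\<alpha> - y))^2" using loc[OF _ b bb \<alpha> True] y by auto
        finally show ?thesis .
      next
        case False
        then have f: "norm (b - y) + \<eta> \<le> norm (\<alpha> - y)" using \<alpha> unfolding N_def by (intro far) (auto simp: N_def)
        have "norm (\<alpha> - b) \<le> 2 * R" using norm_triangle_ineq4[of \<alpha> b] R[OF \<alpha>] R[OF bM(1)] by linarith
        then have "(norm (\<alpha> - b))^2 \<le> (2 * R)^2" by (intro power_mono) auto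
        then have "c' * (norm (\<alpha> - b))^2 \<le> \<eta>^2 / (4 * R^2 + 1) * (4 * R^2 + 1)"
          using c' R4 by (intro mult_mono) (auto simp: power_mult_distrib)
        also have "\<dots> = \<eta>^2" using R4 by simp
        finally have "(norm (b - y))^2 + c' * (norm (\<alpha> - b))^2 \<le> (norm (b - y))^2 + \<eta>^2" by simp
        also have "\<dots> \<le> (norm (b - y) + \<eta>)^2" using \<eta>(1) by (simp add: power2_sum)
        also have "\<dots> \<le> (norm (\<alpha> - y))^2" using f \<eta>(1) by (intro power_mono) auto
        finally show ?thesis .
      qed
    qed
  qed
qed

lemma nearest_eq:
  assumes "unique_nondeg_min M x a"
  shows "nearest M x = a"
proof -
  have "x \<notin> cutlocus M" using assms unfolding cutlocus_def by blast
  moreover have "(THE \<mu>. is_nearest M x \<mu>) = a"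
    using unique_nondeg_min_is_nearest[OF assms] is_nearest_unique[OF assms] by (rule the_equality)
  ultimately show ?thesis unfolding nearest_def is_nearest_def by simp
qed

lemma growth_not_cutlocus: "quadratic_growth M y b \<Longrightarrow> y \<notin> cutlocus M"
  using growth_unique_nondeg_min unfolding cutlocus_def by auto

lemma nearest_growth:
  assumes "compact M" "submanifold m M" "x \<notin> cutlocus M"
  shows "quadratic_growth M x (nearest M x)"
proof -
  obtain a where a: "unique_nondeg_min M x a" using assms(3) unfolding cutlocus_def by blast
  obtain \<rho> where "\<rho> > 0" "\<And>y b. y \<in> ball x \<rho> \<Longrightarrow> is_nearest M y b \<Longrightarrow> quadratic_growth M y b"
    using growth_near_unique_nondeg_min[OF assms(1,2) a] by metis
  then show ?thesis using unique_nondeg_min_is_nearest[OF a] nearest_eq[OF a] by auto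
qed

lemma is_nearest_nearest:
  assumes "x \<notin> cutlocus M"
  shows "is_nearest M x (nearest M x)"
  using assms unique_nondeg_min_is_nearest nearest_eq unfolding cutlocus_def by blast

text \<open>Growth persists at neighbouring points, so the complement is open. Closedness makes
  \<delta> positive off a nonempty cut locus and serves the measurability of
  \<open>nearest\<close>.\<close>

lemma closed_cutlocus:
  assumes "compact M" "submanifold m M"
  shows "closed (cutlocus M)"
proof (cases "M = {}")
  case True
  then have "cutlocus M = UNIV" unfolding cutlocus_def unique_nondeg_min_def by auto
  then show ?thesis by simp
next
  case False
  have "open (- cutlocus M)" unfolding open_contains_ball
  proof
    fix x assume "x \<in> - cutlocus M"
    then obtain a where a: "unique_nondeg_min M x a" unfolding cutlocus_def by blast
    obtain \<rho> where \<rho>: "\<rho> > 0" "\<And>y b. y \<in> ball x \<rho> \<Longrightarrow> is_nearest M y b \<Longrightarrow> quadratic_growth M y b"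
      using growth_near_unique_nondeg_min[OF assms a] by metis
    have "y \<notin> cutlocus M" if "y \<in> ball x \<rho>" for y
      using is_nearest_exists[OF assms(1) False, of y] \<rho>(2)[OF that] growth_not_cutlocus by metis
    then show "\<exists>e>0. ball x e \<subseteq> - cutlocus M" using \<rho>(1) by blast
  qed
  then show ?thesis by (simp add: closed_def)
qed

section \<open>The nearest-point map\<close>

lemma growth_inner:
  assumes "(norm (b - y))^2 + c * (norm (\<alpha> - b))^2 \<le> (norm (\<alpha> - y))^2"
  shows "2 * ((\<alpha> - b) \<bullet> (y - b)) \<le> (1 - c) * (norm (\<alpha> - b))^2"
proof -
  have "(norm (\<alpha> - y))^2 = (norm (\<alpha> - b))^2 - 2 * ((\<alpha> - b) \<bullet> (y - b)) + (norm (b - y))^2"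
    by (simp add: power2_norm_eq_inner inner_diff_left inner_diff_right inner_commute algebra_simps)
  then show ?thesis using assms by (simp add: algebra_simps)
qed

lemma is_nearest_inner:
  assumes "is_nearest M y b" "\<alpha> \<in> M"
  shows "2 * ((\<alpha> - b) \<bullet> (y - b)) \<le> (norm (\<alpha> - b))^2"
proof -
  have "norm (b - y) \<le> norm (\<alpha> - y)" using assms unfolding is_nearest_def by blast
  then have "(norm (b - y))^2 \<le> (norm (\<alpha> - y))^2" by (rule power_mono) simp
  then show ?thesis using growth_inner[of b y 0 \<alpha>] by simp
qed

lemma inner_is_nearest:
  assumes "b \<in> M" "\<And>\<alpha>. \<alpha> \<in> M \<Longrightarrow> 2 * ((\<alpha> - b) \<bullet> (y - b)) \<le> (norm (\<alpha> - b))^2"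
  shows "is_nearest M y b"
  unfolding is_nearest_def
proof (intro conjI assms(1) ballI)
  fix \<alpha> assume \<alpha>: "\<alpha> \<in> M"
  have "(norm (\<alpha> - y))^2 = (norm (\<alpha> - b))^2 - 2 * ((\<alpha> - b) \<bullet> (y - b)) + (norm (b - y))^2"
    by (simp add: power2_norm_eq_inner inner_diff_left inner_diff_right inner_commute algebra_simps)
  then have "(norm (b - y))^2 \<le> (norm (\<alpha> - y))^2" using assms(2)[OF \<alpha>] by simp
  then show "norm (b - y) \<le> norm (\<alpha> - y)" by (rule power2_le_imp_le) simp
qed

text \<open>If q is the least constant with 2 (a - b, x - b) \<le> q |a - b|^2 for all a in M, then b stays a nearest
  point along the ray from b through x up to b + (x - b)/q. Quadratic growth fails at this end point, so
  it lies in the cut locus and hence is at least \<delta> away from x.\<close>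
lemma ray_bound:
  assumes M: "compact M" "submanifold m M" and x: "x \<notin> cutlocus M"
    and \<delta>: "0 \<le> \<delta>" "\<And>z. z \<in> cutlocus M \<Longrightarrow> \<delta> \<le> dist x z"
    and b: "b = nearest M x" and \<alpha>: "\<alpha> \<in> M"
  shows "2 * (norm (x - b) + \<delta>) * ((\<alpha> - b) \<bullet> (x - b)) \<le> norm (x - b) * (norm (\<alpha> - b))^2"
proof (rule ccontr)
  assume neg: "\<not> 2 * (norm (x - b) + \<delta>) * ((\<alpha> - b) \<bullet> (x - b)) \<le> norm (x - b) * (norm (\<alpha> - b))^2"
  define v where "v = x - b"
  \<comment> \<open>The threshold for \<open>q\<close>: the negated claim says f \<alpha> >
    \<kappa>, whereas an end point of the ray at distance at least \<delta> from \<open>x\<close>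
    would give q \<le> \<kappa>.\<close>
  define \<kappa> where "\<kappa> = norm v / (norm v + \<delta>)"
  have v0: "norm v > 0" using neg unfolding v_def by (cases "x = b") auto
  have v\<delta>: "norm v + \<delta> > 0" using v0 \<delta>(1) by linarith
  have \<alpha>b: "\<alpha> \<noteq> b" using neg by auto
  obtain c where bM: "b \<in> M" and c: "c > 0" "\<And>\<alpha>. \<alpha> \<in> M \<Longrightarrow> (norm (b - x))^2 + c * (norm (\<alpha> - b))^2 \<le> (norm (\<alpha> - x))^2"
    using nearest_growth[OF M x] unfolding b quadratic_growth_def by blast
  define f where "f \<alpha> = 2 * ((\<alpha> - b) \<bullet> v) / (norm (\<alpha> - b))^2" for \<alpha>
  define q where "q = Sup (f ` (M - {b}))"
  have fle: "f \<beta> \<le> 1 - c" if "\<beta> \<in> M - {b}" for \<beta>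
    using growth_inner[OF c(2), of \<beta>] that unfolding f_def v_def by (simp add: divide_le_eq)
  then have bdd: "bdd_above (f ` (M - {b}))" by (intro bdd_aboveI2)
  have ne: "f ` (M - {b}) \<noteq> {}" using \<alpha> \<alpha>b by auto
  have q1: "q \<le> 1 - c" unfolding q_def using fle by (intro cSup_least ne) auto
  have fq: "f \<beta> \<le> q" if "\<beta> \<in> M - {b}" for \<beta> unfolding q_def using that by (intro cSup_upper bdd) auto
  have "norm v * (norm (\<alpha> - b))^2 < 2 * (norm v + \<delta>) * ((\<alpha> - b) \<bullet> v)" using neg unfolding v_def by simp
  moreover have "(norm (\<alpha> - b))^2 > 0" using \<alpha>b by simp
  ultimately have "norm v < 2 * (norm v + \<delta>) * ((\<alpha> - b) \<bullet> v) / (norm (\<alpha> - b))^2" by (simp add: pos_less_divide_eq)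
  then have "norm v < f \<alpha> * (norm v + \<delta>)" unfolding f_def by (simp only: times_divide_eq_left times_divide_eq_right mult_ac)
  then have "\<kappa> < f \<alpha>" unfolding \<kappa>_def using v\<delta> by (simp add: pos_divide_less_eq)
  then have \<kappa>q: "\<kappa> < q" using fq[of \<alpha>] \<alpha> \<alpha>b by auto
  have "\<kappa> > 0" unfolding \<kappa>_def using v0 v\<delta> by (intro divide_pos_pos)
  then have q0: "q > 0" using \<kappa>q by simp
  define z where "z = b + (1 / q) *\<^sub>R v"
  have fz: "2 * ((\<beta> - b) \<bullet> (z - b)) = f \<beta> / q * (norm (\<beta> - b))^2" if "\<beta> \<noteq> b" for \<beta>
    using that unfolding z_def f_def by simp
  have near: "is_nearest M z b"
  proof (rule inner_is_nearest[OF bM])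
    fix \<beta> assume \<beta>: "\<beta> \<in> M"
    show "2 * ((\<beta> - b) \<bullet> (z - b)) \<le> (norm (\<beta> - b))^2"
    proof (cases "\<beta> = b")
      case False
      then have "f \<beta> / q \<le> 1" using fq[of \<beta>] \<beta> q0 by simp
      then have "f \<beta> / q * (norm (\<beta> - b))^2 \<le> 1 * (norm (\<beta> - b))^2" by (intro mult_right_mono) auto
      then show ?thesis using fz[OF False] by simp
    qed simp
  qed
  have "z \<notin> cutlocus M"
  proof
    assume "z \<in> cutlocus M"
    then have "\<delta> \<le> dist x z" by (rule \<delta>(2))
    also have "dist x z = norm ((1 / q - 1) *\<^sub>R v)"
    proof -
      have "z - x = (1 / q - 1) *\<^sub>R v" unfolding z_def v_def by (simp add: algebra_simps)
      then show ?thesis by (metis dist_norm dist_commute)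
    qed
    also have "\<dots> = (1 / q - 1) * norm v" using q0 q1 c(1) by simp
    finally have "q * (\<delta> + norm v) \<le> norm v" using q0 by (simp add: field_simps)
    then have "q \<le> \<kappa>" unfolding \<kappa>_def using v\<delta> by (simp add: pos_le_divide_eq add.commute)
    then show False using \<kappa>q by simp
  qed
  then have "quadratic_growth M z (nearest M z)" by (rule nearest_growth[OF M])
  moreover have "nearest M z = b"
    using is_nearest_unique[OF growth_unique_nondeg_min[OF calculation] near] by simp
  ultimately obtain c' where c': "c' > 0" "\<And>\<alpha>. \<alpha> \<in> M \<Longrightarrow> (norm (b - z))^2 + c' * (norm (\<alpha> - b))^2 \<le> (norm (\<alpha> - z))^2"
    unfolding quadratic_growth_def by metis
  \<comment> \<open>Growth at the end point would lower the bound on all \<open>f \<beta>\<close> by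
    the factor 1 - c', which is impossible for their positive supremum \<open>q\<close>.\<close>
  have "f \<beta> \<le> (1 - c') * q" if \<beta>: "\<beta> \<in> M - {b}" for \<beta>
  proof -
    have "f \<beta> / q * (norm (\<beta> - b))^2 \<le> (1 - c') * (norm (\<beta> - b))^2"
      using growth_inner[OF c'(2), of \<beta>] fz[of \<beta>] \<beta> by simp
    moreover have "(norm (\<beta> - b))^2 > 0" using \<beta> by simp
    ultimately have "f \<beta> / q \<le> 1 - c'" by (rule mult_right_le_imp_le)
    then show ?thesis using q0 by (simp add: divide_le_eq)
  qed
  then have "q \<le> (1 - c') * q" unfolding q_def by (intro cSup_least ne) (auto simp: q_def)
  then have "c' * q \<le> 0" by (simp add: algebra_simps)
  then show False using mult_pos_pos[OF c'(1) q0] by simp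
qed

text \<open>Growth at \<open>a\<close>, tested with \<open>b\<close>, is added to minimality at
  \<open>b\<close>, tested with \<open>a\<close>. The squares combine to c |b - a|^2 on one side,
  with an inner product with \<open>y - x\<close> on the other.\<close>

lemma nearest_continuous_bound:
  assumes gr: "(norm (a - x))^2 + c * (norm (b - a))^2 \<le> (norm (b - x))^2" and b: "is_nearest M y b" and a: "a \<in> M"
  shows "c * norm (b - a) \<le> 2 * norm (y - x)"
proof -
  have "2 * ((b - a) \<bullet> (x - a)) \<le> (1 - c) * (norm (b - a))^2" by (rule growth_inner[OF gr])
  moreover have "2 * ((a - b) \<bullet> (y - b)) \<le> (norm (b - a))^2"
    using is_nearest_inner[OF b a] by (simp add: norm_minus_commute)
  moreover have "(b - a) \<bullet> (x - a) + (a - b) \<bullet> (y - b) = (norm (b - a))^2 - (b - a) \<bullet> (y - x)"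
    by (simp add: power2_norm_eq_inner inner_diff_left inner_diff_right inner_commute algebra_simps)
  ultimately have "c * (norm (b - a))^2 \<le> 2 * ((b - a) \<bullet> (y - x))" by (simp add: algebra_simps)
  also have "\<dots> \<le> 2 * (norm (b - a) * norm (y - x))" using norm_cauchy_schwarz[of "b - a" "y - x"] by simp
  finally have "(c * norm (b - a)) * norm (b - a) \<le> (2 * norm (y - x)) * norm (b - a)"
    by (simp add: power2_eq_square mult_ac)
  then show ?thesis by (cases "norm (b - a) = 0") auto
qed

lemma continuous_on_nearest:
  assumes M: "compact M" "submanifold m M"
  shows "continuous_on (- cutlocus M) (nearest M)"
  unfolding continuous_on_iff
proof (intro ballI allI impI)
  fix x and e :: real assume x: "x \<in> - cutlocus M" and e: "e > 0"
  define a where "a = nearest M x"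
  obtain c where a: "a \<in> M" and c: "c > 0" "\<And>\<alpha>. \<alpha> \<in> M \<Longrightarrow> (norm (a - x))^2 + c * (norm (\<alpha> - a))^2 \<le> (norm (\<alpha> - x))^2"
    using nearest_growth[OF M, of x] x unfolding quadratic_growth_def a_def by auto
  show "\<exists>d>0. \<forall>y\<in>- cutlocus M. dist y x < d \<longrightarrow> dist (nearest M y) (nearest M x) < e"
  proof (intro exI[of _ "c * e / 2"] conjI ballI impI)
    show "c * e / 2 > 0" using c e by simp
  next
    fix y assume y: "y \<in> - cutlocus M" "dist y x < c * e / 2"
    have n: "is_nearest M y (nearest M y)" using y by (intro is_nearest_nearest) auto
    then have "nearest M y \<in> M" unfolding is_nearest_def by blast
    have "c * norm (nearest M y - a) \<le> 2 * norm (y - x)"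
      by (rule nearest_continuous_bound[OF c(2)[OF \<open>nearest M y \<in> M\<close>] n a])
    also have "\<dots> < c * e" using y(2) by (simp add: dist_norm)
    finally show "dist (nearest M y) (nearest M x) < e" using c(1) unfolding a_def by (simp add: dist_norm)
  qed
qed

text \<open>Continuity off the closed cut locus and the constant value 0 on it; this makes the
  random nearest points measurable.\<close>

lemma borel_measurable_nearest:
  assumes M: "compact M" "submanifold m M"
  shows "nearest M \<in> borel_measurable borel"
proof -
  have cl: "closed (cutlocus M)" by (rule closed_cutlocus[OF M])
  have "(\<lambda>x. if x \<in> - cutlocus M then nearest M x else 0) \<in> borel_measurable borel"
    by (intro borel_measurable_continuous_on_if continuous_on_nearest[OF M] continuous_on_const)
       (use cl in \<open>auto intro: borel_closed borel_open\<close>)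
  moreover have "(\<lambda>x. if x \<in> - cutlocus M then nearest M x else 0) = nearest M"
    by (auto simp: fun_eq_iff nearest_def)
  ultimately show ?thesis by simp
qed

text \<open>The ray bound is used at both points. With r = |b - a|^2 each of the two doubled inner
  products is at most (D + \<delta>/2)/(D + \<delta>) r, so their sum falls short of 2 r by at least
  \<delta>/(D + \<delta>) r; only the inner product with \<open>y - x\<close> can make up for
  this.\<close>

lemma nearest_lipschitz:
  assumes M: "compact M" "submanifold m M" and D: "0 \<le> D"
    and x: "x \<notin> cutlocus M" "infdist x M \<le> D" and \<delta>: "\<delta> = infdist x (cutlocus M)" "\<delta> > 0" and y: "norm (y - x) \<le> \<delta> / 2"
  shows "y \<notin> cutlocus M" "\<delta> * norm (nearest M y - nearest M x) \<le> 2 * (D + \<delta>) * norm (y - x)"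
    "norm (x - nearest M x) \<le> D"
proof -
  have dx: "\<delta> \<le> dist x z" if "z \<in> cutlocus M" for z unfolding \<delta>(1) by (rule infdist_le[OF that])
  have dy: "\<delta> / 2 \<le> dist y z" if "z \<in> cutlocus M" for z
    using dx[OF that] dist_triangle[of x z y] y by (simp add: dist_norm norm_minus_commute)
  show yC: "y \<notin> cutlocus M" using dy[of y] \<delta>(2) by auto
  define a b where "a = nearest M x" and "b = nearest M y"
  have na: "is_nearest M x a" and nb: "is_nearest M y b" unfolding a_def b_def using is_nearest_nearest x yC by auto
  then have aM: "a \<in> M" and bM: "b \<in> M" unfolding is_nearest_def by auto
  have "infdist x M = dist x a"
  proof -
    have "infdist x M = (INF \<alpha>\<in>M. dist x \<alpha>)" using aM by (intro infdist_notempty) auto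
    also have "\<dots> = dist x a"
      using na by (intro cInf_eq_minimum) (auto simp: is_nearest_def dist_norm norm_minus_commute)
    finally show ?thesis .
  qed
  then have va: "norm (x - a) \<le> D" using x(2) by (simp add: dist_norm)
  then show "norm (x - nearest M x) \<le> D" unfolding a_def .
  have "norm (y - b) \<le> norm (y - a)" using nb aM unfolding is_nearest_def by (auto simp: norm_minus_commute)
  also have "\<dots> \<le> norm (y - x) + norm (x - a)" using norm_triangle_ineq[of "y - x" "x - a"] by simp
  also have "\<dots> \<le> D + \<delta> / 2" using y va by simp
  finally have vb: "norm (y - b) \<le> D + \<delta> / 2" .
  define r where "r = (norm (b - a))^2"
  have r: "r \<ge> 0" unfolding r_def by simp
  \<comment> \<open>Here \<open>t\<close> is the distance to the nearest point,
    \<open>\<delta>'\<close> a lower bound on the distance to the cut locus, and t/(t + \<delta>')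
    increases with \<open>t\<close>. For \<open>x\<close> the excess \<open>\<delta>''\<close> is 0,
    for \<open>y\<close> it is \<delta>/2; in both cases the denominator becomes D +
    \<delta>.\<close>
  have frac: "2 * I * (D + \<delta>) \<le> (D + \<delta> / 2) * r"
    if "2 * (t + \<delta>') * I \<le> t * r" "0 \<le> t" "t \<le> D + \<delta>'' " "0 < \<delta>'" "\<delta>' + \<delta>'' = \<delta> " "0 \<le> \<delta>''" "\<delta>'' \<le> \<delta> / 2"
    for I t \<delta>' \<delta>''
  proof (cases "I \<le> 0")
    case True
    then have "2 * I * (D + \<delta>) \<le> 0" using D \<delta>(2) by (simp add: mult_nonpos_nonneg)
    also have "0 \<le> (D + \<delta> / 2) * r" using D \<delta>(2) r by simp
    finally show ?thesis .
  next
    case False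
    have "I * 2 \<le> t / (t + \<delta>') * r" using that by (simp add: field_simps)
    also have "t / (t + \<delta>') \<le> (D + \<delta>'') / (D + \<delta>)"
    proof -
      have "t * \<delta>' \<le> (D + \<delta>'') * \<delta>'" using that by (intro mult_right_mono) auto
      then have "t * (D + \<delta>) \<le> (D + \<delta>'') * (t + \<delta>')" using that(5)[symmetric] by (simp add: algebra_simps)
      then show ?thesis using that D \<delta>(2) by (simp add: divide_le_eq le_divide_eq mult_ac)
    qed
    also have "\<dots> \<le> (D + \<delta> / 2) / (D + \<delta>)" using that D \<delta>(2) by (intro divide_right_mono) auto
    finally have "I * 2 \<le> (D + \<delta> / 2) / (D + \<delta>) * r" using r by (meson mult_right_mono)
    then show ?thesis using D \<delta>(2) by (simp add: field_simps)
  qed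
  have "2 * (norm (x - a) + \<delta>) * ((b - a) \<bullet> (x - a)) \<le> norm (x - a) * r"
    unfolding r_def using \<delta>(2) by (intro ray_bound[OF M x(1) _ dx a_def bM]) auto
  then have 1: "2 * ((b - a) \<bullet> (x - a)) * (D + \<delta>) \<le> (D + \<delta> / 2) * r"
    by (rule frac[where \<delta>''=0]) (use va \<delta>(2) in auto)
  have "2 * (norm (y - b) + \<delta> / 2) * ((a - b) \<bullet> (y - b)) \<le> norm (y - b) * (norm (a - b))^2"
    using \<delta>(2) by (intro ray_bound[OF M yC _ dy b_def aM]) auto
  then have "2 * (norm (y - b) + \<delta> / 2) * ((a - b) \<bullet> (y - b)) \<le> norm (y - b) * r"
    unfolding r_def by (simp add: norm_minus_commute)
  then have 2: "2 * ((a - b) \<bullet> (y - b)) * (D + \<delta>) \<le> (D + \<delta> / 2) * r"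
    by (rule frac[where \<delta>''="\<delta> / 2"]) (use vb \<delta>(2) in auto)
  have e: "(b - a) \<bullet> (x - a) + (a - b) \<bullet> (y - b) = r - (b - a) \<bullet> (y - x)"
    unfolding r_def by (simp add: power2_norm_eq_inner inner_diff_left inner_diff_right inner_commute algebra_simps)
  have "2 * (r - (b - a) \<bullet> (y - x)) * (D + \<delta>) \<le> 2 * ((D + \<delta> / 2) * r)"
    using 1 2 unfolding e[symmetric] by (simp add: algebra_simps)
  then have "\<delta> * r \<le> 2 * (D + \<delta>) * ((b - a) \<bullet> (y - x))" by (simp add: algebra_simps)
  also have "\<dots> \<le> 2 * (D + \<delta>) * (norm (b - a) * norm (y - x))"
    using D \<delta>(2) by (intro mult_left_mono norm_cauchy_schwarz) auto
  finally have "(\<delta> * norm (b - a)) * norm (b - a) \<le> (2 * (D + \<delta>) * norm (y - x)) * norm (b - a)"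
    unfolding r_def by (simp add: power2_eq_square mult_ac)
  then have "\<delta> * norm (b - a) \<le> 2 * (D + \<delta>) * norm (y - x)"
    using D \<delta>(2) by (cases "norm (b - a) = 0") auto
  then show "\<delta> * norm (nearest M y - nearest M x) \<le> 2 * (D + \<delta>) * norm (y - x)" unfolding a_def b_def .
qed

section \<open>The case of an empty cut locus\<close>

lemma farthest_normal:
  assumes q: "q \<in> M" "\<And>\<alpha>. \<alpha> \<in> M \<Longrightarrow> norm (\<alpha> - p) \<le> norm (q - p)"
  shows "p - q \<in> normal_space M q"
  unfolding normal_space_def
proof (intro CollectI ballI)
  fix w assume "w \<in> tangent_space M q"
  then obtain \<gamma> e where g: "0 < e" "\<And>t. t\<in>{-e<..<e} \<Longrightarrow> \<gamma> t \<in> M" "\<gamma> 0 = q" "(\<gamma> has_vector_derivative w) (at 0)"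
    unfolding tangent_space_def by blast
  note d = squared_distance_curve_derivative[OF g(4,3), of p]
  have "2 * ((q - p) \<bullet> w) = 0"
  proof (rule DERIV_local_max[OF d g(1)], intro allI impI)
    fix t assume "\<bar>0 - t\<bar> < e"
    then have "norm (\<gamma> t - p) \<le> norm (q - p)" using q(2) g(2)[of t] by (auto simp: abs_less_iff)
    then show "(\<gamma> t - p) \<bullet> (\<gamma> t - p) \<le> (\<gamma> 0 - p) \<bullet> (\<gamma> 0 - p)"
      using g(3) by (simp add: norm_le)
  qed
  then show "(p - q) \<bullet> w = 0" by (simp add: inner_diff_left)
qed

text \<open>With an empty cut locus, the ray bound holds for all \<delta>, so nearest points satisfy the variational
  inequality of a convex set. Hence M is convex, and the chord to a farthest point q would be both
  normal and tangent to M at q.\<close>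
lemma empty_cutlocus:
  assumes M: "compact M" "submanifold m M" and C: "cutlocus M = {}" and p: "p \<in> M"
  shows "M = {p}"
proof -
  have var: "(\<alpha> - nearest M x) \<bullet> (x - nearest M x) \<le> 0" if \<alpha>: "\<alpha> \<in> M" for x \<alpha>
  proof (rule ccontr)
    define b where "b = nearest M x"
    assume "\<not> (\<alpha> - nearest M x) \<bullet> (x - nearest M x) \<le> 0"
    then have I: "(\<alpha> - b) \<bullet> (x - b) > 0" unfolding b_def by simp
    define J where "J = (\<alpha> - b) \<bullet> (x - b)"
    \<comment> \<open>The value for which the right side of the ray bound is exactly \<delta> J, so
      that its left side, 2 (|x - b| + \<delta>) J, is too large.\<close>
    define \<delta> where "\<delta> = norm (x - b) * (norm (\<alpha> - b))^2 / J"
    have J: "J > 0" unfolding J_def by (rule I)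
    have \<delta>: "\<delta> \<ge> 0" unfolding \<delta>_def using J by simp
    have "2 * (norm (x - b) + \<delta>) * J \<le> norm (x - b) * (norm (\<alpha> - b))^2"
      unfolding J_def by (rule ray_bound[OF M _ \<delta> _ b_def \<alpha>]) (use C in auto)
    also have "\<dots> = \<delta> * J" unfolding \<delta>_def using J by simp
    finally have "(2 * norm (x - b) + \<delta>) * J \<le> 0" by (simp add: algebra_simps)
    then have "2 * norm (x - b) + \<delta> \<le> 0" using J by (simp add: mult_le_0_iff)
    then have "norm (x - b) = 0" using \<delta> norm_ge_zero[of "x - b"] by linarith
    then show False using I by simp
  qed
  have conv: "convex M" unfolding convex_alt
  proof (intro ballI allI impI)
    fix \<alpha> \<beta> and u :: real assume ab: "\<alpha> \<in> M" "\<beta> \<in> M" and u: "0 \<le> u \<and> u \<le> 1"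
    define x where "x = (1 - u) *\<^sub>R \<alpha> + u *\<^sub>R \<beta>"
    define b where "b = nearest M x"
    have "x - b = (1 - u) *\<^sub>R (\<alpha> - b) + u *\<^sub>R (\<beta> - b)" unfolding x_def by (simp add: algebra_simps)
    then have "(x - b) \<bullet> (x - b) = (1 - u) * ((\<alpha> - b) \<bullet> (x - b)) + u * ((\<beta> - b) \<bullet> (x - b))"
      by (metis inner_add_left inner_scaleR_left)
    also have "\<dots> \<le> 0" using var[OF ab(1), of x] var[OF ab(2), of x] u unfolding b_def
      by (intro add_nonpos_nonpos mult_nonneg_nonpos) auto
    finally have "x = b" by (metis inner_eq_zero_iff inner_ge_zero order_antisym eq_iff_diff_eq_0)
    moreover have "b \<in> M" using is_nearest_nearest[of x M] C unfolding b_def is_nearest_def by auto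
    ultimately show "(1 - u) *\<^sub>R \<alpha> + u *\<^sub>R \<beta> \<in> M" unfolding x_def by simp
  qed
  have "continuous_on M (\<lambda>\<alpha>. norm (\<alpha> - p))" by (intro continuous_intros)
  then obtain q where q: "q \<in> M" "\<And>\<alpha>. \<alpha> \<in> M \<Longrightarrow> norm (\<alpha> - p) \<le> norm (q - p)"
    using continuous_attains_sup[OF M(1)] p by blast
  have "q = p"
  proof (rule ccontr)
    assume qp: "q \<noteq> p"
    obtain \<rho> K where \<rho>: "\<rho> > 0" and K: "K \<ge> 0" and
      est: "\<And>\<mu> \<mu>'. \<mu> \<in> M \<Longrightarrow> \<mu>' \<in> M \<Longrightarrow> norm (\<mu>' - \<mu>) < \<rho> \<Longrightarrow> tangential_estimates M K \<mu> \<mu>'"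
      using uniform_tangential_estimates[OF M] by metis
    define d where "d = norm (p - q)"
    have d: "d > 0" unfolding d_def using qp by simp
    \<comment> \<open>The point of the chord is taken so close to \<open>q\<close> that K t d < 1;
      then the quadratic bound on the normal part contradicts the chord being entirely
      normal.\<close>
    define t where "t = min 1 (min (\<rho> / (2 * d)) (1 / (2 * (K + 1) * d)))"
    have t: "0 < t" "t \<le> 1" "t * d < \<rho>" "(K + 1) * (t * d) < 1"
    proof -
      show t0: "0 < t" "t \<le> 1" unfolding t_def using \<rho> d K by auto
      have "t \<le> \<rho> / (2 * d)" "t \<le> 1 / (2 * (K + 1) * d)" unfolding t_def by auto
      moreover have "2 * (K + 1) * d > 0" using d K by simp
      ultimately have "t * d \<le> \<rho> / 2" "(K + 1) * (t * d) \<le> 1 / 2"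
        using d K by (simp_all add: pos_le_divide_eq mult_ac)
      then show "t * d < \<rho>" "(K + 1) * (t * d) < 1" using \<rho> by auto
    qed
    define \<mu> where "\<mu> = q + t *\<^sub>R (p - q)"
    have "\<mu> = (1 - t) *\<^sub>R q + t *\<^sub>R p" unfolding \<mu>_def by (simp add: algebra_simps)
    then have \<mu>: "\<mu> \<in> M" using conv q(1) p t unfolding convex_alt by auto
    have \<mu>q: "\<mu> - q = t *\<^sub>R (p - q)" "norm (\<mu> - q) = t * d" unfolding \<mu>_def d_def using t by auto
    have "tangential_estimates M K q \<mu>" using est[OF q(1) \<mu>] \<mu>q t by simp
    then have "norm (\<mu> - q - tanproj M q *v (\<mu> - q)) \<le> K * norm (\<mu> - q)^2"
      unfolding tangential_estimates_def by blast
    moreover have "tanproj M q *v (\<mu> - q) = 0"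
      unfolding \<mu>q by (simp add: matrix_vector_mult_scaleR
          tanproj_normal_zero[OF subspace_tangent_space[OF M(2) q(1)] farthest_normal[OF q]])
    ultimately have "t * d \<le> K * (t * d)^2" using \<mu>q by simp
    then have "(t * d) * 1 \<le> (t * d) * (K * (t * d))" by (simp add: power2_eq_square mult_ac)
    then have "1 \<le> K * (t * d)" using t(1) d by simp
    moreover have "0 < t * d" using t(1) d by simp
    ultimately show False using t(4) by (simp add: algebra_simps)
  qed
  then have "norm (\<alpha> - p) \<le> 0" if "\<alpha> \<in> M" for \<alpha> using q(2)[OF that] by simp
  then have "M \<subseteq> {p}" by auto
  then show ?thesis using p by blast
qed

text \<open>With \<eta> = |y - x|/\<delta>, the Lipschitz bound gives |\<mu>' - \<mu>| = O(\<eta>),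
  so every error term of the tangential estimates is O(\<eta>^2). The constants depend on
  \<open>M\<close>, \<open>D\<close> and one point of the cut locus, not on
  \<open>x\<close>.\<close>

lemma main_estimate:
  fixes M :: "(real^'n) set"
  assumes M: "compact M" "submanifold m M" and D: "0 \<le> D" and C: "cutlocus M \<noteq> {}"
  obtains \<epsilon> K where "\<epsilon> > 0" "K \<ge> 0"
    "\<And>x y. x \<notin> cutlocus M \<Longrightarrow> infdist x M \<le> D \<Longrightarrow> norm (y - x) \<le> \<epsilon> * infdist x (cutlocus M) \<Longrightarrow>
       norm ((mat 1 - weingarten_tan M (nearest M x) (x - nearest M x)) *v (nearest M y - nearest M x)
          - tanproj M (nearest M x) *v (y - x)) \<le> K * (norm (y - x) / infdist x (cutlocus M))^2"
proof (cases "M = {}")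
  case True
  then have "x \<in> cutlocus M" for x unfolding cutlocus_def unique_nondeg_min_def by auto
  then show thesis by (intro that[of 1 0]) auto
next
  case False
  obtain \<rho> K where \<rho>: "\<rho> > 0" and K: "K \<ge> 0" and
    est: "\<And>\<mu> \<mu>'. \<mu> \<in> M \<Longrightarrow> \<mu>' \<in> M \<Longrightarrow> norm (\<mu>' - \<mu>) < \<rho> \<Longrightarrow> tangential_estimates M K \<mu> \<mu>'"
    using uniform_tangential_estimates[OF M] by metis
  obtain R where R: "\<And>\<alpha>. \<alpha> \<in> M \<Longrightarrow> norm \<alpha> \<le> R" using compact_imp_bounded[OF M(1)] unfolding bounded_iff by blast
  obtain c0 where c0: "c0 \<in> cutlocus M" using C by blast
  have R0: "R \<ge> 0" using R False norm_ge_zero order_trans by blast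
  \<comment> \<open>Bounds \<delta> for all admissible \<open>x\<close>: these have norm at most R +
    D, and \<open>c0\<close> lies in the cut locus. Hence |y - x| = \<eta> \<delta> is at most K0
    \<eta>.\<close>
  define K0 where "K0 = R + D + norm c0"
  have K0: "K0 \<ge> 0" unfolding K0_def using R0 D by simp
  define K1 where "K1 = 2 * (D + K0)"
  have K1: "K1 \<ge> 0" unfolding K1_def using D K0 by simp
  \<comment> \<open>The bound 1/2 is for the Lipschitz estimate, the other brings \<mu>' within
    \<rho> of \<mu>.\<close>
  define \<epsilon> where "\<epsilon> = min (1/2) (\<rho> / (K1 + 1))"
  have \<epsilon>: "\<epsilon> > 0" "\<epsilon> \<le> 1/2" "K1 * \<epsilon> < \<rho>"
  proof -
    show "\<epsilon> > 0" unfolding \<epsilon>_def using \<rho> K1 by auto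
    show "\<epsilon> \<le> 1/2" unfolding \<epsilon>_def by (rule min.cobounded1)
    have "\<epsilon> \<le> \<rho> / (K1 + 1)" unfolding \<epsilon>_def by simp
    then have "(K1 + 1) * \<epsilon> \<le> \<rho>" using K1 by (simp add: field_simps)
    then show "K1 * \<epsilon> < \<rho>" using \<open>\<epsilon> > 0\<close> by (simp add: algebra_simps)
  qed
  define K2 where "K2 = K * K1^2 + K * (D * K1^2 + K1 * (K0 + K1))"
  show thesis
  proof (rule that[of \<epsilon> K2])
    show "\<epsilon> > 0" "K2 \<ge> 0" unfolding K2_def using \<epsilon> K K0 K1 D by auto
  next
    fix x y assume x: "x \<notin> cutlocus M" "infdist x M \<le> D" and y: "norm (y - x) \<le> \<epsilon> * infdist x (cutlocus M)"
    define \<delta> where "\<delta> = infdist x (cutlocus M)"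
    have \<delta>: "\<delta> > 0" unfolding \<delta>_def using infdist_pos_not_in_closed[OF closed_cutlocus[OF M] C x(1)] .
    have "\<epsilon> * \<delta> \<le> 1/2 * \<delta>" using \<epsilon>(2) \<delta> by (intro mult_right_mono) auto
    then have y2: "norm (y - x) \<le> \<delta> / 2" using y unfolding \<delta>_def[symmetric] by simp
    note lip = nearest_lipschitz[OF M D x \<delta>_def \<delta> y2]
    define \<mu> \<mu>' where "\<mu> = nearest M x" and "\<mu>' = nearest M y"
    have n: "is_nearest M x \<mu>" "is_nearest M y \<mu>'" unfolding \<mu>_def \<mu>'_def using is_nearest_nearest x lip(1) by auto
    then have \<mu>M: "\<mu> \<in> M" "\<mu>' \<in> M" unfolding is_nearest_def by auto
    define \<eta> where "\<eta> = norm (y - x) / \<delta>"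
    have \<eta>: "\<eta> \<ge> 0" "\<eta> \<le> \<epsilon>" unfolding \<eta>_def using \<delta> y unfolding \<delta>_def[symmetric] by (simp_all add: divide_le_eq)
    have \<delta>K: "\<delta> \<le> K0"
    proof -
      have "\<delta> \<le> dist x c0" unfolding \<delta>_def by (rule infdist_le[OF c0])
      also have "\<dots> \<le> norm (x - \<mu>) + norm \<mu> + norm c0"
        unfolding dist_norm using norm_triangle_ineq[of "x - \<mu>" \<mu>] norm_triangle_ineq4[of x c0] by simp
      also have "\<dots> \<le> K0" unfolding K0_def using lip(3) R[OF \<mu>M(1)] unfolding \<mu>_def by simp
      finally show ?thesis .
    qed
    have yx: "norm (y - x) = \<eta> * \<delta>" unfolding \<eta>_def using \<delta> by simp
    have yx2: "norm (y - x) \<le> K0 * \<eta>" unfolding yx using \<delta>K \<eta>(1) by (simp add: mult.commute mult_right_mono)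
    define \<Delta> where "\<Delta> = \<mu>' - \<mu>"
    have "\<delta> * norm \<Delta> \<le> \<delta> * (2 * (D + \<delta>) * \<eta>)" using lip(2) unfolding \<Delta>_def \<mu>_def \<mu>'_def yx by (simp add: mult_ac)
    then have "norm \<Delta> \<le> 2 * (D + \<delta>) * \<eta>" using \<delta> by simp
    also have "\<dots> \<le> K1 * \<eta>" unfolding K1_def using \<delta>K \<eta>(1) by (intro mult_right_mono) auto
    finally have \<Delta>: "norm \<Delta> \<le> K1 * \<eta>" .
    also have "\<dots> \<le> K1 * \<epsilon>" using \<eta> K1 by (intro mult_left_mono)
    finally have "norm (\<mu>' - \<mu>) < \<rho>" using \<epsilon>(3) unfolding \<Delta>_def by simp
    then have te: "tangential_estimates M K \<mu> \<mu>'" by (rule est[OF \<mu>M])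
    define v nn where "v = x - \<mu>" and "nn = y - \<mu>'"
    have vn: "v \<in> normal_space M \<mu>" "nn \<in> normal_space M \<mu>'"
      unfolding v_def nn_def using nearest_normal n by auto
    note T = subspace_tangent_space[OF M(2) \<mu>M(1)]
    define P W where "P = tanproj M \<mu>" and "W = weingarten_tan M \<mu> v"
    have t1: "norm (\<Delta> - P *v \<Delta>) \<le> K * norm \<Delta>^2"
      using te unfolding tangential_estimates_def \<Delta>_def P_def by blast
    have t2: "norm (P *v nn + W *v \<Delta>) \<le> K * (norm v * norm \<Delta>^2 + norm \<Delta> * norm (nn - v))"
      using te vn unfolding tangential_estimates_def \<Delta>_def P_def W_def by blast
    have Pv: "P *v v = 0" unfolding P_def by (rule tanproj_normal_zero[OF T vn(1)])
    \<comment> \<open>Projecting kills \<open>v\<close>, so the error splits into \<Delta> - P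
      \<Delta> and P nn + W \<Delta>, the quantities of the first and the third tangential
      estimate.\<close>
    have "y - x = nn + \<Delta> - v" unfolding nn_def \<Delta>_def v_def by simp
    then have "P *v (y - x) = P *v nn + P *v \<Delta>"
      using Pv by (simp add: matrix_vector_mult_diff_distrib matrix_vector_right_distrib)
    then have "(mat 1 - W) *v \<Delta> - P *v (y - x) = (\<Delta> - P *v \<Delta>) - (P *v nn + W *v \<Delta>)"
      by (simp add: matrix_vector_mult_diff_rdistrib)
    then have "norm ((mat 1 - W) *v \<Delta> - P *v (y - x)) \<le> norm (\<Delta> - P *v \<Delta>) + norm (P *v nn + W *v \<Delta>)"
      by (simp only: norm_triangle_ineq4)
    also have "\<dots> \<le> K * norm \<Delta>^2 + K * (norm v * norm \<Delta>^2 + norm \<Delta> * norm (nn - v))" by (rule add_mono[OF t1 t2])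
    also have "\<dots> \<le> K * (K1 * \<eta>)^2 + K * (D * (K1 * \<eta>)^2 + (K1 * \<eta>) * (K0 * \<eta> + K1 * \<eta>))"
    proof -
      have d2: "norm \<Delta>^2 \<le> (K1 * \<eta>)^2" using \<Delta> by (intro power_mono) auto
      have vD: "norm v \<le> D" using lip(3) unfolding v_def \<mu>_def .
      have "nn - v = (y - x) - \<Delta>" unfolding nn_def v_def \<Delta>_def by simp
      then have "norm (nn - v) \<le> norm (y - x) + norm \<Delta>" by (simp only: norm_triangle_ineq4)
      then have nv: "norm (nn - v) \<le> K0 * \<eta> + K1 * \<eta>" using yx2 \<Delta> by linarith
      show ?thesis using d2 vD nv \<Delta> K K1 \<eta>(1) D
        by (intro add_mono mult_left_mono mult_mono) auto
    qed
    also have "\<dots> = K2 * \<eta>^2" unfolding K2_def by (simp add: algebra_simps power2_eq_square)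
    finally show "norm ((mat 1 - weingarten_tan M (nearest M x) (x - nearest M x)) *v (nearest M y - nearest M x)
          - tanproj M (nearest M x) *v (y - x)) \<le> K2 * (norm (y - x) / infdist x (cutlocus M))^2"
      unfolding W_def \<Delta>_def P_def v_def \<eta>_def \<delta>_def \<mu>_def \<mu>'_def .
  qed
qed

section \<open>Convergence in distribution\<close>

lemma convergent_subsequences_tendsto:
  fixes a :: "nat \<Rightarrow> real"
  assumes "\<And>r. strict_mono r \<Longrightarrow> \<exists>s. strict_mono (s :: nat \<Rightarrow> nat) \<and> (\<lambda>k. a (r (s k))) \<longlonglongrightarrow> l"
  shows "a \<longlonglongrightarrow> l"
proof (rule ccontr)
  assume "\<not> a \<longlonglongrightarrow> l"
  then obtain e where e: "e > 0" "\<not> (\<exists>N. \<forall>n\<ge>N. dist (a n) l < e)" unfolding lim_sequentially by blast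
  then have inf: "infinite {n. \<not> dist (a n) l < e}" unfolding infinite_nat_iff_unbounded_le by auto
  define r where "r = enumerate {n. \<not> dist (a n) l < e}"
  have r: "strict_mono r" unfolding r_def by (rule strict_mono_enumerate[OF inf])
  have far: "\<not> dist (a (r k)) l < e" for k
    using enumerate_in_set[OF inf, of k] unfolding r_def by simp
  obtain s where s: "(\<lambda>k. a (r (s k))) \<longlonglongrightarrow> l" using assms[OF r] by blast
  then obtain N where "\<forall>k\<ge>N. dist (a (r (s k))) l < e" using e(1) unfolding lim_sequentially by blast
  then show False using far by blast
qed

lemma conv_distr_continuous_map:
  fixes h :: "'c::metric_space \<Rightarrow> 'd::metric_space"
  assumes "conv_distr P X Q Y" "continuous_on UNIV h"
  shows "conv_distr P (\<lambda>n \<omega>. h (X n \<omega>)) Q (\<lambda>\<omega>. h (Y \<omega>))"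
  unfolding conv_distr_def
proof (intro allI impI, elim conjE)
  fix f :: "'d \<Rightarrow> real" assume f: "continuous_on UNIV f" "bounded (range f)"
  have "continuous_on UNIV (\<lambda>x. f (h x))"
    using continuous_on_compose2[OF f(1) assms(2)] by simp
  moreover have "bounded (range (\<lambda>x. f (h x)))" using f(2) by (rule bounded_subset) auto
  ultimately show "(\<lambda>n. \<integral>\<omega>. f (h (X n \<omega>)) \<partial>P) \<longlonglongrightarrow> (\<integral>\<omega>. f (h (Y \<omega>)) \<partial>Q)"
    using assms(1) unfolding conv_distr_def by blast
qed

lemma conv_distr_subseq:
  assumes "conv_distr P X Q Y" "strict_mono r"
  shows "conv_distr P (\<lambda>n. X (r n)) Q Y"
  using assms LIMSEQ_subseq_LIMSEQ[OF _ assms(2)] unfolding conv_distr_def by (force simp: o_def)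

lemma conv_prob_zero_subseq:
  assumes "conv_prob_zero P X" "strict_mono r"
  shows "conv_prob_zero P (\<lambda>n. X (r n))"
  using assms(1) eventually_subseq[OF assms(2)] unfolding conv_prob_zero_def by blast

lemma conv_prob_zero_add:
  assumes X: "conv_prob_zero P X" and Y: "conv_prob_zero P Y" and P: "prob_space P"
  shows "conv_prob_zero P (\<lambda>n \<omega>. X n \<omega> + Y n \<omega>)"
  unfolding conv_prob_zero_def
proof (intro allI impI)
  fix e d :: real assume e: "0 < e" and d: "0 < d"
  interpret prob_space P by (rule P)
  have "\<forall>\<^sub>F n in sequentially. \<exists>A\<in>sets P. {\<omega>\<in>space P. e/2 < norm (X n \<omega>)} \<subseteq> A \<and> measure P A < d/2"
    using X e d unfolding conv_prob_zero_def by (meson half_gt_zero)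
  moreover have "\<forall>\<^sub>F n in sequentially. \<exists>A\<in>sets P. {\<omega>\<in>space P. e/2 < norm (Y n \<omega>)} \<subseteq> A \<and> measure P A < d/2"
    using Y e d unfolding conv_prob_zero_def by (meson half_gt_zero)
  ultimately show "\<forall>\<^sub>F n in sequentially. \<exists>A\<in>sets P. {\<omega>\<in>space P. e < norm (X n \<omega> + Y n \<omega>)} \<subseteq> A \<and> measure P A < d"
  proof eventually_elim
    fix n
    assume "\<exists>A\<in>sets P. {\<omega>\<in>space P. e/2 < norm (X n \<omega>)} \<subseteq> A \<and> measure P A < d/2"
    then obtain A where A: "A \<in> sets P" "{\<omega>\<in>space P. e/2 < norm (X n \<omega>)} \<subseteq> A" "measure P A < d/2" by blast
    assume "\<exists>A\<in>sets P. {\<omega>\<in>space P. e/2 < norm (Y n \<omega>)} \<subseteq> A \<and> measure P A < d/2"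
    then obtain A' where A': "A' \<in> sets P" "{\<omega>\<in>space P. e/2 < norm (Y n \<omega>)} \<subseteq> A'" "measure P A' < d/2" by blast
    show "\<exists>A\<in>sets P. {\<omega>\<in>space P. e < norm (X n \<omega> + Y n \<omega>)} \<subseteq> A \<and> measure P A < d"
    proof (intro bexI[of _ "A \<union> A'"] conjI subsetI)
      fix \<omega> assume "\<omega> \<in> {\<omega>\<in>space P. e < norm (X n \<omega> + Y n \<omega>)}"
      then have w: "\<omega> \<in> space P" "e < norm (X n \<omega>) + norm (Y n \<omega>)"
        using norm_triangle_ineq[of "X n \<omega>" "Y n \<omega>"] by auto
      then have "e/2 < norm (X n \<omega>) \<or> e/2 < norm (Y n \<omega>)" by linarith
      then show "\<omega> \<in> A \<union> A'" using A(2) A'(2) w(1) by auto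
    next
      have "measure P (A \<union> A') \<le> measure P A + measure P A'" by (rule measure_Un_le[OF A(1) A'(1)])
      then show "measure P (A \<union> A') < d" using A A' by linarith
    qed (use A A' in auto)
  qed
qed

text \<open>Tightness for large n, which is what convergence of integrals yields directly and what
  statements about limits in n require.\<close>

definition eventually_tight :: "'a measure \<Rightarrow> (nat \<Rightarrow> 'a \<Rightarrow> 'c::real_normed_vector) \<Rightarrow> bool" where
  "eventually_tight P X \<longleftrightarrow> (\<forall>d>0. \<exists>R>0. \<forall>\<^sub>F n in sequentially. measure P {\<omega>\<in>space P. R < norm (X n \<omega>)} < d)"

lemma conv_distr_tight:
  fixes X :: "nat \<Rightarrow> 'a \<Rightarrow> 'c::{real_normed_vector, second_countable_topology}"
  assumes X: "conv_distr P X Q Y" and P: "prob_space P" and Q: "prob_space Q"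
    and mX: "\<And>n. X n \<in> borel_measurable P" and mY: "Y \<in> borel_measurable Q"
  shows "eventually_tight P X"
  unfolding eventually_tight_def
proof (intro allI impI)
  fix d :: real assume d: "d > 0"
  interpret P: prob_space P by (rule P)
  interpret Q: prob_space Q by (rule Q)
  \<comment> \<open>A continuous bounded test function between the indicators of norm z > R + 1 and
    norm z > R.\<close>
  define f where "f R z = min 1 (max 0 (norm z - R))" for R and z :: 'c
  have f01: "0 \<le> f R z" "f R z \<le> 1" for R z unfolding f_def by auto
  have fc: "continuous_on UNIV (f R)" for R unfolding f_def by (intro continuous_intros)
  have fb: "bounded (range (f R))" for R
    using f01 by (intro boundedI[of _ 1]) (auto simp: abs_of_nonneg)
  have fm: "f R \<in> borel_measurable borel" for R by (rule borel_measurable_continuous_onI[OF fc])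
  have "(\<lambda>k. \<integral>\<omega>. f (real k) (Y \<omega>) \<partial>Q) \<longlonglongrightarrow> (\<integral>\<omega>. 0 \<partial>Q)"
  proof (rule integral_dominated_convergence[where w="\<lambda>_. 1"])
    show "\<And>k. (\<lambda>\<omega>. f (real k) (Y \<omega>)) \<in> borel_measurable Q" by (rule measurable_compose[OF mY fm])
    show "AE \<omega> in Q. (\<lambda>k. f (real k) (Y \<omega>)) \<longlonglongrightarrow> 0"
    proof (rule AE_I2)
      fix \<omega>
      obtain N where N: "norm (Y \<omega>) \<le> real N" using real_arch_simple by blast
      have "\<forall>\<^sub>F k in sequentially. f (real k) (Y \<omega>) = 0"
        unfolding eventually_sequentially
      proof (intro exI[of _ N] allI impI)
        fix k assume "N \<le> k"
        then have "norm (Y \<omega>) \<le> real k" using N by linarith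
        then show "f (real k) (Y \<omega>) = 0" unfolding f_def by auto
      qed
      then show "(\<lambda>k. f (real k) (Y \<omega>)) \<longlonglongrightarrow> 0" by (rule tendsto_eventually)
    qed
    show "\<And>k. AE \<omega> in Q. norm (f (real k) (Y \<omega>)) \<le> 1" using f01 by (auto simp: abs_of_nonneg)
  qed auto
  then have "\<forall>\<^sub>F k in sequentially. (\<integral>\<omega>. f (real k) (Y \<omega>) \<partial>Q) < d"
    using d by (intro order_tendstoD) auto
  then obtain k where k: "(\<integral>\<omega>. f (real k) (Y \<omega>) \<partial>Q) < d" using eventually_happens'[OF sequentially_bot] by blast
  have "(\<lambda>n. \<integral>\<omega>. f (real k) (X n \<omega>) \<partial>P) \<longlonglongrightarrow> (\<integral>\<omega>. f (real k) (Y \<omega>) \<partial>Q)"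
    using X fc fb unfolding conv_distr_def by blast
  then have "\<forall>\<^sub>F n in sequentially. (\<integral>\<omega>. f (real k) (X n \<omega>) \<partial>P) < d"
    using k by (rule order_tendstoD)
  then have "\<forall>\<^sub>F n in sequentially. measure P {\<omega>\<in>space P. real k + 1 < norm (X n \<omega>)} < d"
  proof eventually_elim
    fix n assume n: "(\<integral>\<omega>. f (real k) (X n \<omega>) \<partial>P) < d"
    define A where "A = {\<omega>\<in>space P. real k + 1 < norm (X n \<omega>)}"
    have A: "A \<in> sets P" unfolding A_def using mX[of n] by measurable
    have "measure P A = (\<integral>\<omega>. indicat_real A \<omega> \<partial>P)" using A by simp
    also have "\<dots> \<le> (\<integral>\<omega>. f (real k) (X n \<omega>) \<partial>P)"
    proof (rule integral_mono)
      show "integrable P (indicat_real A)" using A by (intro integrable_real_indicator) (auto simp: P.emeasure_eq_measure)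
      show "integrable P (\<lambda>\<omega>. f (real k) (X n \<omega>))"
        using f01 measurable_compose[OF mX fm] by (intro P.integrable_const_bound[of _ 1]) (auto simp: abs_of_nonneg)
      fix \<omega> show "indicat_real A \<omega> \<le> f (real k) (X n \<omega>)"
        using f01[of "real k" "X n \<omega>"] by (cases "\<omega> \<in> A") (auto simp: A_def f_def)
    qed
    finally show "measure P {\<omega>\<in>space P. real k + 1 < norm (X n \<omega>)} < d" using n unfolding A_def by simp
  qed
  then show "\<exists>R>0. \<forall>\<^sub>F n in sequentially. measure P {\<omega>\<in>space P. R < norm (X n \<omega>)} < d"
    by (intro exI[of _ "real k + 1"]) auto
qed

text \<open>Off the event that \<open>Y n\<close> leaves a ball, the bound on \<open>X n\<close> is
  deterministic. This event is measurable and improbable, and serves as the covering set in the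
  outer probability.\<close>

lemma conv_prob_zero_tight:
  fixes Y :: "nat \<Rightarrow> 'a \<Rightarrow> 'c::{real_normed_vector, second_countable_topology}"
  assumes Y: "eventually_tight P Y" and mY: "\<And>n. Y n \<in> borel_measurable P"
    and X: "\<And>R e. R > 0 \<Longrightarrow> e > 0 \<Longrightarrow> \<forall>\<^sub>F n in sequentially. \<forall>\<omega>. norm (Y n \<omega>) \<le> R \<longrightarrow> norm (X n \<omega>) \<le> e"
  shows "conv_prob_zero P X"
  unfolding conv_prob_zero_def
proof (intro allI impI)
  fix e d :: real assume e: "0 < e" and d: "0 < d"
  obtain R where R: "R > 0" "\<forall>\<^sub>F n in sequentially. measure P {\<omega>\<in>space P. R < norm (Y n \<omega>)} < d"
    using Y d unfolding eventually_tight_def by blast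
  from R(2) X[OF R(1) e]
  show "\<forall>\<^sub>F n in sequentially. \<exists>A\<in>sets P. {\<omega>\<in>space P. e < norm (X n \<omega>)} \<subseteq> A \<and> measure P A < d"
  proof eventually_elim
    fix n assume a: "measure P {\<omega>\<in>space P. R < norm (Y n \<omega>)} < d" "\<forall>\<omega>. norm (Y n \<omega>) \<le> R \<longrightarrow> norm (X n \<omega>) \<le> e"
    have "{\<omega>\<in>space P. R < norm (Y n \<omega>)} \<in> sets P" using mY[of n] by measurable
    moreover have "{\<omega>\<in>space P. e < norm (X n \<omega>)} \<subseteq> {\<omega>\<in>space P. R < norm (Y n \<omega>)}"
      using a(2) by (auto simp: not_less[symmetric])
    ultimately show "\<exists>A\<in>sets P. {\<omega>\<in>space P. e < norm (X n \<omega>)} \<subseteq> A \<and> measure P A < d" using a(1) by blast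
  qed
qed

text \<open>Tightness confines the comparison to a compact ball, on which the bounded continuous
  test function is uniformly continuous.\<close>

lemma slutsky:
  fixes X Y :: "nat \<Rightarrow> 'a \<Rightarrow> 'c::euclidean_space"
  assumes P: "prob_space P" and Y: "conv_distr P Y Q V" and tight: "eventually_tight P Y"
    and mX: "\<And>n. X n \<in> borel_measurable P" and mY: "\<And>n. Y n \<in> borel_measurable P"
    and XY: "conv_prob_zero P (\<lambda>n \<omega>. X n \<omega> - Y n \<omega>)"
  shows "conv_distr P X Q V"
  unfolding conv_distr_def
proof (intro allI impI, elim conjE)
  fix f :: "'c \<Rightarrow> real" assume f: "continuous_on UNIV f" "bounded (range f)"
  interpret prob_space P by (rule P)
  obtain b where b: "b > 0" "\<And>x. \<bar>f x\<bar> \<le> b" using f(2) unfolding bounded_pos by auto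
  have fm: "f \<in> borel_measurable borel" by (rule borel_measurable_continuous_onI[OF f(1)])
  have int: "integrable P (\<lambda>\<omega>. f (X n \<omega>))" "integrable P (\<lambda>\<omega>. f (Y n \<omega>))" for n
    using b measurable_compose[OF mX fm] measurable_compose[OF mY fm]
    by (auto intro!: integrable_const_bound[of _ b])
  have "(\<lambda>n. (\<integral>\<omega>. f (X n \<omega>) \<partial>P) - (\<integral>\<omega>. f (Y n \<omega>) \<partial>P)) \<longlonglongrightarrow> 0"
    unfolding tendsto_iff
  proof (intro allI impI)
    fix e :: real assume e: "0 < e"
    \<comment> \<open>Two exceptional events of probability below \<open>d\<close> each cost at most
      2 b (2 d) = e/2, which leaves room for e/4 from uniform continuity.\<close>
    define d where "d = e / (8 * b)"
    have d: "d > 0" unfolding d_def using e b by simp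
    obtain R where R: "R > 0" "\<forall>\<^sub>F n in sequentially. measure P {\<omega>\<in>space P. R < norm (Y n \<omega>)} < d"
      using tight d unfolding eventually_tight_def by blast
    \<comment> \<open>The radius is R + 1 because \<open>X\<close> differs from \<open>Y\<close> by
      at most \<eta> \<le> 1 off the exceptional events.\<close>
    have "uniformly_continuous_on (cball 0 (R + 1)) f"
      by (intro compact_uniformly_continuous continuous_on_subset[OF f(1)]) auto
    then obtain \<eta>0 where \<eta>0: "\<eta>0 > 0" "\<And>u w. u \<in> cball 0 (R + 1) \<Longrightarrow> w \<in> cball 0 (R + 1) \<Longrightarrow> dist w u < \<eta>0 \<Longrightarrow> dist (f w) (f u) < e / 4"
      unfolding uniformly_continuous_on_def using zero_less_divide_iff[of e 4] e by (metis zero_less_numeral)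
    define \<eta> where "\<eta> = min 1 (\<eta>0 / 2)"
    have \<eta>: "\<eta> > 0" "\<eta> \<le> 1" "\<eta> < \<eta>0" unfolding \<eta>_def using \<eta>0 by auto
    have "\<forall>\<^sub>F n in sequentially. \<exists>A\<in>sets P. {\<omega>\<in>space P. \<eta> < norm (X n \<omega> - Y n \<omega>)} \<subseteq> A \<and> measure P A < d"
      using XY \<eta> d unfolding conv_prob_zero_def by blast
    with R(2) show "\<forall>\<^sub>F n in sequentially. dist ((\<integral>\<omega>. f (X n \<omega>) \<partial>P) - (\<integral>\<omega>. f (Y n \<omega>) \<partial>P)) 0 < e"
    proof eventually_elim
      fix n assume mR: "measure P {\<omega>\<in>space P. R < norm (Y n \<omega>)} < d"
      assume "\<exists>A\<in>sets P. {\<omega>\<in>space P. \<eta> < norm (X n \<omega> - Y n \<omega>)} \<subseteq> A \<and> measure P A < d"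
      then obtain A where A: "A \<in> sets P" "{\<omega>\<in>space P. \<eta> < norm (X n \<omega> - Y n \<omega>)} \<subseteq> A" "measure P A < d" by blast
      define S where "S = {\<omega>\<in>space P. R < norm (Y n \<omega>)}"
      have S: "S \<in> sets P" unfolding S_def using mY[of n] by measurable
      have AS: "A \<union> S \<in> sets P" using A S by auto
      have mAS: "measure P (A \<union> S) < 2 * d"
        using measure_Un_le[OF A(1) S] A(3) mR unfolding S_def by linarith
      have "norm ((\<integral>\<omega>. f (X n \<omega>) \<partial>P) - (\<integral>\<omega>. f (Y n \<omega>) \<partial>P)) = norm (\<integral>\<omega>. f (X n \<omega>) - f (Y n \<omega>) \<partial>P)"
        using int by simp
      also have "\<dots> \<le> (\<integral>\<omega>. norm (f (X n \<omega>) - f (Y n \<omega>)) \<partial>P)" by (rule integral_norm_bound)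
      also have "\<dots> \<le> (\<integral>\<omega>. e / 4 + 2 * b * indicat_real (A \<union> S) \<omega> \<partial>P)"
      proof (rule integral_mono)
        show "integrable P (\<lambda>\<omega>. norm (f (X n \<omega>) - f (Y n \<omega>)))" using int by auto
        show "integrable P (\<lambda>\<omega>. e / 4 + 2 * b * indicat_real (A \<union> S) \<omega>)"
          using AS by (intro Bochner_Integration.integrable_add integrable_mult_right integrable_real_indicator) (auto simp: emeasure_eq_measure)
        fix \<omega> assume w: "\<omega> \<in> space P"
        show "norm (f (X n \<omega>) - f (Y n \<omega>)) \<le> e / 4 + 2 * b * indicat_real (A \<union> S) \<omega>"
        proof (cases "\<omega> \<in> A \<union> S")
          case True
          then show ?thesis using b(2)[of "X n \<omega>"] b(2)[of "Y n \<omega>"] e by (simp add: abs_le_iff)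
        next
          case False
          then have 1: "norm (Y n \<omega>) \<le> R" "norm (X n \<omega> - Y n \<omega>) \<le> \<eta>" using A(2) w unfolding S_def by (auto simp: not_less[symmetric])
          then have "norm (X n \<omega>) \<le> R + 1" using \<eta>(2) norm_triangle_ineq2[of "X n \<omega>" "Y n \<omega>"] by linarith
          then have "dist (f (X n \<omega>)) (f (Y n \<omega>)) < e / 4"
            using 1 \<eta>(3) by (intro \<eta>0(2)) (auto simp: dist_norm)
          then show ?thesis using False by (simp add: dist_norm)
        qed
      qed
      also have "\<dots> = e / 4 + 2 * b * measure P (A \<union> S)"
        using AS by (subst Bochner_Integration.integral_add) (auto simp: prob_space emeasure_eq_measure)
      also have "\<dots> < e"
      proof -
        have "2 * b * measure P (A \<union> S) \<le> 2 * b * (2 * d)" using mAS b(1) by (intro mult_left_mono) auto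
        also have "\<dots> = e / 2" unfolding d_def using b(1) by (simp add: field_simps)
        finally show ?thesis using e by linarith
      qed
      finally show "dist ((\<integral>\<omega>. f (X n \<omega>) \<partial>P) - (\<integral>\<omega>. f (Y n \<omega>) \<partial>P)) 0 < e" by simp
    qed
  qed
  moreover have "(\<lambda>n. \<integral>\<omega>. f (Y n \<omega>) \<partial>P) \<longlonglongrightarrow> (\<integral>\<omega>. f (V \<omega>) \<partial>Q)" using Y f unfolding conv_distr_def by blast
  ultimately show "(\<lambda>n. \<integral>\<omega>. f (X n \<omega>) \<partial>P) \<longlonglongrightarrow> (\<integral>\<omega>. f (V \<omega>) \<partial>Q)"
    using tendsto_add by fastforce
qed

lemma measurable_matrix_vector:
  fixes A :: "real^'n^'m"
  assumes "X \<in> borel_measurable P"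
  shows "(\<lambda>\<omega>. A *v X \<omega>) \<in> borel_measurable P"
  by (rule measurable_compose[OF assms borel_measurable_continuous_onI])
     (intro linear_continuous_on matrix_vector_mul_bounded_linear)

lemma eventually_tight_matrix:
  fixes A :: "real^'n^'m" and Y :: "nat \<Rightarrow> 'a \<Rightarrow> real^'n"
  assumes P: "prob_space P" and Y: "eventually_tight P Y" and mY: "\<And>n. Y n \<in> borel_measurable P"
  shows "eventually_tight P (\<lambda>n \<omega>. A *v Y n \<omega>)"
  unfolding eventually_tight_def
proof (intro allI impI)
  interpret prob_space P by (rule P)
  fix d :: real assume "d > 0"
  then obtain R where R: "R > 0" "\<forall>\<^sub>F n in sequentially. measure P {\<omega>\<in>space P. R < norm (Y n \<omega>)} < d"
    using Y unfolding eventually_tight_def by blast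
  have "\<forall>\<^sub>F n in sequentially. measure P {\<omega>\<in>space P. norm A * R + 1 < norm (A *v Y n \<omega>)} < d"
    using R(2)
  proof eventually_elim
    fix n assume n: "measure P {\<omega>\<in>space P. R < norm (Y n \<omega>)} < d"
    have "{\<omega>\<in>space P. norm A * R + 1 < norm (A *v Y n \<omega>)} \<subseteq> {\<omega>\<in>space P. R < norm (Y n \<omega>)}"
    proof safe
      fix \<omega> assume "norm A * R + 1 < norm (A *v Y n \<omega>)"
      also have "\<dots> \<le> norm A * norm (Y n \<omega>)" by (rule norm_matrix_vector_mult_le)
      finally show "R < norm (Y n \<omega>)" using mult_left_mono[of "norm (Y n \<omega>)" R "norm A"] by (cases "R < norm (Y n \<omega>)") auto
    qed
    moreover have "{\<omega>\<in>space P. R < norm (Y n \<omega>)} \<in> sets P" using mY[of n] by measurable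
    ultimately have "measure P {\<omega>\<in>space P. norm A * R + 1 < norm (A *v Y n \<omega>)} \<le> measure P {\<omega>\<in>space P. R < norm (Y n \<omega>)}"
      by (rule finite_measure_mono)
    then show "measure P {\<omega>\<in>space P. norm A * R + 1 < norm (A *v Y n \<omega>)} < d" using n by linarith
  qed
  moreover have "norm A * R + 1 > 0" using R(1) by (simp add: add_nonneg_pos)
  ultimately show "\<exists>R>0. \<forall>\<^sub>F n in sequentially. measure P {\<omega>\<in>space P. R < norm (A *v Y n \<omega>)} < d" by blast
qed

text \<open>Tightness makes (O' n - W) Y n vanish in probability, so W Y n may replace O' n Y n; the
  fixed matrix \<open>W\<close> acts as a continuous map on the laws.\<close>

lemma conv_distr_matrix_limit:
  fixes O' :: "nat \<Rightarrow> real^'n^'m" and Y :: "nat \<Rightarrow> 'a \<Rightarrow> real^'n"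
  assumes P: "prob_space P" and Q: "prob_space Q" and Y: "conv_distr P Y Q Z"
    and mY: "\<And>n. Y n \<in> borel_measurable P" and mZ: "Z \<in> borel_measurable Q"
    and mX: "\<And>n. X n \<in> borel_measurable P"
    and X: "conv_prob_zero P (\<lambda>n \<omega>. X n \<omega> - O' n *v Y n \<omega>)" and O: "O' \<longlonglongrightarrow> W"
  shows "conv_distr P X Q (\<lambda>\<omega>. W *v Z \<omega>)"
proof (rule slutsky[OF P _ _ mX, where Y="\<lambda>n \<omega>. W *v Y n \<omega>"])
  have tight: "eventually_tight P Y" by (rule conv_distr_tight[OF Y P Q mY mZ])
  show "conv_distr P (\<lambda>n \<omega>. W *v Y n \<omega>) Q (\<lambda>\<omega>. W *v Z \<omega>)"
    by (intro conv_distr_continuous_map[OF Y] linear_continuous_on matrix_vector_mul_bounded_linear)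
  show "eventually_tight P (\<lambda>n \<omega>. W *v Y n \<omega>)" by (rule eventually_tight_matrix[OF P tight mY])
  show "(\<lambda>\<omega>. W *v Y n \<omega>) \<in> borel_measurable P" for n by (rule measurable_matrix_vector[OF mY])
  have "conv_prob_zero P (\<lambda>n \<omega>. O' n *v Y n \<omega> - W *v Y n \<omega>)"
  proof (rule conv_prob_zero_tight[OF tight mY])
    fix R e :: real assume R: "R > 0" and e: "e > 0"
    have "\<forall>\<^sub>F n in sequentially. dist (O' n) W < e / R" using O R e by (intro tendstoD) auto
    then show "\<forall>\<^sub>F n in sequentially. \<forall>\<omega>. norm (Y n \<omega>) \<le> R \<longrightarrow> norm (O' n *v Y n \<omega> - W *v Y n \<omega>) \<le> e"
    proof eventually_elim
      case (elim n)
      show ?case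
      proof (intro allI impI)
        fix \<omega> assume y: "norm (Y n \<omega>) \<le> R"
        have "norm (O' n *v Y n \<omega> - W *v Y n \<omega>) = norm ((O' n - W) *v Y n \<omega>)" by (simp add: matrix_vector_mult_diff_rdistrib)
        also have "\<dots> \<le> norm (O' n - W) * norm (Y n \<omega>)" by (rule norm_matrix_vector_mult_le)
        also have "\<dots> \<le> (e / R) * R" using elim y R e by (intro mult_mono) (auto simp: dist_norm)
        finally show "norm (O' n *v Y n \<omega> - W *v Y n \<omega>) \<le> e" using R by simp
      qed
    qed
  qed
  from conv_prob_zero_add[OF X this P]
  show "conv_prob_zero P (\<lambda>n \<omega>. X n \<omega> - W *v Y n \<omega>)" by simp
qed

section \<open>Spherical laws under isometries and projections\<close>

lemma isometry_extends_to_orthogonal: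
  fixes f :: "real^'n \<Rightarrow> real^'n"
  assumes S: "subspace S" and f: "linear f" and iso: "\<And>x. x \<in> S \<Longrightarrow> norm (f x) = norm x"
  obtains H :: "real^'n^'n" where "orthogonal_matrix H" "\<And>x. x \<in> S \<Longrightarrow> H *v x = f x"
proof -
  define T where "T = f ` S"
  have T: "subspace T" unfolding T_def by (rule linear_subspace_image[OF f S])
  have inj: "inj_on f S"
  proof (rule inj_onI)
    fix x y assume xy: "x \<in> S" "y \<in> S" "f x = f y"
    then have "norm (x - y) = norm (f (x - y))" using iso S by (simp add: subspace_diff)
    also have "\<dots> = 0" using xy(3) linear_diff[OF f] by simp
    finally show "x = y" by simp
  qed
  have dT: "dim T = dim S" unfolding T_def
    by (rule dim_image_eq[OF f]) (use inj S in \<open>simp add: span_eq_iff[THEN iffD2]\<close>)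
  define S' where "S' = {y. \<forall>x\<in>S. orthogonal x y}"
  define T' where "T' = {y. \<forall>x\<in>T. orthogonal x y}"
  have sub': "subspace S'" "subspace T'" unfolding S'_def T'_def by (simp_all add: subspace_orthogonal_to_vectors)
  have "dim S' + dim S = dim (UNIV :: (real^'n) set)" "dim T' + dim T = dim (UNIV :: (real^'n) set)"
    using dim_subspace_orthogonal_to_vectors[OF S subspace_UNIV] dim_subspace_orthogonal_to_vectors[OF T subspace_UNIV]
    unfolding S'_def T'_def by auto
  then have "dim S' \<le> dim T'" using dT by linarith
  then obtain g where g: "linear g" "g \<in> S' \<rightarrow> T'" "\<And>x. x \<in> S' \<Longrightarrow> norm (g x) = norm x"
    using isometry_subset_subspace[OF sub'] by blast
  have "\<exists>p. p \<in> S \<and> x - p \<in> S'" for x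
  proof -
    obtain y z where "y \<in> span S" "\<And>w. w \<in> span S \<Longrightarrow> orthogonal z w" "x = y + z"
      using orthogonal_subspace_decomp_exists[of S x] by blast
    then show ?thesis using span_eq_iff[THEN iffD2, OF S] unfolding S'_def
      by (intro exI[of _ y]) (auto simp: orthogonal_commute)
  qed
  then obtain p where p: "\<And>x. p x \<in> S" "\<And>x. x - p x \<in> S'" by metis
  have ortho: "x \<bullet> y = 0" if "x \<in> S" "y \<in> S'" for x y using that unfolding S'_def orthogonal_def by blast
  have p_eq: "p x = y" if "y \<in> S" "x - y \<in> S'" for x y
  proof -
    have "p x - y \<in> S" using p(1) that S by (simp add: subspace_diff)
    moreover have "(x - y) - (x - p x) \<in> S'" using p(2) that sub'(1) by (rule_tac subspace_diff) auto
    ultimately have "(p x - y) \<bullet> (p x - y) = 0" using ortho by simp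
    then show ?thesis by simp
  qed
  have lp: "linear p"
  proof (rule linearI)
    fix x y show "p (x + y) = p x + p y"
    proof (rule p_eq)
      have "x + y - (p x + p y) = (x - p x) + (y - p y)" by simp
      then show "x + y - (p x + p y) \<in> S'" using subspace_add[OF sub'(1) p(2)[of x] p(2)[of y]] by (simp only:)
    qed (use p S in \<open>simp add: subspace_add\<close>)
  next
    fix c x show "p (c *\<^sub>R x) = c *\<^sub>R p x"
    proof (rule p_eq)
      have "c *\<^sub>R x - c *\<^sub>R p x = c *\<^sub>R (x - p x)" by (simp add: scaleR_diff_right)
      then show "c *\<^sub>R x - c *\<^sub>R p x \<in> S'" using subspace_scale[OF sub'(1) p(2)[of x]] by simp
    qed (use p S in \<open>simp add: subspace_scale\<close>)
  qed
  \<comment> \<open>\<open>f\<close> on \<open>S\<close> is glued to an isometry of the orthogonal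
    complements, which have equal dimension because \<open>f\<close> is injective on
    \<open>S\<close>. The images of the two parts are orthogonal, so Pythagoras applies.\<close>
  define h where "h x = f (p x) + g (x - p x)" for x
  have lh: "linear h" unfolding h_def
    using linear_compose[OF lp f] linear_compose[OF linear_compose_sub[OF linear_ident lp] g(1)]
    by (intro linear_compose_add) (auto simp: o_def)
  have nh: "norm (h x) = norm x" for x
  proof -
    have "f (p x) \<bullet> g (x - p x) = 0"
      using g(2) p unfolding T'_def T_def orthogonal_def by blast
    then have "(norm (h x))^2 = (norm (f (p x)))^2 + (norm (g (x - p x)))^2"
      unfolding h_def power2_norm_eq_inner by (simp add: inner_add_left inner_add_right inner_commute)
    also have "\<dots> = (norm (p x))^2 + (norm (x - p x))^2" using iso[OF p(1)] g(3)[OF p(2)] by simp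
    also have "\<dots> = (norm x)^2"
      using ortho[OF p(1)[of x] p(2)[of x]]
      by (simp add: power2_norm_eq_inner inner_diff_left inner_diff_right inner_commute)
    finally show ?thesis by simp
  qed
  have "orthogonal_transformation h" unfolding orthogonal_transformation using lh nh by blast
  then have "orthogonal_matrix (matrix h)" using orthogonal_transformation_matrix by blast
  moreover have "matrix h *v x = f x" if "x \<in> S" for x
  proof -
    have "p x = x" using that sub'(1) by (intro p_eq) (auto simp: subspace_0)
    then have "h x = f x" unfolding h_def using linear_0[OF g(1)] by simp
    then show ?thesis using lh by (simp add: matrix_works)
  qed
  ultimately show thesis using that by blast
qed

lemma spherical_integral:
  fixes f :: "real^'n \<Rightarrow> real"
  assumes Z: "spherical Q Z" "Z \<in> borel_measurable Q" and H: "orthogonal_matrix H" and f: "f \<in> borel_measurable borel"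
  shows "(\<integral>\<omega>. f (H *v Z \<omega>) \<partial>Q) = (\<integral>\<omega>. f (Z \<omega>) \<partial>Q)"
proof -
  have "(\<integral>\<omega>. f (H *v Z \<omega>) \<partial>Q) = (\<integral>z. f z \<partial>distr Q borel (\<lambda>\<omega>. H *v Z \<omega>))"
    using f by (subst integral_distr[OF measurable_matrix_vector[OF Z(2)]]) auto
  also have "\<dots> = (\<integral>z. f z \<partial>distr Q borel Z)" using Z(1) H unfolding spherical_def by simp
  also have "\<dots> = (\<integral>\<omega>. f (Z \<omega>) \<partial>Q)" using f by (subst integral_distr[OF Z(2)]) auto
  finally show ?thesis .
qed

text \<open>The transpose of W is isometric on the range of the orthogonal projection P and vanishes on its complement.\<close>
lemma projection_root_factor:
  fixes W P :: "real^'n^'n"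
  assumes W: "W ** transpose W = P" and idem: "P ** P = P"
  obtains H where "orthogonal_matrix H" "W = P ** H"
proof -
  define S where "S = range ((*v) P)"
  have S: "subspace S" unfolding S_def by (intro linear_subspace_image matrix_vector_mul_linear) simp
  have n: "(norm (transpose W *v x))^2 = x \<bullet> (P *v x)" for x
    unfolding W[symmetric] power2_norm_eq_inner by (simp add: dot_lmul_matrix matrix_vector_mul_assoc[symmetric])
  have Pid: "P *v x = x" if "x \<in> S" for x
    using that idem unfolding S_def by (auto simp: matrix_vector_mul_assoc)
  have iso: "norm (transpose W *v x) = norm x" if "x \<in> S" for x
  proof -
    have "(norm (transpose W *v x))^2 = (norm x)^2" using n[of x] Pid[OF that] by (simp add: power2_norm_eq_inner)
    then show ?thesis by simp
  qed
  have sym: "transpose P = P" unfolding W[symmetric] by (simp add: matrix_transpose_mul)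
  obtain H where H: "orthogonal_matrix H" "\<And>x. x \<in> S \<Longrightarrow> H *v x = transpose W *v x"
    using isometry_extends_to_orthogonal[OF S matrix_vector_mul_linear iso] by blast
  have "transpose W *v x = (H ** P) *v x" for x
  proof -
    have "P *v (x - P *v x) = 0" using idem by (simp add: matrix_vector_mult_diff_distrib matrix_vector_mul_assoc)
    then have "transpose W *v (x - P *v x) = 0" using n[of "x - P *v x"] by simp
    then have "transpose W *v x = transpose W *v (P *v x)" by (simp add: matrix_vector_mult_diff_distrib)
    also have "\<dots> = H *v (P *v x)" using H(2)[of "P *v x"] unfolding S_def by simp
    finally show ?thesis by (simp add: matrix_vector_mul_assoc)
  qed
  then have "transpose W = H ** P" by (simp add: matrix_eq)
  then have "transpose (transpose W) = transpose (H ** P)" by simp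
  then have "W = P ** transpose H" by (simp add: matrix_transpose_mul sym)
  moreover have "orthogonal_matrix (transpose H)" using H(1) by (simp add: orthogonal_matrix_transpose)
  ultimately show thesis using that by blast
qed

lemma spherical_projection_root:
  fixes W P :: "real^'n^'n" and f :: "real^'n \<Rightarrow> real"
  assumes Z: "spherical Q Z" "Z \<in> borel_measurable Q" and W: "W ** transpose W = P" "P ** P = P" and f: "continuous_on UNIV f"
  shows "(\<integral>\<omega>. f (W *v Z \<omega>) \<partial>Q) = (\<integral>\<omega>. f (P *v Z \<omega>) \<partial>Q)"
proof -
  obtain H where H: "orthogonal_matrix H" "W = P ** H" using projection_root_factor[OF W] .
  have "(\<lambda>z. f (P *v z)) \<in> borel_measurable borel"
    by (intro borel_measurable_continuous_onI continuous_on_compose2[OF f] linear_continuous_on matrix_vector_mul_bounded_linear) auto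
  from spherical_integral[OF Z H(1) this] show ?thesis unfolding H(2) by (simp add: matrix_vector_mul_assoc)
qed

text \<open>An orthogonal \<open>V\<close> carries \<open>T\<close> onto the span of the axes in
  \<open>I\<close>, and sphericity absorbs \<open>V\<close>. Thus any set \<open>I\<close> of
  \<open>dim T\<close> coordinates can stand for the first m.\<close>

lemma spherical_projection_norm:
  fixes P :: "real^'n^'n" and f :: "real \<Rightarrow> real" and I :: "'n set"
  assumes Z: "spherical Q Z" "Z \<in> borel_measurable Q"
    and P: "\<And>x. P *v x \<in> T" "\<And>x w. w \<in> T \<Longrightarrow> (x - P *v x) \<bullet> w = 0" and T: "subspace T" "dim T = card I"
    and f: "continuous_on UNIV f"
  shows "(\<integral>\<omega>. f ((norm (P *v Z \<omega>))^2) \<partial>Q) = (\<integral>\<omega>. f (\<Sum>i\<in>I. (Z \<omega> $ i)^2) \<partial>Q)"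
proof -
  define E where "E = (\<lambda>i. axis i 1 :: real^'n) ` I"
  have EB: "E \<subseteq> Basis" unfolding E_def by auto
  have "inj_on (\<lambda>i. axis i 1 :: real^'n) I" by (auto simp: inj_on_def axis_eq_axis)
  then have cE: "card E = card I" unfolding E_def by (rule card_image)
  have indE: "independent E" using independent_mono[OF independent_Basis EB] .
  then have dE: "dim (span E) = card I" using cE dim_span_eq_card_independent by metis
  obtain g where g: "linear g" "g \<in> T \<rightarrow> span E" "\<And>x. x \<in> T \<Longrightarrow> norm (g x) = norm x"
    using isometry_subset_subspace[OF T(1) subspace_span, of E] T(2) dE by auto
  obtain V where V: "orthogonal_matrix V" "\<And>x. x \<in> T \<Longrightarrow> V *v x = g x"
    using isometry_extends_to_orthogonal[OF T(1) g(1,3)] by blast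
  have Vi: "(V *v x) \<bullet> (V *v y) = x \<bullet> y" for x y
    using V(1) orthogonal_transformation_matrix[of "(*v) V"] unfolding orthogonal_transformation_def by simp
  have injV: "inj ((*v) V)"
    by (rule injI) (metis Vi eq_iff_diff_eq_0 inner_eq_zero_iff matrix_vector_mult_diff_distrib)
  have VT: "(*v) V ` T = span E"
  proof (rule subspace_dim_equal)
    show "subspace ((*v) V ` T)" by (intro linear_subspace_image T matrix_vector_mul_linear)
    show "(*v) V ` T \<subseteq> span E" using V(2) g(2) by auto
    have "dim ((*v) V ` T) = dim T" by (intro dim_image_eq matrix_vector_mul_linear inj_on_subset[OF injV]) auto
    then show "dim (span E) \<le> dim ((*v) V ` T)" using T(2) dE by simp
  qed auto
  have key: "(norm (P *v z))^2 = (\<Sum>i\<in>I. ((V *v z) $ i)^2)" for z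
  proof -
    define y where "y = V *v (P *v z)"
    have yE: "y \<in> span E" unfolding y_def using VT P(1) by blast
    have y1: "y $ i = (V *v z) $ i" if "i \<in> I" for i
    proof -
      have "axis i 1 \<in> span E" using that unfolding E_def by (intro span_base) auto
      then obtain w where w: "w \<in> T" "axis i 1 = V *v w" using VT by auto
      have "(V *v (z - P *v z)) \<bullet> axis i 1 = 0" unfolding w(2) Vi by (rule P(2)[OF w(1)])
      then show ?thesis unfolding y_def by (simp add: matrix_vector_mult_diff_distrib inner_axis)
    qed
    have y0: "y $ i = 0" if "i \<notin> I" for i
    proof -
      have "span E \<subseteq> {x. x $ i = 0}"
      proof (rule span_minimal)
        show "E \<subseteq> {x. x $ i = 0}" using that unfolding E_def by (auto simp: axis_def)
        show "subspace {x :: real^'n. x $ i = 0}" by (auto simp: subspace_def)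
      qed
      then have "y \<in> {x. x $ i = 0}" using yE by blast
      then show ?thesis by simp
    qed
    have "(norm (P *v z))^2 = y \<bullet> y" unfolding y_def Vi by (simp add: power2_norm_eq_inner)
    also have "\<dots> = (\<Sum>i\<in>UNIV. (y $ i)^2)" by (simp add: inner_vec_def power2_eq_square)
    also have "\<dots> = (\<Sum>i\<in>I. (y $ i)^2)" by (rule sum.mono_neutral_right) (auto simp: y0)
    also have "\<dots> = (\<Sum>i\<in>I. ((V *v z) $ i)^2)" by (rule sum.cong) (auto simp: y1)
    finally show ?thesis .
  qed
  have "(\<lambda>z. f (\<Sum>i\<in>I. (z $ i)^2)) \<in> borel_measurable borel"
    by (intro borel_measurable_continuous_onI continuous_on_compose2[OF f] continuous_intros) auto
  from spherical_integral[OF Z V(1) this] show ?thesis unfolding key .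
qed

section \<open>The limit theorem\<close>

text \<open>\<open>norm\<close> on matrices is the Euclidean norm of the entries, not the operator
  norm; the crude dimension factors do no harm where only convergence is deduced.\<close>

lemma norm_le_of_apply_axis:
  fixes A :: "real^'n^'m"
  assumes "\<And>j. norm (A *v axis j 1) \<le> c"
  shows "norm A \<le> real CARD('m) * (real CARD('n) * c)"
proof -
  have "\<bar>A $ i $ j\<bar> \<le> c" for i j
  proof -
    have "A $ i $ j = (A *v axis j 1) $ i"
      by (simp add: matrix_vector_mult_def axis_def if_distrib cong: if_cong)
    then show ?thesis using component_le_norm_cart[of "A *v axis j 1" i] assms[of j] by linarith
  qed
  then have "(\<Sum>i\<in>UNIV. \<Sum>j\<in>UNIV. \<bar>A $ i $ j\<bar>) \<le> (\<Sum>i\<in>(UNIV::'m set). \<Sum>j\<in>(UNIV::'n set). c)"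
    by (intro sum_mono)
  then show ?thesis using norm_matrix_le_l1[of A] by simp
qed

text \<open>P0 - P1 = P0 (1 - P1) - (1 - P0) P1. The first term projects vectors normal at one point
  onto the tangent space at the other, and the second is dual to such a term. Both are O(|\<mu>1 -
  \<mu>0|) by the second tangential estimate, used in both directions.\<close>

lemma tanproj_tendsto:
  fixes M :: "(real^'n) set"
  assumes M: "compact M" "submanifold m M" and \<mu>: "\<And>n. \<mu> n \<in> M" "\<mu>0 \<in> M" "\<mu> \<longlonglongrightarrow> \<mu>0"
  shows "(\<lambda>n. tanproj M (\<mu> n)) \<longlonglongrightarrow> tanproj M \<mu>0"
proof -
  obtain \<rho> K where \<rho>: "\<rho> > 0" and K: "K \<ge> 0" and
    est: "\<And>\<mu> \<mu>'. \<mu> \<in> M \<Longrightarrow> \<mu>' \<in> M \<Longrightarrow> norm (\<mu>' - \<mu>) < \<rho> \<Longrightarrow> tangential_estimates M K \<mu> \<mu>'"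
    using uniform_tangential_estimates[OF M] by metis
  define P0 where "P0 = tanproj M \<mu>0"
  note T0 = subspace_tangent_space[OF M(2) \<mu>(2)]
  have bound: "norm (P0 *v x - tanproj M \<mu>1 *v x) \<le> 2 * K * norm (\<mu>1 - \<mu>0) * norm x"
    if \<mu>1: "\<mu>1 \<in> M" "norm (\<mu>1 - \<mu>0) < \<rho>" for \<mu>1 x
  proof -
    define P1 where "P1 = tanproj M \<mu>1"
    note T1 = subspace_tangent_space[OF M(2) \<mu>1(1)]
    have e0: "\<And>z. z \<in> normal_space M \<mu>1 \<Longrightarrow> norm (P0 *v z) \<le> K * (norm (\<mu>1 - \<mu>0) * norm z)"
      using est[OF \<mu>(2) \<mu>1(1)] \<mu>1(2) unfolding tangential_estimates_def P0_def by blast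
    have e1: "\<And>z. z \<in> normal_space M \<mu>0 \<Longrightarrow> norm (P1 *v z) \<le> K * (norm (\<mu>1 - \<mu>0) * norm z)"
      using est[OF \<mu>1(1) \<mu>(2)] \<mu>1(2) unfolding tangential_estimates_def P1_def by (simp add: norm_minus_commute)
    have "norm (P0 *v (x - P1 *v x)) \<le> K * (norm (\<mu>1 - \<mu>0) * norm (x - P1 *v x))"
      unfolding P1_def by (rule e0[OF tanproj_normal[OF T1]])
    also have "\<dots> \<le> K * (norm (\<mu>1 - \<mu>0) * norm x)"
      using norm_diff_tanproj_le[OF T1 subspace_0[OF T1], of x] K unfolding P1_def
      by (intro mult_left_mono) auto
    finally have a: "norm (P0 *v (x - P1 *v x)) \<le> K * (norm (\<mu>1 - \<mu>0) * norm x)" .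
    \<comment> \<open>This part is handled by duality: \<open>w\<close> is normal at \<mu>0 and w
      \<bullet> w = (P1 w) \<bullet> x, to which the estimate with exchanged points applies.\<close>
    define w where "w = P1 *v x - P0 *v (P1 *v x)"
    have wN: "w \<in> normal_space M \<mu>0" unfolding w_def P0_def by (rule tanproj_normal[OF T0])
    have "w \<bullet> (P0 *v (P1 *v x)) = 0"
      using wN tanproj_in[OF T0] unfolding normal_space_def P0_def by blast
    then have "w \<bullet> w = w \<bullet> (P1 *v x)" unfolding w_def by (simp add: inner_diff_right)
    also have "\<dots> = (P1 *v w) \<bullet> x" unfolding P1_def by (rule tanproj_inner[OF T1, symmetric])
    also have "\<dots> \<le> norm (P1 *v w) * norm x" by (rule norm_cauchy_schwarz)
    also have "\<dots> \<le> (K * (norm (\<mu>1 - \<mu>0) * norm w)) * norm x" by (intro mult_right_mono e1[OF wN]) auto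
    finally have "norm w * norm w \<le> (K * (norm (\<mu>1 - \<mu>0) * norm x)) * norm w"
      by (simp add: power2_norm_eq_inner[symmetric] power2_eq_square mult_ac)
    then have b: "norm w \<le> K * (norm (\<mu>1 - \<mu>0) * norm x)" using K by (cases "norm w = 0") auto
    have "P0 *v x - P1 *v x = P0 *v (x - P1 *v x) - w" unfolding w_def by (simp add: matrix_vector_mult_diff_distrib)
    then have "norm (P0 *v x - P1 *v x) \<le> norm (P0 *v (x - P1 *v x)) + norm w" by (simp only: norm_triangle_ineq4)
    then show ?thesis using a b unfolding P1_def by (simp add: mult_ac)
  qed
  define c where "c = real CARD('n) * real CARD('n) * (2 * K)"
  have "norm (tanproj M \<mu>1 - P0) \<le> c * norm (\<mu>1 - \<mu>0)" if \<mu>1: "\<mu>1 \<in> M" "norm (\<mu>1 - \<mu>0) < \<rho>" for \<mu>1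
  proof -
    have "norm ((P0 - tanproj M \<mu>1) *v axis j 1) \<le> 2 * K * norm (\<mu>1 - \<mu>0)" for j
      using bound[OF \<mu>1, of "axis j 1"] by (simp add: matrix_vector_mult_diff_rdistrib)
    from norm_le_of_apply_axis[OF this] show ?thesis unfolding c_def by (simp add: norm_minus_commute mult_ac)
  qed
  moreover have "\<forall>\<^sub>F n in sequentially. norm (\<mu> n - \<mu>0) < \<rho>"
    using tendstoD[OF \<mu>(3) \<rho>] by (simp add: dist_norm)
  ultimately have "\<forall>\<^sub>F n in sequentially. norm (tanproj M (\<mu> n) - P0) \<le> c * norm (\<mu> n - \<mu>0)"
    using \<mu>(1) by (simp add: eventually_mono)
  moreover have "(\<lambda>n. c * norm (\<mu> n - \<mu>0)) \<longlonglongrightarrow> c * norm (\<mu>0 - \<mu>0)" by (intro tendsto_intros \<mu>(3))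
  then have "(\<lambda>n. c * norm (\<mu> n - \<mu>0)) \<longlonglongrightarrow> 0" by simp
  ultimately have "(\<lambda>n. tanproj M (\<mu> n) - P0) \<longlonglongrightarrow> 0" by (rule Lim_null_comparison)
  then show ?thesis unfolding P0_def by (rule LIM_zero_cancel)
qed

lemma tanproj_singleton:
  assumes "submanifold m {p}"
  shows "tanproj {p} p *v x = 0"
proof -
  have "tanproj {p} p *v x \<in> tangent_space {p} p"
    by (rule tanproj_in[OF subspace_tangent_space[OF assms]]) simp
  then obtain \<gamma> e where "0 < e" "\<forall>t\<in>{-e<..<e}. \<gamma> t \<in> {p}" and d: "(\<gamma> has_vector_derivative (tanproj {p} p *v x)) (at 0)"
    unfolding tangent_space_def by blast
  then have g: "0 < e" "\<And>t. t\<in>{-e<..<e} \<Longrightarrow> \<gamma> t = p" by blast+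
  have "((\<lambda>t. p) has_vector_derivative 0) (at 0)" by simp
  then have "(\<gamma> has_vector_derivative 0) (at 0)"
    by (rule has_vector_derivative_transform_within_open[where S="{-e<..<e}"]) (use g in auto)
  from vector_derivative_unique_at[OF d this] show ?thesis .
qed

lemma weingarten_symmetric:
  assumes "submanifold m M" "\<mu> \<in> M" "v \<in> normal_space M \<mu>"
  shows "x \<bullet> (weingarten_tan M \<mu> v *v y) = y \<bullet> (weingarten_tan M \<mu> v *v x)"
proof -
  obtain U V \<phi> \<psi> L A B C where s: "straightening M \<mu> U V \<phi> \<psi> L A B C"
    using submanifold_straightening[OF assms(1,2)] by metis
  show ?thesis by (rule straightening.weingarten_tan_symmetric[OF s assms(2) straightening.p_U[OF s] assms(3)])
qed

text \<open>The transpose of \<open>W\<close> does not increase norms, which bounds every entry of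
  \<open>W\<close> by 1. Boundedness is what yields convergent subsequences of the matrices in the
  limit theorem.\<close>

lemma norm_projection_root_le:
  fixes W P :: "real^'n^'n"
  assumes W: "W ** transpose W = P" and P: "\<And>x. x \<bullet> (P *v x) \<le> (norm x)^2"
  shows "norm W \<le> real CARD('n) * real CARD('n)"
proof -
  have n: "norm (transpose W *v x) \<le> norm x" for x
  proof -
    have "(norm (transpose W *v x))^2 = x \<bullet> (P *v x)"
      unfolding W[symmetric] power2_norm_eq_inner by (simp add: dot_lmul_matrix matrix_vector_mul_assoc[symmetric])
    then have "(norm (transpose W *v x))^2 \<le> (norm x)^2" using P by simp
    then show ?thesis by (rule power2_le_imp_le) simp
  qed
  have "\<bar>W $ i $ j\<bar> \<le> 1" for i j
  proof -
    have "W $ i $ j = (transpose W *v axis i 1) $ j"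
      by (simp add: matrix_vector_mult_def axis_def if_distrib transpose_def cong: if_cong)
    then show ?thesis
      using component_le_norm_cart[of "transpose W *v axis i 1" j] n[of "axis i 1"] by simp
  qed
  then have "(\<Sum>i\<in>UNIV. \<Sum>j\<in>UNIV. \<bar>W $ i $ j\<bar>) \<le> (\<Sum>i\<in>(UNIV::'n set). \<Sum>j\<in>(UNIV::'n set). 1)"
    by (intro sum_mono)
  then show ?thesis using norm_matrix_le_l1[of W] by simp
qed

lemma tendsto_matrix_mult_transpose:
  fixes W :: "nat \<Rightarrow> real^'n^'m"
  assumes "W \<longlonglongrightarrow> A"
  shows "(\<lambda>n. W n ** transpose (W n)) \<longlonglongrightarrow> A ** transpose A"
  by (intro vec_tendstoI) (simp add: matrix_matrix_mult_def transpose_def, intro tendsto_intros tendsto_vec_nth assms)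

text \<open>Different subsequences of the matrices may have different limits \<open>W\<close>; what
  must agree is the law of h (W Z). Every subsequence has a further one along which the bounded
  matrices converge, so the integrals converge to a common value.\<close>

lemma conv_distr_bounded_matrices:
  fixes O' :: "nat \<Rightarrow> real^'n^'n" and h :: "real^'n \<Rightarrow> 'c::metric_space"
  assumes P: "prob_space P" and Q: "prob_space Q" and Y: "conv_distr P Y Q Z"
    and mY: "\<And>n. Y n \<in> borel_measurable P" and mZ: "Z \<in> borel_measurable Q"
    and mX: "\<And>n. X n \<in> borel_measurable P"
    and X: "conv_prob_zero P (\<lambda>n \<omega>. X n \<omega> - O' n *v Y n \<omega>)"
    and O: "\<And>n. norm (O' n) \<le> c" and h: "continuous_on UNIV h"
    and lim: "\<And>r W f. strict_mono r \<Longrightarrow> (\<lambda>k. O' (r k)) \<longlonglongrightarrow> W \<Longrightarrow> continuous_on UNIV f \<Longrightarrow>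
       (\<integral>\<omega>. f (h (W *v Z \<omega>)) \<partial>Q) = (\<integral>\<omega>. f (V \<omega>) \<partial>Q :: real)"
  shows "conv_distr P (\<lambda>n \<omega>. h (X n \<omega>)) Q V"
  unfolding conv_distr_def
proof (intro allI impI, elim conjE)
  fix f :: "'c \<Rightarrow> real" assume f: "continuous_on UNIV f" "bounded (range f)"
  show "(\<lambda>n. \<integral>\<omega>. f (h (X n \<omega>)) \<partial>P) \<longlonglongrightarrow> (\<integral>\<omega>. f (V \<omega>) \<partial>Q)"
  proof (rule convergent_subsequences_tendsto)
    fix r :: "nat \<Rightarrow> nat" assume r: "strict_mono r"
    have "\<forall>k. O' (r k) \<in> cball 0 c" using O by simp
    then obtain W s where s: "strict_mono s" "((\<lambda>k. O' (r k)) \<circ> s) \<longlonglongrightarrow> W"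
      using compact_cball[of "0 :: real^'n^'n" c, unfolded compact_def, THEN spec[of _ "\<lambda>k. O' (r k)"]] by blast
    have rs: "strict_mono (\<lambda>k. r (s k))" using strict_mono_o[OF r s(1)] by (simp add: o_def)
    have W: "(\<lambda>k. O' (r (s k))) \<longlonglongrightarrow> W" using s(2) by (simp add: o_def)
    have "conv_distr P (\<lambda>k. X (r (s k))) Q (\<lambda>\<omega>. W *v Z \<omega>)"
      by (rule conv_distr_matrix_limit[OF P Q conv_distr_subseq[OF Y rs] mY mZ mX conv_prob_zero_subseq[OF X rs] W])
    from conv_distr_continuous_map[OF this h]
    have "(\<lambda>k. \<integral>\<omega>. f (h (X (r (s k)) \<omega>)) \<partial>P) \<longlonglongrightarrow> (\<integral>\<omega>. f (h (W *v Z \<omega>)) \<partial>Q)"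
      using f unfolding conv_distr_def by blast
    then show "\<exists>s. strict_mono s \<and> (\<lambda>k. \<integral>\<omega>. f (h (X (r (s k)) \<omega>)) \<partial>P) \<longlonglongrightarrow> (\<integral>\<omega>. f (V \<omega>) \<partial>Q)"
      using s(1) lim[OF rs W f(1)] by (intro exI[of _ s]) simp
  qed
qed

text \<open>The deterministic core of the first claim: for \<open>z\<close> in a fixed ball the
  error is at most |\<Gamma>| K (|B| R/\<delta>)^2 in operator norms, which is a multiple of the
  quantity that the hypothesis on \<Gamma> sends to 0.\<close>

lemma linearization_error:
  fixes M :: "(real^'n) set" and B \<Gamma> :: "nat \<Rightarrow> real^'n^'n"
  assumes M: "compact M" "submanifold m M" and D: "D > 0"
    and t: "\<And>n. t n \<notin> cutlocus M" "\<And>n. infdist (t n) M \<le> D"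
    and B: "(\<lambda>n. onorm ((*v) (B n)) / infdist (t n) (cutlocus M)) \<longlonglongrightarrow> 0"
    and \<Gamma>: "(\<lambda>n. onorm ((*v) (\<Gamma> n)) * (onorm ((*v) (B n)))\<^sup>2 / (infdist (t n) (cutlocus M))\<^sup>2) \<longlonglongrightarrow> 0"
    and R: "R > 0" and e: "e > 0"
  shows "\<forall>\<^sub>F n in sequentially. \<forall>z. norm z \<le> R \<longrightarrow>
    norm (\<Gamma> n *v ((mat 1 - weingarten_tan M (nearest M (t n)) (t n - nearest M (t n))) *v
         (nearest M (t n + B n *v z) - nearest M (t n)))
       - (\<Gamma> n ** tanproj M (nearest M (t n)) ** B n) *v z) \<le> e"
proof (cases "cutlocus M = {}")
  \<comment> \<open>\<open>infdist\<close> to an empty set is 0 and division by 0 gives 0, so no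
    rate is available. But \<open>M\<close> is then a single point with tangent space 0, and both
    terms of the difference vanish.\<close>
  case True
  have "nearest M (t 0) \<in> M" using is_nearest_nearest[OF t(1)] unfolding is_nearest_def by blast
  then have "\<exists>p. M = {p}" using empty_cutlocus[OF M True] by blast
  then obtain p where p: "M = {p}" by blast
  have n: "nearest M y = p" for y
    using is_nearest_nearest[of y M] True p unfolding is_nearest_def by blast
  have "tanproj M p *v x = 0" for x using tanproj_singleton M(2) unfolding p by blast
  then show ?thesis using e by (simp add: n matrix_vector_mul_assoc[symmetric])
next
  case False
  obtain \<epsilon> K where \<epsilon>: "\<epsilon> > 0" and K: "K \<ge> 0" and est:
    "\<And>x y. x \<notin> cutlocus M \<Longrightarrow> infdist x M \<le> D \<Longrightarrow> norm (y - x) \<le> \<epsilon> * infdist x (cutlocus M) \<Longrightarrow>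
       norm ((mat 1 - weingarten_tan M (nearest M x) (x - nearest M x)) *v (nearest M y - nearest M x)
          - tanproj M (nearest M x) *v (y - x)) \<le> K * (norm (y - x) / infdist x (cutlocus M))^2"
    using main_estimate[OF M less_imp_le[OF D] False] by metis
  have "\<forall>\<^sub>F n in sequentially. onorm ((*v) (B n)) / infdist (t n) (cutlocus M) < \<epsilon> / R"
    using B \<epsilon> R by (intro order_tendstoD) auto
  \<comment> \<open>K R^2 is the factor of the rate in the error bound below; the 1 covers K =
    0.\<close>
  moreover have "\<forall>\<^sub>F n in sequentially. onorm ((*v) (\<Gamma> n)) * (onorm ((*v) (B n)))\<^sup>2 / (infdist (t n) (cutlocus M))\<^sup>2 < e / (K * R^2 + 1)"
    using \<Gamma> e K by (intro order_tendstoD) (auto simp: add_nonneg_pos)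
  ultimately show ?thesis
  proof eventually_elim
    case (elim n)
    define \<delta> \<beta> \<gamma> where "\<delta> = infdist (t n) (cutlocus M)" and "\<beta> = onorm ((*v) (B n))" and "\<gamma> = onorm ((*v) (\<Gamma> n))"
    have \<delta>: "\<delta> > 0" unfolding \<delta>_def by (rule infdist_pos_not_in_closed[OF closed_cutlocus[OF M] False t(1)])
    have bB: "norm (B n *v x) \<le> \<beta> * norm x" "norm (\<Gamma> n *v x) \<le> \<gamma> * norm x" for x
      unfolding \<beta>_def \<gamma>_def by (rule onorm[OF matrix_vector_mul_bounded_linear])+
    have pos: "\<beta> \<ge> 0" "\<gamma> \<ge> 0" unfolding \<beta>_def \<gamma>_def by (rule onorm_pos_le[OF matrix_vector_mul_bounded_linear])+
    have 1: "\<beta> * R \<le> \<epsilon> * \<delta>" using elim(1) \<delta> R unfolding \<delta>_def[symmetric] \<beta>_def[symmetric] by (simp add: field_simps)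
    have 2: "\<gamma> * \<beta>^2 / \<delta>^2 * (K * R^2 + 1) \<le> e"
      using elim(2) K unfolding \<delta>_def[symmetric] \<beta>_def[symmetric] \<gamma>_def[symmetric]
      by (simp add: pos_less_divide_eq add_nonneg_pos)
    show ?case
    proof (intro allI impI)
      fix z :: "real^'n" assume z: "norm z \<le> R"
      define x y where "x = t n" and "y = t n + B n *v z"
      define E where "E = (mat 1 - weingarten_tan M (nearest M x) (x - nearest M x)) *v (nearest M y - nearest M x)
          - tanproj M (nearest M x) *v (y - x)"
      have yx: "norm (y - x) \<le> \<beta> * R" unfolding y_def x_def using bB(1)[of z] mult_left_mono[OF z pos(1)] by simp
      have "norm E \<le> K * (norm (y - x) / \<delta>)^2" unfolding E_def \<delta>_def x_def
        by (rule est[OF t]) (use yx 1 in \<open>simp add: \<delta>_def x_def\<close>)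
      also have "\<dots> \<le> K * (\<beta> * R / \<delta>)^2" using yx K \<delta> by (intro mult_left_mono power_mono divide_right_mono) auto
      finally have "norm E \<le> K * (\<beta> * R / \<delta>)^2" .
      then have "norm (\<Gamma> n *v E) \<le> \<gamma> * (K * (\<beta> * R / \<delta>)^2)" using bB(2)[of E] pos(2) mult_left_mono order_trans by blast
      also have "\<dots> = \<gamma> * \<beta>^2 / \<delta>^2 * (K * R^2)" by (simp add: power_divide power_mult_distrib)
      also have "\<dots> \<le> \<gamma> * \<beta>^2 / \<delta>^2 * (K * R^2 + 1)" using pos by (intro mult_left_mono) auto
      also have "\<dots> \<le> e" by (rule 2)
      finally have "norm (\<Gamma> n *v E) \<le> e" .
      moreover have "\<Gamma> n *v E = \<Gamma> n *v ((mat 1 - weingarten_tan M (nearest M (t n)) (t n - nearest M (t n))) *v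
         (nearest M (t n + B n *v z) - nearest M (t n))) - (\<Gamma> n ** tanproj M (nearest M (t n)) ** B n) *v z"
        unfolding E_def x_def y_def by (simp add: matrix_vector_mult_diff_distrib[of "\<Gamma> n"] matrix_vector_mul_assoc[symmetric])
      ultimately show "norm (\<Gamma> n *v ((mat 1 - weingarten_tan M (nearest M (t n)) (t n - nearest M (t n))) *v
         (nearest M (t n + B n *v z) - nearest M (t n))) - (\<Gamma> n ** tanproj M (nearest M (t n)) ** B n) *v z) \<le> e" by simp
    qed
  qed
qed

theorem theorem2p2:
  fixes M :: "(real^'n) set" and m :: nat
    and P :: "'a measure" and Q :: "'b measure"
    and t :: "nat \<Rightarrow> real^'n" and tt :: "nat \<Rightarrow> 'a \<Rightarrow> real^'n"
    and B \<Gamma> :: "nat \<Rightarrow> real^'n^'n" and Z :: "'b \<Rightarrow> real^'n" and D :: real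
  defines "Zn \<equiv> \<lambda>n \<omega>. matrix_inv (B n) *v (tt n \<omega> - t n)"
    and "\<mu>n \<equiv> \<lambda>n. nearest M (t n)"
    and "\<mu>t \<equiv> \<lambda>n \<omega>. nearest M (tt n \<omega>)"
    and "G \<equiv> \<lambda>n. mat 1 - weingarten_tan M (nearest M (t n)) (t n - nearest M (t n))"
  assumes "compact M" and "submanifold m M"
    and "prob_space P" and "prob_space Q"
    and "\<forall>n. tt n \<in> borel_measurable P" and "Z \<in> borel_measurable Q"
    and "\<forall>n. invertible (B n)" and "B \<longlonglongrightarrow> 0"
    and "conv_distr P Zn Q Z"
    and "\<forall>n. t n \<notin> cutlocus M"
    and "D > 0" and "\<forall>n. infdist (t n) M \<le> D"
    and "(\<lambda>n. onorm ((*v) (B n)) / infdist (t n) (cutlocus M)) \<longlonglongrightarrow> 0"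
    and "(\<lambda>n. onorm ((*v) (\<Gamma> n)) * (onorm ((*v) (B n)))\<^sup>2
              / (infdist (t n) (cutlocus M))\<^sup>2) \<longlonglongrightarrow> 0"
  shows "conv_prob_zero P (\<lambda>n \<omega>. \<Gamma> n *v (G n *v (\<mu>t n \<omega> - \<mu>n n))
                                 - (\<Gamma> n ** tanproj M (\<mu>n n) ** B n) *v Zn n \<omega>)
       \<and> (spherical Q Z \<and>
          (\<forall>n. \<Gamma> n ** tanproj M (\<mu>n n) ** B n ** transpose (B n) ** tanproj M (\<mu>n n)
                 ** transpose (\<Gamma> n) = tanproj M (\<mu>n n))
          \<longrightarrow>
            (\<forall>\<mu>\<in>M. \<mu>n \<longlonglongrightarrow> \<mu> \<longrightarrow>
               conv_distr P (\<lambda>n \<omega>. (\<Gamma> n ** tanproj M (\<mu>n n) ** B n) *v Zn n \<omega>)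
                          Q (\<lambda>\<omega>. tanproj M \<mu> *v Z \<omega>)
             \<and> conv_distr P (\<lambda>n \<omega>. \<Gamma> n *v (G n *v (\<mu>t n \<omega> - \<mu>n n)))
                          Q (\<lambda>\<omega>. tanproj M \<mu> *v Z \<omega>))
          \<and> (\<forall>I :: 'n set. card I = m \<longrightarrow>
               conv_distr P (\<lambda>n \<omega>. (\<mu>t n \<omega> - \<mu>n n) \<bullet>
                   ((G n ** transpose (\<Gamma> n) ** \<Gamma> n ** G n) *v (\<mu>t n \<omega> - \<mu>n n)))
                 Q (\<lambda>\<omega>. \<Sum>i\<in>I. (Z \<omega> $ i)\<^sup>2)))"
proof -
  note M = assms(5,6)
  note P = assms(7)
  note Q = assms(8)
  note mtt = assms(9)[rule_format]
  note mZ = assms(10)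
  note inv = assms(11)[rule_format]
  note conv = assms(13)
  note tC = assms(14)[rule_format]
  define X where "X n \<omega> = \<Gamma> n *v (G n *v (\<mu>t n \<omega> - \<mu>n n))" for n \<omega>
  define W where "W n = \<Gamma> n ** tanproj M (\<mu>n n) ** B n" for n
  have mZn: "Zn n \<in> borel_measurable P" for n
    unfolding Zn_def by (intro measurable_matrix_vector borel_measurable_diff mtt) simp
  have mX: "X n \<in> borel_measurable P" for n
    unfolding X_def \<mu>t_def
    by (intro measurable_matrix_vector borel_measurable_diff measurable_compose[OF mtt borel_measurable_nearest[OF M]]) simp
  have mWZ: "(\<lambda>\<omega>. W n *v Zn n \<omega>) \<in> borel_measurable P" for n by (rule measurable_matrix_vector[OF mZn])
  have right_inverse: "B n ** matrix_inv (B n) = mat 1" for n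
    using someI_ex[OF inv[of n, unfolded invertible_def]] unfolding matrix_inv_def by blast
  \<comment> \<open>Invertibility of \<open>B n\<close> recovers the random point from
    \<open>Zn\<close>, so the deterministic bound applies with z = Zn.\<close>
  have BZ: "t n + B n *v Zn n \<omega> = tt n \<omega>" for n \<omega>
    unfolding Zn_def using right_inverse[of n] by (simp add: matrix_vector_mul_assoc)
  have \<mu>M: "\<mu>n n \<in> M" and \<mu>near: "is_nearest M (t n) (\<mu>n n)" for n
    unfolding \<mu>n_def using is_nearest_nearest[OF tC] by (auto simp: is_nearest_def)
  note T = subspace_tangent_space[OF M(2) \<mu>M]
  have part1: "conv_prob_zero P (\<lambda>n \<omega>. X n \<omega> - W n *v Zn n \<omega>)"
  proof (rule conv_prob_zero_tight[OF conv_distr_tight[OF conv P Q mZn mZ] mZn])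
    fix R e :: real assume "R > 0" "e > 0"
    from linearization_error[OF M assms(15) tC assms(16)[rule_format] assms(17,18) this]
    show "\<forall>\<^sub>F n in sequentially. \<forall>\<omega>. norm (Zn n \<omega>) \<le> R \<longrightarrow> norm (X n \<omega> - W n *v Zn n \<omega>) \<le> e"
    proof eventually_elim
      case (elim n)
      show ?case
      proof (intro allI impI)
        fix \<omega> assume "norm (Zn n \<omega>) \<le> R"
        from elim[rule_format, OF this] show "norm (X n \<omega> - W n *v Zn n \<omega>) \<le> e"
          unfolding BZ X_def W_def G_def \<mu>t_def \<mu>n_def .
      qed
    qed
  qed
  have rest: "(\<forall>\<mu>\<in>M. \<mu>n \<longlonglongrightarrow> \<mu> \<longrightarrow>
               conv_distr P (\<lambda>n \<omega>. W n *v Zn n \<omega>) Q (\<lambda>\<omega>. tanproj M \<mu> *v Z \<omega>)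
             \<and> conv_distr P X Q (\<lambda>\<omega>. tanproj M \<mu> *v Z \<omega>))
          \<and> (\<forall>I :: 'n set. card I = m \<longrightarrow>
               conv_distr P (\<lambda>n \<omega>. (\<mu>t n \<omega> - \<mu>n n) \<bullet>
                   ((G n ** transpose (\<Gamma> n) ** \<Gamma> n ** G n) *v (\<mu>t n \<omega> - \<mu>n n)))
                 Q (\<lambda>\<omega>. \<Sum>i\<in>I. (Z \<omega> $ i)\<^sup>2))"
    if sph: "spherical Q Z" and \<Gamma>: "\<forall>n. \<Gamma> n ** tanproj M (\<mu>n n) ** B n ** transpose (B n) ** tanproj M (\<mu>n n)
                 ** transpose (\<Gamma> n) = tanproj M (\<mu>n n)"
  proof -
    have WW: "W n ** transpose (W n) = tanproj M (\<mu>n n)" for n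
    proof -
      have "W n ** transpose (W n) = \<Gamma> n ** tanproj M (\<mu>n n) ** B n ** transpose (B n) ** tanproj M (\<mu>n n) ** transpose (\<Gamma> n)"
        unfolding W_def by (simp add: matrix_transpose_mul tanproj_transpose[OF T] matrix_mul_assoc)
      then show ?thesis using \<Gamma> by simp
    qed
    have Wb: "norm (W n) \<le> real CARD('n) * real CARD('n)" for n
    proof (rule norm_projection_root_le[OF WW])
      fix x
      have "x \<bullet> (tanproj M (\<mu>n n) *v x) \<le> norm x * norm (tanproj M (\<mu>n n) *v x)" by (rule norm_cauchy_schwarz)
      also have "\<dots> \<le> norm x * norm x" by (intro mult_left_mono norm_tanproj_le[OF T]) auto
      finally show "x \<bullet> (tanproj M (\<mu>n n) *v x) \<le> (norm x)^2" by (simp add: power2_eq_square)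
    qed
    have idem: "tanproj M \<mu> ** tanproj M \<mu> = tanproj M \<mu>" if "\<mu> \<in> M" for \<mu>
      using tanproj_idem[OF subspace_tangent_space[OF M(2) that]] by (simp add: matrix_eq matrix_vector_mul_assoc[symmetric])
    have WWlim: "A ** transpose A = tanproj M \<mu>"
      if "strict_mono r" "(\<lambda>k. W (r k)) \<longlonglongrightarrow> A" "(\<lambda>k. \<mu>n (r k)) \<longlonglongrightarrow> \<mu>" "\<mu> \<in> M" for r A \<mu>
      using LIMSEQ_unique[OF tendsto_matrix_mult_transpose[OF that(2)]]
        tanproj_tendsto[OF M, of "\<lambda>k. \<mu>n (r k)" \<mu>] that \<mu>M WW by simp
    \<comment> \<open>Lets \<open>part2\<close>, stated for sequences close to W n Zn, be applied to
      W n Zn itself.\<close>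
    have zero: "conv_prob_zero P (\<lambda>n \<omega>. W n *v Zn n \<omega> - W n *v Zn n \<omega>)"
      unfolding conv_prob_zero_def by (auto intro!: always_eventually bexI[of _ "{}"])
    have part2: "conv_distr P X' Q (\<lambda>\<omega>. tanproj M \<mu> *v Z \<omega>)"
      if \<mu>: "\<mu> \<in> M" "\<mu>n \<longlonglongrightarrow> \<mu>" and X': "\<And>n. X' n \<in> borel_measurable P" "conv_prob_zero P (\<lambda>n \<omega>. X' n \<omega> - W n *v Zn n \<omega>)"
      for \<mu> X'
    proof (rule conv_distr_bounded_matrices[where h="\<lambda>x. x", OF P Q conv mZn mZ X' Wb])
      fix r A and f :: "real^'n \<Rightarrow> real"
      assume r: "strict_mono r" "(\<lambda>k. W (r k)) \<longlonglongrightarrow> A" and f: "continuous_on UNIV f"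
      have "A ** transpose A = tanproj M \<mu>"
        using WWlim[OF r _ \<mu>(1)] LIMSEQ_subseq_LIMSEQ[OF \<mu>(2) r(1)] by (simp add: o_def)
      from spherical_projection_root[OF sph mZ this idem[OF \<mu>(1)] f]
      show "(\<integral>\<omega>. f (A *v Z \<omega>) \<partial>Q) = (\<integral>\<omega>. f (tanproj M \<mu> *v Z \<omega>) \<partial>Q)" .
    qed (rule continuous_on_id)
    have part3: "conv_distr P (\<lambda>n \<omega>. (norm (X n \<omega>))^2) Q (\<lambda>\<omega>. \<Sum>i\<in>I. (Z \<omega> $ i)\<^sup>2)" if I: "card I = m" for I :: "'n set"
    proof (rule conv_distr_bounded_matrices[where h="\<lambda>x. (norm x)^2", OF P Q conv mZn mZ mX part1 Wb])
      show "continuous_on UNIV (\<lambda>x :: real^'n. (norm x)^2)" by (intro continuous_intros)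
      fix r A and f :: "real \<Rightarrow> real"
      assume r: "strict_mono r" "(\<lambda>k. W (r k)) \<longlonglongrightarrow> A" and f: "continuous_on UNIV f"
      \<comment> \<open>\<open>\<mu>n\<close> may fail to converge, but compactness of
        \<open>M\<close> gives a further subsequence along which it does. The matrix limit
        \<open>A\<close> is unchanged, and the law of |A Z|^2 depends on \<mu> only through the
        dimension m.\<close>
      obtain \<mu> s where \<mu>: "\<mu> \<in> M" and s: "strict_mono s" "((\<lambda>k. \<mu>n (r k)) \<circ> s) \<longlonglongrightarrow> \<mu>"
        using M(1) \<mu>M unfolding compact_def by (meson)
      have "A ** transpose A = tanproj M \<mu>"
        using WWlim[of "\<lambda>k. r (s k)" A \<mu>] strict_mono_o[OF r(1) s(1)] LIMSEQ_subseq_LIMSEQ[OF r(2) s(1)] s(2) \<mu>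
        by (simp add: o_def)
      moreover have "continuous_on UNIV (\<lambda>x :: real^'n. f ((norm x)^2))"
        by (intro continuous_on_compose2[OF f] continuous_intros) auto
      ultimately have "(\<integral>\<omega>. f ((norm (A *v Z \<omega>))^2) \<partial>Q) = (\<integral>\<omega>. f ((norm (tanproj M \<mu> *v Z \<omega>))^2) \<partial>Q)"
        by (rule spherical_projection_root[OF sph mZ _ idem[OF \<mu>]])
      also have "\<dots> = (\<integral>\<omega>. f (\<Sum>i\<in>I. (Z \<omega> $ i)^2) \<partial>Q)"
      proof (rule spherical_projection_norm[OF sph mZ _ _ _ _ f])
        note T' = subspace_tangent_space[OF M(2) \<mu>]
        show "subspace (tangent_space M \<mu>)" by (rule T')
        show "tanproj M \<mu> *v x \<in> tangent_space M \<mu>" for x by (rule tanproj_in[OF T'])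
        show "w \<in> tangent_space M \<mu> \<Longrightarrow> (x - tanproj M \<mu> *v x) \<bullet> w = 0" for x w
          using tanproj_normal[OF T', of x] unfolding normal_space_def by blast
        show "dim (tangent_space M \<mu>) = card I" using dim_tangent_space[OF M(2) \<mu>] I by simp
      qed
      finally show "(\<integral>\<omega>. f ((norm (A *v Z \<omega>))^2) \<partial>Q) = (\<integral>\<omega>. f (\<Sum>i\<in>I. (Z \<omega> $ i)^2) \<partial>Q)" .
    qed
    \<comment> \<open>Symmetry moves the left factor of the quadratic form to the other side, so
      that the form is |X|^2.\<close>
    have Gsym: "x \<bullet> (G n *v y) = (G n *v x) \<bullet> y" for n x y
    proof -
      have "x \<bullet> (weingarten_tan M (\<mu>n n) (t n - \<mu>n n) *v y) = y \<bullet> (weingarten_tan M (\<mu>n n) (t n - \<mu>n n) *v x)"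
        by (rule weingarten_symmetric[OF M(2) \<mu>M nearest_normal[OF \<mu>near]])
      then show ?thesis unfolding G_def \<mu>n_def
        by (simp add: matrix_vector_mult_diff_rdistrib inner_diff_left inner_diff_right inner_commute)
    qed
    have tr: "a \<bullet> (transpose (\<Gamma> n) *v b) = (\<Gamma> n *v a) \<bullet> b" for n a b
      using dot_lmul_matrix[of b "\<Gamma> n" a] by (simp add: inner_commute)
    have "(\<mu>t n \<omega> - \<mu>n n) \<bullet> ((G n ** transpose (\<Gamma> n) ** \<Gamma> n ** G n) *v (\<mu>t n \<omega> - \<mu>n n)) = (norm (X n \<omega>))^2" for n \<omega>
      unfolding X_def power2_norm_eq_inner
      by (simp only: matrix_vector_mul_assoc[symmetric] Gsym tr)
    then show ?thesis using part2 part3 mX mWZ part1 zero by auto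
  qed
  show ?thesis using part1 rest unfolding X_def[abs_def] W_def by blast
qed

end
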